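(* Let $t$ be a positive integer and let $G$ be a finite simple graph. (i) If $G$ has no $K_t$ topological minor, then $G$ is dynamically $(10t^2+2)$-colorable. (ii) If $G$ has no $K_t$ minor, then $G$ is dynamically $(\lfloor 16t\sqrt{\log_2 t}\rfloor+3)$-colorable.
   Context: All graphs are finite and simple. A graph $H$ is a topological minor of $G$ if $G$ has a subgraph isomorphic to a subdivision of $H$. Given a proper vertex coloring of a graph, a vertex $v$ is happy if either $v$ has at most one neighbor or $v$ has two neighbors receiving distinct colors. A dynamic $m$-coloring is a proper vertex coloring with at most $m$ colors in which every vertex is happy; a graph is dynamically $m$-colorable if it has one. *)

theory Defs
  imports Complex_Main
begin

definition simple_graph :: "'a set \<Rightarrow> ('a \<Rightarrow> 'a \<Rightarrow> bool) \<Rightarrow> bool" where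
  "simple_graph V E \<longleftrightarrow> finite V \<and> (\<forall>u v. E u v \<longrightarrow> E v u) \<and> (\<forall>u. \<not> E u u)
     \<and> (\<forall>u v. E u v \<longrightarrow> u \<in> V \<and> v \<in> V)"

definition neighbors :: "'a set \<Rightarrow> ('a \<Rightarrow> 'a \<Rightarrow> bool) \<Rightarrow> 'a \<Rightarrow> 'a set" where
  "neighbors V E v = {u \<in> V. E v u}"

definition is_path :: "'a set \<Rightarrow> ('a \<Rightarrow> 'a \<Rightarrow> bool) \<Rightarrow> 'a list \<Rightarrow> bool" where
  "is_path V E p \<longleftrightarrow> p \<noteq> [] \<and> distinct p \<and> set p \<subseteq> V
     \<and> (\<forall>k. Suc k < length p \<longrightarrow> E (p ! k) (p ! Suc k))"

definition internal :: "'a list \<Rightarrow> 'a set" where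
  "internal p = set (butlast (tl p))"

definition has_Kt_topological_minor :: "'a set \<Rightarrow> ('a \<Rightarrow> 'a \<Rightarrow> bool) \<Rightarrow> nat \<Rightarrow> bool" where
  "has_Kt_topological_minor V E t \<longleftrightarrow>
    (\<exists>f P. inj_on f {..<t} \<and> f ` {..<t} \<subseteq> V \<and>
      (\<forall>i j. i < j \<and> j < t \<longrightarrow>
          is_path V E (P i j) \<and> hd (P i j) = f i \<and> last (P i j) = f j
          \<and> internal (P i j) \<inter> f ` {..<t} = {}) \<and>
      (\<forall>i j k l. i < j \<and> j < t \<and> k < l \<and> l < t \<and> (i, j) \<noteq> (k, l) \<longrightarrow>
          internal (P i j) \<inter> internal (P k l) = {}))"

definition connected_set :: "('a \<Rightarrow> 'a \<Rightarrow> bool) \<Rightarrow> 'a set \<Rightarrow> bool" where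
  "connected_set E B \<longleftrightarrow>
    (\<forall>x\<in>B. \<forall>y\<in>B. (\<lambda>u v. u \<in> B \<and> v \<in> B \<and> E u v)\<^sup>*\<^sup>* x y)"

definition has_Kt_minor :: "'a set \<Rightarrow> ('a \<Rightarrow> 'a \<Rightarrow> bool) \<Rightarrow> nat \<Rightarrow> bool" where
  "has_Kt_minor V E t \<longleftrightarrow>
    (\<exists>B :: nat \<Rightarrow> 'a set.
      (\<forall>i<t. B i \<noteq> {} \<and> B i \<subseteq> V \<and> connected_set E (B i)) \<and>
      (\<forall>i<t. \<forall>j<t. i \<noteq> j \<longrightarrow> B i \<inter> B j = {}) \<and>
      (\<forall>i<t. \<forall>j<t. i \<noteq> j \<longrightarrow> (\<exists>u\<in>B i. \<exists>v\<in>B j. E u v)))"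

definition proper_coloring :: "'a set \<Rightarrow> ('a \<Rightarrow> 'a \<Rightarrow> bool) \<Rightarrow> ('a \<Rightarrow> nat) \<Rightarrow> bool" where
  "proper_coloring V E c \<longleftrightarrow> (\<forall>u\<in>V. \<forall>v\<in>V. E u v \<longrightarrow> c u \<noteq> c v)"

definition happy :: "'a set \<Rightarrow> ('a \<Rightarrow> 'a \<Rightarrow> bool) \<Rightarrow> ('a \<Rightarrow> nat) \<Rightarrow> 'a \<Rightarrow> bool" where
  "happy V E c v \<longleftrightarrow> card (neighbors V E v) \<le> 1 \<or>
     (\<exists>x\<in>neighbors V E v. \<exists>y\<in>neighbors V E v. c x \<noteq> c y)"

definition dynamic_coloring :: "'a set \<Rightarrow> ('a \<Rightarrow> 'a \<Rightarrow> bool) \<Rightarrow> nat \<Rightarrow> ('a \<Rightarrow> nat) \<Rightarrow> bool" where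
  "dynamic_coloring V E m c \<longleftrightarrow> proper_coloring V E c \<and> card (c ` V) \<le> m
     \<and> (\<forall>v\<in>V. happy V E c v)"

definition dynamically_colorable :: "'a set \<Rightarrow> ('a \<Rightarrow> 'a \<Rightarrow> bool) \<Rightarrow> nat \<Rightarrow> bool" where
  "dynamically_colorable V E m \<longleftrightarrow> (\<exists>c. dynamic_coloring V E m c)"

end

theory Submission
  imports Defs
begin

text \<open>Both parts rest on a colouring argument for a class of graphs that is closed under deleting a vertex
  \<open>v\<close> and under replacing \<open>v\<close> by an edge \<open>xy\<close> between two of its neighbours. If every nonempty member has
  a vertex of degree at most \<open>d\<close>, then all members are dynamically \<open>(d + 3)\<close>-colourable: for \<open>v\<close> of minimum
  degree, colour the smaller graph, in which \<open>x\<close> and \<open>y\<close> get distinct colours, and give \<open>v\<close> a colour different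
  from those of its neighbours and of one further neighbour of each of \<open>x\<close> and \<open>y\<close>.

  For minors, an edge-minimal dense minor has dense neighbourhoods. Applied with a linear and then with
  an \<open>n ln n\<close> potential this gives a graph on \<open>n\<close> vertices of minimum degree \<open>(n + b) / 2\<close> with
  \<open>b\<close> about \<open>3 t sqrt (log 2 t)\<close>, in which branch sets are chosen greedily as random tuples
  connected through common neighbours.

  For topological minors, a graph of minimum degree \<open>10 t\<^sup>2\<close> has a \<open>t\<^sup>2\<close>-connected dense subgraph (Mader), where
  every set of \<open>t\<^sup>2\<close> vertices is linked by the argument of Thomas and Wollan. Link up private
  neighbours of \<open>t\<close> branch vertices.\<close>

section \<open>Connected sets, contraction and edge counting\<close>

text \<open>In the colouring step the degree of \<open>v\<close> is minimal because the neighbours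
  of \<open>v\<close> other than \<open>x\<close> and \<open>y\<close> must stay happy: their degree
  is then at least 3, so two of their neighbours survive the deletion of \<open>v\<close>. In the
  minor part the linear potential stops at a graph with \<open>D + 1\<close> vertices and minimum
  degree half of that, where a greedy choice has no room. The second potential gains a surplus
  \<open>b = 0.185 (D + 1)\<close>; the ratio c = 0.185 is just below the limit set by c (1 + ln
  (1/c)) \<le> 1/2. Since 16 * 0.185 = 2.96, the surplus pays for \<open>t\<close> branch sets of
  \<open>2 * s - 1\<close> vertices with \<open>s\<close> near 1.48 sqrt (log 2 t). In the
  topological part the terminals \<open>X\<close> survive all reductions, so only edges with an end
  outside \<open>X\<close> count, and the induction carries a sparsity condition on small
  separations; without it \<open>X\<close> could be cut off from the dense part. Mader's step starts
  with 10 q ordered pairs per vertex; 2 q of them pay for its additive deficit and 8 q remain for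
  the linkage argument.\<close>

definition ugraph :: "('a \<Rightarrow> 'a \<Rightarrow> bool) \<Rightarrow> bool" where
  "ugraph E \<longleftrightarrow> (\<forall>u v. E u v \<longrightarrow> E v u) \<and> (\<forall>u. \<not> E u u)"

lemma ugraph_sym: "ugraph E \<Longrightarrow> E u v \<Longrightarrow> E v u"
  and ugraph_irrefl: "ugraph E \<Longrightarrow> \<not> E u u"
  by (auto simp: ugraph_def)

abbreviation reach_in :: "('a \<Rightarrow> 'a \<Rightarrow> bool) \<Rightarrow> 'a set \<Rightarrow> 'a \<Rightarrow> 'a \<Rightarrow> bool" where
  "reach_in E B \<equiv> (\<lambda>u v. u \<in> B \<and> v \<in> B \<and> E u v)\<^sup>*\<^sup>*"

lemma reach_in_sym:
  assumes "ugraph E" "reach_in E B x y" shows "reach_in E B y x"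
  using assms(2)
proof (induction rule: rtranclp_induct)
  case (step y z)
  then have "z \<in> B \<and> y \<in> B \<and> E z y" using ugraph_sym[OF assms(1)] by blast
  then show ?case using step.IH by (rule converse_rtranclp_into_rtranclp)
qed simp

lemma reach_in_mono:
  assumes "reach_in E B x y" "B \<subseteq> C" "\<And>u v. u \<in> B \<Longrightarrow> v \<in> B \<Longrightarrow> E u v \<Longrightarrow> F u v"
  shows "reach_in F C x y"
  using assms(1) by (rule rtranclp_mono[THEN predicate2D, rotated]) (use assms(2,3) in auto)

lemma reach_in_closed: "reach_in E B x y \<Longrightarrow> x \<in> B \<Longrightarrow> y \<in> B"
  by (induction rule: rtranclp_induct) auto

lemma connected_setI_root:
  assumes "ugraph E" "\<And>x. x \<in> B \<Longrightarrow> reach_in E B r x"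
  shows "connected_set E B"
  unfolding connected_set_def
proof (intro ballI)
  fix x y assume "x \<in> B" "y \<in> B"
  then show "reach_in E B x y"
    by (rule_tac rtranclp_trans[OF reach_in_sym[OF assms(1) assms(2)] assms(2)])
qed

lemma connected_set_reach: "connected_set E B \<Longrightarrow> x \<in> B \<Longrightarrow> y \<in> B \<Longrightarrow> reach_in E B x y"
  by (simp add: connected_set_def)

lemma connected_set_singleton [simp]: "connected_set E {x}"
  by (simp add: connected_set_def)

lemma connected_set_cong:
  assumes "connected_set E B" "\<And>u v. u \<in> B \<Longrightarrow> v \<in> B \<Longrightarrow> E u v \<Longrightarrow> F u v"
  shows "connected_set F B"
  unfolding connected_set_def
proof (intro ballI)
  fix x y assume "x \<in> B" "y \<in> B"
  then show "reach_in F B x y"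
    by (rule reach_in_mono[OF connected_set_reach[OF assms(1)] subset_refl assms(2)])
qed

lemma connected_set_Un_edge:
  assumes g: "ugraph E" and A: "connected_set E A" and B: "connected_set E B"
    and e: "a \<in> A" "b \<in> B" "E a b \<or> a = b"
  shows "connected_set E (A \<union> B)"
proof (rule connected_setI_root[OF g, of _ a])
  fix x assume "x \<in> A \<union> B"
  have ab: "reach_in E (A \<union> B) a b" using e by auto
  from \<open>x \<in> A \<union> B\<close> show "reach_in E (A \<union> B) a x"
  proof
    assume "x \<in> A"
    then show ?thesis by (rule reach_in_mono[OF connected_set_reach[OF A e(1)]]) auto
  next
    assume "x \<in> B"
    then have "reach_in E (A \<union> B) b x"
      by (rule reach_in_mono[OF connected_set_reach[OF B e(2)]]) auto
    with ab show ?thesis by (rule rtranclp_trans)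
  qed
qed

lemma connected_set_Un:
  assumes "ugraph E" "connected_set E A" "connected_set E B" "A \<inter> B \<noteq> {}"
  shows "connected_set E (A \<union> B)"
  using connected_set_Un_edge[OF assms(1-3)] assms(4) by blast

lemma connected_set_insert:
  assumes "ugraph E" "connected_set E A" "a \<in> A" "E x a"
  shows "connected_set E (insert x A)"
  using connected_set_Un_edge[OF assms(1) connected_set_singleton assms(2), of x x a] assms(3,4) by simp

text \<open>Follow a walk from \<open>x\<close> towards \<open>y\<close> and stop at its first
  vertex in \<open>L\<close>: the part traversed is connected and meets \<open>L\<close> only there.
  Linkages are later truncated in this way where they enter a hub or a clique.\<close>

lemma connected_set_first_hit:
  assumes g: "ugraph E" and T: "connected_set E T" "x \<in> T" "y \<in> T" "y \<in> L"
  obtains T' z where "T' \<subseteq> T" "connected_set E T'" "x \<in> T'" "T' \<inter> L = {z}"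
proof -
  have "reach_in E T x y" using T by (simp add: connected_set_reach)
  then have "\<exists>T' z. T' \<subseteq> T \<and> connected_set E T' \<and> x \<in> T' \<and> T' \<inter> L = {z}"
  proof (induction rule: converse_rtranclp_induct)
    case base
    then show ?case using T by (intro exI[of _ "{y}"]) auto
  next
    case (step x x')
    then obtain T' z where T': "T' \<subseteq> T" "connected_set E T'" "x' \<in> T'" "T' \<inter> L = {z}" by blast
    show ?case
    proof (cases "x \<in> L")
      case True
      then show ?thesis using step by (intro exI[of _ "{x}"]) auto
    next
      case False
      have "connected_set E (insert x T')"
        using connected_set_insert[OF g T'(2,3)] step by blast
      then show ?thesis using T' step False by (intro exI[of _ "insert x T'"] exI[of _ z]) auto
    qed
  qed
  then show thesis using that by blast
qed

text \<open>The edge \<open>u v\<close> is contracted onto \<open>u\<close>; the relation is meant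
  to be used on \<open>V - {v}\<close>, where \<open>u\<close> inherits the neighbours of
  \<open>v\<close>.\<close>

definition contract :: "('a \<Rightarrow> 'a \<Rightarrow> bool) \<Rightarrow> 'a \<Rightarrow> 'a \<Rightarrow> 'a \<Rightarrow> 'a \<Rightarrow> bool" where
  "contract E u v = (\<lambda>a b. a \<noteq> v \<and> b \<noteq> v \<and> a \<noteq> b \<and> (E a b \<or> a = u \<and> E v b \<or> b = u \<and> E a v))"

lemma ugraph_contract: "ugraph E \<Longrightarrow> ugraph (contract E u v)"
  by (auto simp: ugraph_def contract_def)

text \<open>A step of the contracted graph that is not an edge of \<open>E\<close> leads from
  \<open>u\<close> to a neighbour of \<open>v\<close> or back, so it becomes a detour through
  \<open>v\<close>. Hence \<open>v\<close> is put back exactly where \<open>u\<close> is.\<close>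

lemma connected_set_uncontract:
  assumes g: "ugraph E" and uv: "E u v" and S: "connected_set (contract E u v) S" "v \<notin> S"
  shows "connected_set E (if u \<in> S then insert v S else S)" (is "connected_set E ?S")
proof -
  have r: "reach_in E ?S x y" if "reach_in (contract E u v) S x y" for x y
    using that
  proof (induction rule: rtranclp_induct)
    case (step y z)
    have yz: "y \<in> S" "z \<in> S" "contract E u v y z" using step by auto
    have "reach_in E ?S y z"
    proof (cases "E y z")
      case True
      then show ?thesis using yz by auto
    next
      case False
      then have "y = u \<and> E v z \<or> z = u \<and> E y v" using yz by (auto simp: contract_def)
      then have "(\<lambda>u' v'. u' \<in> ?S \<and> v' \<in> ?S \<and> E u' v') y v" "(\<lambda>u' v'. u' \<in> ?S \<and> v' \<in> ?S \<and> E u' v') v z"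
        using yz uv ugraph_sym[OF g] by auto
      then show ?thesis by (rule converse_rtranclp_into_rtranclp[OF _ r_into_rtranclp])
    qed
    with step.IH show ?case by (rule rtranclp_trans)
  qed simp
  show ?thesis
  proof (cases "u \<in> S")
    case True
    have "reach_in E (insert v S) u x" if "x \<in> insert v S" for x
    proof (cases "x = v")
      case True
      then show ?thesis using uv \<open>u \<in> S\<close> by auto
    next
      case False
      then show ?thesis using r[of u x] S that \<open>u \<in> S\<close> by (simp add: connected_set_def)
    qed
    then show ?thesis using connected_setI_root[OF g, of "insert v S" u] \<open>u \<in> S\<close> by simp
  next
    case False
    then show ?thesis using r S by (simp add: connected_set_def)
  qed
qed

text \<open>Edges are counted as ordered pairs, so each counts twice and
  \<open>incident_pairs V E V\<close> has the size of the degree sum. Every density threshold below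
  is therefore twice a number of edges per vertex. The parameter \<open>S\<close> makes it possible
  to ignore the edges inside a terminal set.\<close>

definition incident_pairs :: "'a set \<Rightarrow> ('a \<Rightarrow> 'a \<Rightarrow> bool) \<Rightarrow> 'a set \<Rightarrow> ('a \<times> 'a) set" where
  "incident_pairs V E S = {(u, v). u \<in> V \<and> v \<in> V \<and> E u v \<and> (u \<in> S \<or> v \<in> S)}"

lemma finite_incident_pairs [simp]: "finite V \<Longrightarrow> finite (incident_pairs V E S)"
  by (rule finite_subset[of _ "V \<times> V"]) (auto simp: incident_pairs_def)

lemma card_incident_pairs_UNIV:
  assumes "finite V"
  shows "card (incident_pairs V E V) = (\<Sum>v\<in>V. card (neighbors V E v))"
proof -
  have "incident_pairs V E V = (SIGMA v:V. neighbors V E v)"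
    by (auto simp: incident_pairs_def neighbors_def)
  then show ?thesis using assms by (simp add: neighbors_def)
qed

lemma card_incident_pairs_remove:
  assumes g: "ugraph E" and "finite V" "v \<in> V"
  shows "card (incident_pairs V E V) = card (incident_pairs (V - {v}) E (V - {v})) + 2 * card (neighbors V E v)"
proof -
  let ?N = "neighbors V E v"
  have fin: "finite ?N" using assms by (simp add: neighbors_def)
  have eq: "incident_pairs V E V = incident_pairs (V - {v}) E (V - {v}) \<union> ({v} \<times> ?N \<union> ?N \<times> {v})"
    using assms ugraph_sym[OF g] by (auto simp: incident_pairs_def neighbors_def)
  have d1: "incident_pairs (V - {v}) E (V - {v}) \<inter> ({v} \<times> ?N \<union> ?N \<times> {v}) = {}"
    by (auto simp: incident_pairs_def)
  have d2: "({v} \<times> ?N) \<inter> (?N \<times> {v}) = {}" using ugraph_irrefl[OF g] by (auto simp: neighbors_def)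
  show ?thesis unfolding eq using fin assms d1 d2
    by (simp add: card_Un_disjoint card_cartesian_product)
qed

lemma card_Un6_le: "card (A \<union> (B \<union> (C \<union> D \<union> (F \<union> G)))) \<le> card A + (card B + (card C + card D + (card F + card G)))"
  using card_Un_le[of A "B \<union> (C \<union> D \<union> (F \<union> G))"] card_Un_le[of B "C \<union> D \<union> (F \<union> G)"]
    card_Un_le[of "C \<union> D" "F \<union> G"] card_Un_le[of C D] card_Un_le[of F G] by linarith

text \<open>Besides the two pairs of \<open>u v\<close>, contraction loses an edge
  \<open>v w\<close> in two situations: \<open>u w\<close> is an edge already, so the two merge, or
  \<open>u\<close> and \<open>w\<close> both lie in \<open>X\<close>, so the new edge is no longer
  counted. All other edges at \<open>v\<close> move to \<open>u\<close> without loss.\<close>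

lemma card_incident_pairs_contract:
  assumes g: "ugraph E" and fin: "finite V" and uv: "u \<in> V" "v \<in> V" "E u v" "v \<notin> X"
  shows "card (incident_pairs V E (V - X)) \<le> card (incident_pairs (V - {v}) (contract E u v) (V - {v} - X)) + 2
     + 2 * card {w \<in> V. E v w \<and> w \<noteq> u \<and> (E u w \<or> u \<in> X \<and> w \<in> X)}"
proof -
  define C where "C = {w \<in> V. E v w \<and> w \<noteq> u \<and> (E u w \<or> u \<in> X \<and> w \<in> X)}"
  define D where "D = {w \<in> V. E v w \<and> w \<noteq> u \<and> \<not> (E u w \<or> u \<in> X \<and> w \<in> X)}"
  define A where "A = incident_pairs (V - {v}) E (V - {v} - X)"
  have irr: "\<And>x. \<not> E x x" by (rule ugraph_irrefl[OF g])
  then have ne: "u \<noteq> v" using uv by auto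
  have fC: "finite C" "finite D" using fin by (auto simp: C_def D_def)
  have fA: "finite A" using fin by (simp add: A_def)
  have "incident_pairs V E (V - X) \<subseteq> A \<union> ({(u, v), (v, u)} \<union> ({v} \<times> C \<union> C \<times> {v} \<union> ({v} \<times> D \<union> D \<times> {v})))"
    using uv ugraph_sym[OF g] by (auto simp: A_def C_def D_def incident_pairs_def)
  then have "card (incident_pairs V E (V - X)) \<le> card (A \<union> ({(u, v), (v, u)} \<union> ({v} \<times> C \<union> C \<times> {v} \<union> ({v} \<times> D \<union> D \<times> {v}))))"
    using fin fC fA by (intro card_mono) auto
  also have "\<dots> \<le> card A + (card {(u, v), (v, u)} + (card ({v} \<times> C) + card (C \<times> {v}) + (card ({v} \<times> D) + card (D \<times> {v}))))"
    by (rule card_Un6_le)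
  also have "\<dots> \<le> card A + 2 * card D + 2 + 2 * card C"
    using ne by (auto simp: card_cartesian_product)
  finally have 1: "card (incident_pairs V E (V - X)) \<le> card A + 2 * card D + 2 + 2 * card C" .
  have sub: "A \<union> ({u} \<times> D \<union> D \<times> {u}) \<subseteq> incident_pairs (V - {v}) (contract E u v) (V - {v} - X)"
    using uv irr ugraph_sym[OF g] by (auto simp: A_def C_def D_def incident_pairs_def contract_def)
  have d1: "A \<inter> ({u} \<times> D \<union> D \<times> {u}) = {}"
    using ugraph_sym[OF g] by (auto simp: A_def C_def D_def incident_pairs_def)
  have d2: "({u} \<times> D) \<inter> (D \<times> {u}) = {}" by (auto simp: D_def)
  have "card A + 2 * card D = card (A \<union> ({u} \<times> D \<union> D \<times> {u}))"
    using fin fC fA d1 d2 by (simp add: card_Un_disjoint card_cartesian_product)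
  also have "\<dots> \<le> card (incident_pairs (V - {v}) (contract E u v) (V - {v} - X))"
    using sub fin fA by (intro card_mono) auto
  finally show ?thesis using 1 unfolding C_def by linarith
qed

definition delete_edge :: "('a \<Rightarrow> 'a \<Rightarrow> bool) \<Rightarrow> 'a \<Rightarrow> 'a \<Rightarrow> 'a \<Rightarrow> 'a \<Rightarrow> bool" where
  "delete_edge E u v = (\<lambda>a b. E a b \<and> {a, b} \<noteq> {u, v})"

lemma ugraph_delete_edge: "ugraph E \<Longrightarrow> ugraph (delete_edge E u v)"
  by (auto simp: ugraph_def delete_edge_def insert_commute)

lemma delete_edge_imp: "delete_edge E u v a b \<Longrightarrow> E a b"
  by (simp add: delete_edge_def)

lemma card_incident_pairs_delete_edge:
  assumes g: "ugraph E" and fin: "finite V" and uv: "u \<in> V" "v \<in> V" "E u v" "u \<in> S \<or> v \<in> S"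
  shows "card (incident_pairs V E S) = card (incident_pairs V (delete_edge E u v) S) + 2"
proof -
  have ne: "u \<noteq> v" using g uv ugraph_irrefl by metis
  have "incident_pairs V E S = incident_pairs V (delete_edge E u v) S \<union> {(u, v), (v, u)}"
    using uv ugraph_sym[OF g] by (auto simp: incident_pairs_def delete_edge_def doubleton_eq_iff)
  moreover have "incident_pairs V (delete_edge E u v) S \<inter> {(u, v), (v, u)} = {}"
    by (auto simp: incident_pairs_def delete_edge_def)
  ultimately show ?thesis using fin ne by (simp add: card_Un_disjoint)
qed

section \<open>Minimal dense minors\<close>

lemma has_Kt_minorE:
  assumes "has_Kt_minor V E t"
  obtains B where "\<And>i. i < t \<Longrightarrow> B i \<noteq> {} \<and> B i \<subseteq> V \<and> connected_set E (B i)"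
    "\<And>i j. i < t \<Longrightarrow> j < t \<Longrightarrow> i \<noteq> j \<Longrightarrow> B i \<inter> B j = {}"
    "\<And>i j. i < t \<Longrightarrow> j < t \<Longrightarrow> i \<noteq> j \<Longrightarrow> \<exists>u\<in>B i. \<exists>v\<in>B j. E u v"
proof -
  from assms obtain B where "\<forall>i<t. B i \<noteq> {} \<and> B i \<subseteq> V \<and> connected_set E (B i)"
    "\<forall>i<t. \<forall>j<t. i \<noteq> j \<longrightarrow> B i \<inter> B j = {}" "\<forall>i<t. \<forall>j<t. i \<noteq> j \<longrightarrow> (\<exists>u\<in>B i. \<exists>v\<in>B j. E u v)"
    unfolding has_Kt_minor_def by auto
  then show thesis by (intro that[of B]) blast+
qed

lemma has_Kt_minor_mono:
  assumes "has_Kt_minor V E t" "V \<subseteq> V'" "\<And>u v. E u v \<Longrightarrow> E' u v"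
  shows "has_Kt_minor V' E' t"
proof -
  obtain B where B: "\<And>i. i < t \<Longrightarrow> B i \<noteq> {} \<and> B i \<subseteq> V \<and> connected_set E (B i)"
    "\<And>i j. i < t \<Longrightarrow> j < t \<Longrightarrow> i \<noteq> j \<Longrightarrow> B i \<inter> B j = {}"
    "\<And>i j. i < t \<Longrightarrow> j < t \<Longrightarrow> i \<noteq> j \<Longrightarrow> \<exists>u\<in>B i. \<exists>v\<in>B j. E u v"
    using assms(1) by (rule has_Kt_minorE) (rule that, assumption+)
  show ?thesis unfolding has_Kt_minor_def
  proof (intro exI[of _ B] conjI allI impI)
    fix i assume "i < t"
    then show "connected_set E' (B i)" using B(1) connected_set_cong assms(3) by metis
  qed (use B assms in \<open>blast+\<close>)
qed

lemma has_Kt_minor_contract: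
  assumes g: "ugraph E" and uv: "u \<in> V" "v \<in> V" "E u v"
    and m: "has_Kt_minor (V - {v}) (contract E u v) t"
  shows "has_Kt_minor V E t"
proof -
  obtain B where B: "\<And>i. i < t \<Longrightarrow> B i \<noteq> {} \<and> B i \<subseteq> V - {v} \<and> connected_set (contract E u v) (B i)"
    "\<And>i j. i < t \<Longrightarrow> j < t \<Longrightarrow> i \<noteq> j \<Longrightarrow> B i \<inter> B j = {}"
    "\<And>i j. i < t \<Longrightarrow> j < t \<Longrightarrow> i \<noteq> j \<Longrightarrow> \<exists>a\<in>B i. \<exists>b\<in>B j. contract E u v a b"
    using m by (rule has_Kt_minorE) (rule that, assumption+)
  define C where "C i = (if u \<in> B i then insert v (B i) else B i)" for i
  show ?thesis unfolding has_Kt_minor_def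
  proof (intro exI[of _ C] conjI allI impI)
    fix i assume i: "i < t"
    show "connected_set E (C i)"
      unfolding C_def by (rule connected_set_uncontract[OF g uv(3)]) (use B i in auto)
    show "C i \<noteq> {}" "C i \<subseteq> V" using B(1)[OF i] uv by (auto simp: C_def)
    fix j assume j: "j < t" and ij: "i \<noteq> j"
    show "C i \<inter> C j = {}" using B(1)[OF i] B(1)[OF j] B(2)[OF i j ij] by (auto simp: C_def)
    obtain a b where "a \<in> B i" "b \<in> B j" "contract E u v a b" using B(3)[OF i j ij] by blast
    then show "\<exists>u\<in>C i. \<exists>v\<in>C j. E u v" by (auto simp: C_def contract_def)
  qed
qed

text \<open>Among the graphs without a \<open>K_t\<close> minor that reach the potential, take one
  with fewest vertices and then fewest edges. Deleting an edge falls below the potential, which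
  bounds the number of edges from above. Deleting a vertex or contracting an edge must lose more
  than the increment of \<open>\<phi>\<close>, which bounds degrees and codegrees from
  below.\<close>

lemma exists_minimal_dense_minor:
  fixes \<phi> :: "nat \<Rightarrow> real" and V :: "'a set"
  assumes g: "ugraph E" and V: "finite V" "V \<noteq> {}" and nm: "\<not> has_Kt_minor V E t"
    and dens: "\<phi> (card V) \<le> card (incident_pairs V E V)"
    and pos: "\<And>n. n \<ge> 1 \<Longrightarrow> 0 < \<phi> n"
  obtains V' and E' :: "'a \<Rightarrow> 'a \<Rightarrow> bool" where "ugraph E'" "finite V'" "2 \<le> card V'" "\<not> has_Kt_minor V' E' t"
    "\<phi> (card V') \<le> card (incident_pairs V' E' V')" "card (incident_pairs V' E' V') < \<phi> (card V') + 2"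
    "\<And>v. v \<in> V' \<Longrightarrow> \<phi> (card V') - \<phi> (card V' - 1) < 2 * real (card (neighbors V' E' v))"
    "\<And>u v. u \<in> V' \<Longrightarrow> v \<in> V' \<Longrightarrow> E' u v \<Longrightarrow>
        \<phi> (card V') - \<phi> (card V' - 1) < 2 + 2 * real (card (neighbors V' E' u \<inter> neighbors V' E' v))"
proof -
  define P :: "'a set \<times> ('a \<Rightarrow> 'a \<Rightarrow> bool) \<Rightarrow> bool" where
    "P = (\<lambda>(W, F). ugraph F \<and> finite W \<and> W \<noteq> {} \<and> \<not> has_Kt_minor W F t \<and> \<phi> (card W) \<le> card (incident_pairs W F W))"
  have PV: "P (V, E)" using assms by (simp add: P_def)
  define m where "m = (LEAST m. \<exists>q. P q \<and> card (fst q) = m)"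
  have m: "\<exists>q. P q \<and> card (fst q) = m" unfolding m_def by (rule LeastI_ex) (use PV in blast)
  obtain p where p: "P p" "card (fst p) = m"
    "\<And>q. P q \<Longrightarrow> card (fst q) = m \<Longrightarrow> card (incident_pairs (fst p) (snd p) (fst p)) \<le> card (incident_pairs (fst q) (snd q) (fst q))"
    using m ex_has_least_nat[of "\<lambda>q. P q \<and> card (fst q) = m" _ "\<lambda>q. card (incident_pairs (fst q) (snd q) (fst q))"] by blast
  obtain W F where pWF: "p = (W, F)" by force
  have W: "ugraph F" "finite W" "W \<noteq> {}" "\<not> has_Kt_minor W F t" "\<phi> (card W) \<le> card (incident_pairs W F W)"
    using p(1) by (auto simp: pWF P_def)
  have min1: "\<not> \<phi> (card W') \<le> card (incident_pairs W' F' W')" if "ugraph F'" "finite W'" "W' \<noteq> {}" "\<not> has_Kt_minor W' F' t"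
      "card W' < card W" for W' :: "'a set" and F'
  proof
    assume a: "\<phi> (card W') \<le> card (incident_pairs W' F' W')"
    have "P (W', F')" using that a by (simp add: P_def)
    then have "m \<le> card W'" unfolding m_def by (intro Least_le exI[of _ "(W', F')"]) simp
    then show False using that(5) p(2) by (simp add: pWF)
  qed
  have min2: "card (incident_pairs W F W) \<le> card (incident_pairs W F' W)" if "ugraph F'" "\<not> has_Kt_minor W F' t"
      "\<phi> (card W) \<le> card (incident_pairs W F' W)" for F'
    using p(3)[of "(W, F')"] that p(2) W by (simp add: pWF P_def)
  \<comment> \<open>Positivity of \<open>\<phi>\<close> forces an edge, hence two vertices; so
    \<open>W - {v}\<close> is nonempty and may compete with \<open>W\<close>.\<close>
  have "card W \<ge> 1" using W by (simp add: Suc_leI card_gt_0_iff)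
  then have "0 < card (incident_pairs W F W)" using pos[of "card W"] W(5) by linarith
  then have "incident_pairs W F W \<noteq> {}" by force
  then obtain a b where ab: "a \<in> W" "b \<in> W" "F a b" by (auto simp: incident_pairs_def)
  have "a \<noteq> b" using ab ugraph_irrefl[OF W(1)] by metis
  then have two: "2 \<le> card W" using ab W(2) card_mono[of W "{a, b}"] by simp
  have cardm: "card (W - {v}) = card W - 1" "W - {v} \<noteq> {}" if "v \<in> W" for v
  proof -
    show c: "card (W - {v}) = card W - 1" using W that by simp
    show "W - {v} \<noteq> {}"
    proof
      assume "W - {v} = {}"
      then show False using c two unfolding \<open>W - {v} = {}\<close> by simp
    qed
  qed
  show thesis
  proof (rule that[OF W(1,2) two W(4,5)])
    have "\<not> has_Kt_minor W (delete_edge F a b) t"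
      by (rule contrapos_nn[OF W(4)]) (erule has_Kt_minor_mono, auto simp: delete_edge_def)
    moreover have "card (incident_pairs W F W) = card (incident_pairs W (delete_edge F a b) W) + 2"
      using card_incident_pairs_delete_edge[OF W(1,2) ab] ab by simp
    ultimately show "card (incident_pairs W F W) < \<phi> (card W) + 2"
      using min2[OF ugraph_delete_edge[OF W(1)], of a b] by force
  next
    fix v assume v: "v \<in> W"
    have "\<not> has_Kt_minor (W - {v}) F t"
      by (rule contrapos_nn[OF W(4)]) (erule has_Kt_minor_mono, auto)
    then have "card (incident_pairs (W - {v}) F (W - {v})) < \<phi> (card W - 1)"
      using min1[of F "W - {v}"] W cardm[OF v] two by simp
    then show "\<phi> (card W) - \<phi> (card W - 1) < 2 * real (card (neighbors W F v))"
      using card_incident_pairs_remove[OF W(1,2) v] W(5) by linarith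
  next
    fix u v assume uv: "u \<in> W" "v \<in> W" "F u v"
    let ?C = "{w \<in> W. F v w \<and> w \<noteq> u \<and> (F u w \<or> u \<in> {} \<and> w \<in> {})}"
    have C: "card ?C \<le> card (neighbors W F u \<inter> neighbors W F v)"
      by (rule card_mono) (use W in \<open>auto simp: neighbors_def\<close>)
    have cnt: "card (incident_pairs W F W) \<le> card (incident_pairs (W - {v}) (contract F u v) (W - {v})) + 2 + 2 * card ?C"
      using card_incident_pairs_contract[OF W(1,2) uv, of "{}"] by simp
    have nm': "\<not> has_Kt_minor (W - {v}) (contract F u v) t"
      by (rule contrapos_nn[OF W(4)]) (rule has_Kt_minor_contract[OF W(1) uv])
    have "\<not> \<phi> (card W - 1) \<le> card (incident_pairs (W - {v}) (contract F u v) (W - {v}))"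
      using min1[OF ugraph_contract[OF W(1)] _ _ nm'] W(2) cardm[OF uv(2)] two by simp
    then show "\<phi> (card W) - \<phi> (card W - 1) < 2 + 2 * real (card (neighbors W F u \<inter> neighbors W F v))"
      using cnt C W(5) by linarith
  qed
qed


section \<open>Closed neighbourhoods as small dense graphs, and Mader's exponential bound\<close>

definition closed_nbhd :: "'a set \<Rightarrow> ('a \<Rightarrow> 'a \<Rightarrow> bool) \<Rightarrow> 'a \<Rightarrow> 'a set" where
  "closed_nbhd V E v = insert v (neighbors V E v)"

lemma closed_nbhd_degree:
  assumes g: "ugraph E" and "finite V" "v \<in> V"
  shows "finite (closed_nbhd V E v)" "closed_nbhd V E v \<subseteq> V" "card (closed_nbhd V E v) = card (neighbors V E v) + 1"
    "card (neighbors (closed_nbhd V E v) E v) = card (neighbors V E v)"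
    "w \<in> neighbors V E v \<Longrightarrow> card (neighbors (closed_nbhd V E v) E w) = card (neighbors V E v \<inter> neighbors V E w) + 1"
proof -
  have fN: "finite (neighbors V E v)" using assms by (simp add: neighbors_def)
  have vN: "v \<notin> neighbors V E x" if "x = v" for x using ugraph_irrefl[OF g] that by (simp add: neighbors_def)
  show "finite (closed_nbhd V E v)" "closed_nbhd V E v \<subseteq> V" "card (closed_nbhd V E v) = card (neighbors V E v) + 1"
    using assms fN vN by (auto simp: closed_nbhd_def neighbors_def)
  have "neighbors (closed_nbhd V E v) E v = neighbors V E v"
    using assms ugraph_irrefl[OF g] by (auto simp: closed_nbhd_def neighbors_def)
  then show "card (neighbors (closed_nbhd V E v) E v) = card (neighbors V E v)" by simp
  assume w: "w \<in> neighbors V E v"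
  have "neighbors (closed_nbhd V E v) E w = insert v (neighbors V E v \<inter> neighbors V E w)"
    using assms w ugraph_sym[OF g] by (auto simp: closed_nbhd_def neighbors_def)
  then show "card (neighbors (closed_nbhd V E v) E w) = card (neighbors V E v \<inter> neighbors V E w) + 1"
    using vN fN by simp
qed

text \<open>The potential \<open>D * n\<close> has increment \<open>D\<close>. Fewer than
  \<open>D * n + 2\<close> pairs leave a vertex of degree at most \<open>D\<close>, whose closed
  neighbourhood is the graph sought. Each neighbour shares more than \<open>D / 2 - 1\<close>
  neighbours with the centre and gains the centre itself, so its degree there exceeds
  \<open>D / 2\<close>.\<close>

lemma exists_dense_minor_nbhd:
  fixes V :: "'a set"
  assumes g: "ugraph E" and V: "finite V" "V \<noteq> {}" and nm: "\<not> has_Kt_minor V E t"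
    and D: "1 \<le> D" "D * card V \<le> card (incident_pairs V E V)"
  obtains V' c and E' :: "'a \<Rightarrow> 'a \<Rightarrow> bool" where "ugraph E'" "finite V'" "\<not> has_Kt_minor V' E' t" "c \<in> V'"
    "\<And>w. w \<in> V' \<Longrightarrow> w \<noteq> c \<Longrightarrow> E' c w" "card V' \<le> D + 1" "\<And>v. v \<in> V' \<Longrightarrow> D + 1 \<le> 2 * card (neighbors V' E' v)"
proof -
  define \<phi> where "\<phi> n = real (D * n)" for n
  obtain W and F :: "'a \<Rightarrow> 'a \<Rightarrow> bool" where W: "ugraph F" "finite W" "2 \<le> card W" "\<not> has_Kt_minor W F t"
    "card (incident_pairs W F W) < \<phi> (card W) + 2"
    and deg: "\<And>v. v \<in> W \<Longrightarrow> \<phi> (card W) - \<phi> (card W - 1) < 2 * real (card (neighbors W F v))"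
    and codeg: "\<And>u v. u \<in> W \<Longrightarrow> v \<in> W \<Longrightarrow> F u v \<Longrightarrow>
        \<phi> (card W) - \<phi> (card W - 1) < 2 + 2 * real (card (neighbors W F u \<inter> neighbors W F v))"
    by (rule exists_minimal_dense_minor[OF g V nm, of \<phi>]) (use D in \<open>auto simp: \<phi>_def simp flip: of_nat_mult\<close>)
  have diff: "\<phi> (card W) - \<phi> (card W - 1) = real D"
    using W(3) by (simp add: \<phi>_def of_nat_diff algebra_simps)
  have "\<exists>v\<in>W. card (neighbors W F v) \<le> D"
  proof (rule ccontr)
    assume "\<not> ?thesis"
    then have "(\<Sum>v\<in>W. D + 1) \<le> (\<Sum>v\<in>W. card (neighbors W F v))" by (intro sum_mono) force
    then have "card W * (D + 1) \<le> card (incident_pairs W F W)" using W by (simp add: card_incident_pairs_UNIV)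
    then have "card W * (D + 1) < D * card W + 2" using W(5) unfolding \<phi>_def by linarith
    then show False using W(3) by simp
  qed
  then obtain v where v: "v \<in> W" "card (neighbors W F v) \<le> D" by blast
  let ?H = "closed_nbhd W F v"
  note H = closed_nbhd_degree[OF W(1,2) v(1)]
  show thesis
  proof (rule that[OF W(1) H(1)])
    show "\<not> has_Kt_minor ?H F t" by (rule contrapos_nn[OF W(4)]) (rule has_Kt_minor_mono[OF _ H(2)])
    show "v \<in> ?H" by (simp add: closed_nbhd_def)
    show "F v w" if "w \<in> ?H" "w \<noteq> v" for w using that by (simp add: closed_nbhd_def neighbors_def)
    show "card ?H \<le> D + 1" using H v by simp
    fix w assume w: "w \<in> ?H"
    show "D + 1 \<le> 2 * card (neighbors ?H F w)"
    proof (cases "w = v")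
      case True
      then show ?thesis using deg[OF v(1)] diff H(4) by simp
    next
      case False
      then have wN: "w \<in> neighbors W F v" using w by (simp add: closed_nbhd_def)
      then have "w \<in> W" "F v w" by (auto simp: neighbors_def)
      then have "real D < 2 + 2 * real (card (neighbors W F v \<inter> neighbors W F w))"
        using codeg[OF v(1)] diff by simp
      then show ?thesis using H(5)[OF wN] by simp
    qed
  qed
qed

lemma has_Kt_minor_add_dominating:
  assumes "has_Kt_minor V E t" "c \<notin> V" "\<And>w. w \<in> V \<Longrightarrow> E c w" "ugraph E"
  shows "has_Kt_minor (insert c V) E (Suc t)"
proof -
  obtain B where B: "\<And>i. i < t \<Longrightarrow> B i \<noteq> {} \<and> B i \<subseteq> V \<and> connected_set E (B i)"
    "\<And>i j. i < t \<Longrightarrow> j < t \<Longrightarrow> i \<noteq> j \<Longrightarrow> B i \<inter> B j = {}"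
    "\<And>i j. i < t \<Longrightarrow> j < t \<Longrightarrow> i \<noteq> j \<Longrightarrow> \<exists>u\<in>B i. \<exists>v\<in>B j. E u v"
    using assms(1) by (rule has_Kt_minorE) (rule that, assumption+)
  have 1: "\<exists>v\<in>B i. E c v" "\<exists>v\<in>B i. E v c" "c \<notin> B i" if "i < t" for i
    using B(1)[OF that] assms ugraph_sym by fastforce+
  show ?thesis unfolding has_Kt_minor_def
    by (intro exI[of _ "B(t := {c})"]) (use B 1 in \<open>auto simp: less_Suc_eq\<close>)
qed

text \<open>The centre of the dense neighbourhood dominates it, so a \<open>K_t\<close> minor in the
  rest suffices. Doubled degrees are at least \<open>2 ^ Suc t + 1\<close>, so degrees are at least
  \<open>2 ^ t + 1\<close>, and still \<open>2 ^ t\<close> once the centre is removed.\<close>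

lemma Mader_minor:
  fixes V :: "'a set"
  assumes "ugraph E" "finite V" "V \<noteq> {}" "1 \<le> t" "2 ^ t * card V \<le> card (incident_pairs V E V)"
  shows "has_Kt_minor V E t"
  using assms(4,1,2,3,5)
proof (induction t arbitrary: V E rule: dec_induct)
  case base
  then obtain v where "v \<in> V" by blast
  then show ?case unfolding has_Kt_minor_def by (intro exI[of _ "\<lambda>_. {v}"]) auto
next
  case (step t)
  show ?case
  proof (rule ccontr)
    assume nm: "\<not> has_Kt_minor V E (Suc t)"
    obtain W c and F :: "'a \<Rightarrow> 'a \<Rightarrow> bool" where W: "ugraph F" "finite W" "\<not> has_Kt_minor W F (Suc t)" "c \<in> W"
      "\<And>w. w \<in> W \<Longrightarrow> w \<noteq> c \<Longrightarrow> F c w" "\<And>v. v \<in> W \<Longrightarrow> 2 ^ Suc t + 1 \<le> 2 * card (neighbors W F v)"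
      by (rule exists_dense_minor_nbhd[OF step.prems(1-3) nm _ step.prems(4)]) auto
    let ?W = "W - {c}"
    have deg: "2 ^ t \<le> card (neighbors ?W F v)" if "v \<in> W" for v
    proof -
      have "neighbors W F v \<subseteq> insert c (neighbors ?W F v)" by (auto simp: neighbors_def)
      then have "card (neighbors W F v) \<le> card (neighbors ?W F v) + 1"
        using W(2) card_mono[of "insert c (neighbors ?W F v)" "neighbors W F v"]
        by (simp add: neighbors_def card_insert_if split: if_splits)
      then show ?thesis using W(6)[OF that] by simp
    qed
    have ne: "?W \<noteq> {}"
    proof
      assume "?W = {}"
      then have "neighbors ?W F c = {}" unfolding neighbors_def by blast
      then show False using deg[OF W(4)] by simp
    qed
    have "(\<Sum>v\<in>?W. 2 ^ t) \<le> (\<Sum>v\<in>?W. card (neighbors ?W F v))" using deg by (intro sum_mono) auto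
    then have "2 ^ t * card ?W \<le> card (incident_pairs ?W F ?W)"
      using W(2) by (simp add: card_incident_pairs_UNIV mult.commute)
    then have "has_Kt_minor ?W F t" using step.IH[OF W(1) _ ne] W(2) by simp
    then have "has_Kt_minor (insert c ?W) F (Suc t)" by (rule has_Kt_minor_add_dominating) (use W in auto)
    then show False using W by (simp add: insert_absorb)
  qed
qed

section \<open>Complete minors in graphs of large minimum degree\<close>

definition non_nbrs :: "'a set \<Rightarrow> ('a \<Rightarrow> 'a \<Rightarrow> bool) \<Rightarrow> 'a set \<Rightarrow> 'a set" where
  "non_nbrs V E B = {v \<in> V. \<forall>b\<in>B. \<not> E v b}"

text \<open>Every entry but one brings a common neighbour that ties it to the entries already
  connected: \<open>s\<close> entries and \<open>s - 1\<close> connectors.\<close>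

lemma connect_through_common_neighbors:
  assumes g: "ugraph E" and common: "\<And>x y. x \<in> R \<Longrightarrow> y \<in> R \<Longrightarrow> \<exists>z\<in>R. E x z \<and> E y z"
    and "xs \<noteq> []" "set xs \<subseteq> R"
  shows "\<exists>C. set xs \<subseteq> C \<and> C \<subseteq> R \<and> finite C \<and> connected_set E C \<and> card C \<le> 2 * length xs - 1"
  using assms(3,4)
proof (induction xs rule: list_nonempty_induct)
  case (single x)
  then show ?case by (intro exI[of _ "{x}"]) auto
next
  case (cons x xs)
  then obtain C where C: "set xs \<subseteq> C" "C \<subseteq> R" "finite C" "connected_set E C" "card C \<le> 2 * length xs - 1" by auto
  obtain y where y: "y \<in> set xs" using cons by (meson list.set_sel(1))
  obtain z where z: "z \<in> R" "E x z" "E y z" using common[of x y] y cons by auto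
  have "connected_set E (insert z C)"
    by (rule connected_set_insert[OF g C(4), of y]) (use y C z ugraph_sym[OF g] in auto)
  then have "connected_set E (insert x (insert z C))"
    by (rule connected_set_insert[OF g, of _ z]) (use z in auto)
  moreover have "card (insert x (insert z C)) \<le> card C + 2"
    using C(3) by (simp add: card_insert_if)
  moreover have "length xs \<ge> 1" using cons by (simp add: Suc_leI)
  ultimately show ?case using C z cons by (intro exI[of _ "insert x (insert z C)"]) auto
qed

text \<open>Double counting of the pairs of a tuple and a vertex without neighbour in it.
  Repetitions are allowed in tuples because then those that avoid the neighbours of \<open>v\<close>
  number exactly a power.\<close>

lemma sum_card_swap_lists:
  assumes "finite R"
  shows "(\<Sum>xs\<in>{xs. set xs \<subseteq> R \<and> length xs = s}. card (non_nbrs R E (set xs))) = (\<Sum>v\<in>R. card {u\<in>R. \<not> E v u} ^ s)"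
proof -
  let ?T = "{xs. set xs \<subseteq> R \<and> length xs = s}"
  have fT: "finite ?T" using assms by (rule finite_lists_length_eq)
  have "(\<Sum>xs\<in>?T. card (non_nbrs R E (set xs))) = (\<Sum>xs\<in>?T. \<Sum>v\<in>R. if \<forall>b\<in>set xs. \<not> E v b then 1 else 0)"
    by (rule sum.cong) (simp_all add: non_nbrs_def assms sum.If_cases Int_def)
  also have "\<dots> = (\<Sum>v\<in>R. \<Sum>xs\<in>?T. if \<forall>b\<in>set xs. \<not> E v b then 1 else 0)" by (rule sum.swap)
  also have "\<dots> = (\<Sum>v\<in>R. card {u\<in>R. \<not> E v u} ^ s)"
  proof (rule sum.cong)
    fix v
    have "(\<Sum>xs\<in>?T. if \<forall>b\<in>set xs. \<not> E v b then 1 else 0) = card (?T \<inter> {xs. \<forall>b\<in>set xs. \<not> E v b})"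
      using fT by (simp add: sum.If_cases)
    also have "?T \<inter> {xs. \<forall>b\<in>set xs. \<not> E v b} = {xs. set xs \<subseteq> {u\<in>R. \<not> E v u} \<and> length xs = s}" by auto
    also have "card \<dots> = card {u\<in>R. \<not> E v u} ^ s" using assms by (intro card_lists_length_eq) auto
    finally show "(\<Sum>xs\<in>?T. if \<forall>b\<in>set xs. \<not> E v b then 1 else 0) = card {u\<in>R. \<not> E v u} ^ s" .
  qed simp
  finally show ?thesis .
qed

text \<open>Markov's inequality for the number of common non-neighbours of a uniformly random tuple.\<close>
lemma card_bad_tuples:
  assumes R: "finite R" "R \<noteq> {}" and s: "1 \<le> s" and h: "1 \<le> h" "\<And>v. v \<in> R \<Longrightarrow> card {u\<in>R. \<not> E v u} \<le> h"
  shows "3 * card {xs. set xs \<subseteq> R \<and> length xs = s \<and> 3 * h ^ s < 2 * card (non_nbrs R E (set xs)) * card R ^ (s - 1)} \<le> 2 * card R ^ s"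
proof -
  let ?T = "{xs. set xs \<subseteq> R \<and> length xs = s}"
  let ?B = "{xs. set xs \<subseteq> R \<and> length xs = s \<and> 3 * h ^ s < 2 * card (non_nbrs R E (set xs)) * card R ^ (s - 1)}"
  have fT: "finite ?T" using R(1) by (rule finite_lists_length_eq)
  have BT: "?B \<subseteq> ?T" by auto
  then have fB: "finite ?B" using fT finite_subset by blast
  have "3 * card ?B * h ^ s = (\<Sum>xs\<in>?B. 3 * h ^ s)" by simp
  also have "\<dots> \<le> (\<Sum>xs\<in>?B. 2 * card (non_nbrs R E (set xs)) * card R ^ (s - 1))"
    by (rule sum_mono) auto
  also have "\<dots> \<le> (\<Sum>xs\<in>?T. 2 * card (non_nbrs R E (set xs)) * card R ^ (s - 1))"
    by (rule sum_mono2[OF fT BT]) simp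
  also have "\<dots> = 2 * card R ^ (s - 1) * (\<Sum>xs\<in>?T. card (non_nbrs R E (set xs)))"
    by (simp add: sum_distrib_left mult_ac)
  also have "\<dots> = 2 * card R ^ (s - 1) * (\<Sum>v\<in>R. card {u\<in>R. \<not> E v u} ^ s)"
    using sum_card_swap_lists[OF R(1)] by simp
  also have "\<dots> \<le> 2 * card R ^ (s - 1) * (\<Sum>v\<in>R. h ^ s)"
    using h by (intro mult_left_mono sum_mono power_mono) auto
  also have "\<dots> = 2 * (card R ^ (s - 1) * card R) * h ^ s" by simp
  also have "card R ^ (s - 1) * card R = card R ^ s" using s by (cases s) simp_all
  finally have "3 * card ?B * h ^ s \<le> 2 * card R ^ s * h ^ s" .
  then show ?thesis using h(1) by simp
qed

text \<open>Here \<open>a\<close> is the number of vertices, in a remainder of size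
  \<open>r\<close>, without neighbour in an earlier branch set. Up to the Markov factor 3/2,
  \<open>a / r\<close> is at most \<open>(h / r) ^ s\<close>, and \<open>h / r\<close> is at most
  1/2. So a random \<open>s\<close>-tuple lies among these vertices with probability at most
  \<open>3 ^ s / 2 ^ (s\<^sup>2 + s)\<close>.\<close>

lemma card_tuples_in_small_set:
  assumes U: "2 * a * r ^ (s - 1) \<le> 3 * h ^ s" and r: "2 * h \<le> r" "1 \<le> r" and s: "1 \<le> s"
  shows "(a::nat) ^ s * 2 ^ (s\<^sup>2 + s) \<le> 3 ^ s * r ^ s"
proof -
  have e: "s\<^sup>2 = (s - 1) * s + s" using s by (cases s) (simp_all add: power2_eq_square)
  have "(2 * a * r ^ (s - 1)) ^ s \<le> (3 * h ^ s) ^ s" using U by (rule power_mono) simp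
  then have "a ^ s * 2 ^ s * r ^ ((s - 1) * s) \<le> 3 ^ s * h ^ s\<^sup>2"
    by (simp add: power_mult_distrib power_mult[symmetric] power2_eq_square mult_ac)
  then have "a ^ s * 2 ^ s * r ^ ((s - 1) * s) * 2 ^ s\<^sup>2 \<le> 3 ^ s * h ^ s\<^sup>2 * 2 ^ s\<^sup>2" by (rule mult_right_mono) simp
  also have "\<dots> = 3 ^ s * (2 * h) ^ s\<^sup>2" by (simp add: power_mult_distrib)
  also have "\<dots> \<le> 3 ^ s * r ^ s\<^sup>2" using r by (intro mult_left_mono power_mono) auto
  also have "\<dots> = 3 ^ s * r ^ s * r ^ ((s - 1) * s)" by (simp add: e power_add)
  finally have "(a ^ s * 2 ^ (s\<^sup>2 + s)) * r ^ ((s - 1) * s) \<le> (3 ^ s * r ^ s) * r ^ ((s - 1) * s)"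
    by (simp add: power_add mult_ac)
  then show ?thesis using r(2) by simp
qed

text \<open>Branch sets are chosen one by one in the remainder \<open>R\<close>. By
  \<open>deg\<close>, \<open>card R\<close> exceeds \<open>2 * h\<close>, where \<open>h\<close>
  bounds the non-neighbours of a vertex, even after \<open>t - 1\<close> sets of
  \<open>2 * s - 1\<close> vertices are removed; so any two vertices of \<open>R\<close> have a
  common neighbour in \<open>R\<close>. A random tuple has too many common non-neighbours with
  probability at most 2/3, and by \<open>ts\<close> it misses some earlier branch set with
  probability below 1/3, so a good tuple exists.\<close>

theorem dense_graph_minor:
  assumes g: "ugraph E" and V: "finite V" "V \<noteq> {}" and s: "1 \<le> s"
    and deg: "\<And>v. v \<in> V \<Longrightarrow> card V + (t - 1) * (2 * s - 1) < 2 * card (neighbors V E v)"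
    and ts: "3 * (t - 1) * 3 ^ s < 2 ^ (s\<^sup>2 + s)"
  shows "has_Kt_minor V E t"
proof -
  define n where "n = card V"
  define h where "h = Max ((\<lambda>v. card {u\<in>V. \<not> E v u}) ` V)"
  have hV: "card {u\<in>V. \<not> E v u} \<le> h" if "v \<in> V" for v unfolding h_def using V that by (intro Max_ge) auto
  have nn: "card {u\<in>V. \<not> E v u} = n - card (neighbors V E v)" "card (neighbors V E v) \<le> n" for v
  proof -
    have "{u\<in>V. \<not> E v u} = V - neighbors V E v" by (auto simp: neighbors_def)
    then show "card {u\<in>V. \<not> E v u} = n - card (neighbors V E v)"
      using V by (simp add: n_def card_Diff_subset neighbors_def)
    show "card (neighbors V E v) \<le> n" unfolding n_def using V by (intro card_mono) (auto simp: neighbors_def)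
  qed
  have "h \<in> (\<lambda>v. card {u\<in>V. \<not> E v u}) ` V" unfolding h_def using V by (intro Max_in) auto
  then obtain v0 where v0: "v0 \<in> V" "h = card {u\<in>V. \<not> E v0 u}" by blast
  \<comment> \<open>A vertex is its own non-neighbour, so \<open>h\<close> is positive and its
    powers can be cancelled in Markov's inequality.\<close>
  have "v0 \<in> {u\<in>V. \<not> E v0 u}" using v0 ugraph_irrefl[OF g] by simp
  then have "0 < card {u\<in>V. \<not> E v0 u}" using V by (subst card_gt_0_iff) auto
  then have h1: "1 \<le> h" using v0 by simp
  have hn: "2 * h + (t - 1) * (2 * s - 1) < n"
    using deg[OF v0(1)] nn[of v0] v0(2) unfolding n_def[symmetric] by linarith
  \<comment> \<open>The bound on non-neighbours refers to the remainder after all \<open>i\<close>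
    sets, not to the one in which \<open>B j\<close> was chosen. It is carried along because the
    next tuple must hit the neighbourhood of every earlier set.\<close>
  define Q where "Q i B \<longleftrightarrow>
    (\<forall>j<i. B j \<noteq> {} \<and> B j \<subseteq> V \<and> connected_set E (B j) \<and> card (B j) \<le> 2 * s - 1 \<and>
       2 * card (non_nbrs (V - (\<Union>j<i. B j)) E (B j)) * card (V - (\<Union>j<i. B j)) ^ (s - 1) \<le> 3 * h ^ s) \<and>
    (\<forall>j<i. \<forall>k<i. j \<noteq> k \<longrightarrow> B j \<inter> B k = {} \<and> (\<exists>u\<in>B j. \<exists>v\<in>B k. E u v))" for i and B :: "nat \<Rightarrow> 'a set"
  have "\<exists>B. Q i B" if "i \<le> t" for i
    using that
  proof (induction i)
    case 0
    then show ?case by (simp add: Q_def)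
  next
    case (Suc i)
    then obtain B where B: "Q i B" by auto
    define W where "W = (\<Union>j<i. B j)"
    define R where "R = V - W"
    have Bj: "B j \<noteq> {}" "B j \<subseteq> V" "connected_set E (B j)" "card (B j) \<le> 2 * s - 1"
        "2 * card (non_nbrs R E (B j)) * card R ^ (s - 1) \<le> 3 * h ^ s" if "j < i" for j
      using B that unfolding Q_def R_def W_def by auto
    have "card W \<le> (\<Sum>j<i. card (B j))" unfolding W_def by (rule card_UN_le) simp
    also have "\<dots> \<le> (\<Sum>j<i. 2 * s - 1)" using Bj by (intro sum_mono) auto
    also have "\<dots> \<le> (t - 1) * (2 * s - 1)" using Suc.prems by auto
    finally have W: "card W \<le> (t - 1) * (2 * s - 1)" .
    have WV: "W \<subseteq> V" using Bj unfolding W_def by blast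
    have fW: "finite W" "finite R" using WV V finite_subset unfolding R_def by blast+
    have cR: "card R = n - card W" unfolding R_def n_def using fW WV by (intro card_Diff_subset) auto
    have R2: "2 * h < card R" using cR hn W by linarith
    then have Rne: "R \<noteq> {}" by force
    have hR: "card {u\<in>R. \<not> E v u} \<le> h" if "v \<in> R" for v
    proof -
      have "card {u\<in>R. \<not> E v u} \<le> card {u\<in>V. \<not> E v u}" using V by (intro card_mono) (auto simp: R_def)
      then show ?thesis using hV[of v] that by (simp add: R_def)
    qed
    have common: "\<exists>z\<in>R. E x z \<and> E y z" if "x \<in> R" "y \<in> R" for x y
    proof (rule ccontr)
      assume "\<not> ?thesis"
      then have "R \<subseteq> {u\<in>R. \<not> E x u} \<union> {u\<in>R. \<not> E y u}" by blast
      then have "card R \<le> card ({u\<in>R. \<not> E x u} \<union> {u\<in>R. \<not> E y u})" using fW by (intro card_mono) auto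
      also have "\<dots> \<le> 2 * h" using card_Un_le[of "{u\<in>R. \<not> E x u}" "{u\<in>R. \<not> E y u}"] hR[OF that(1)] hR[OF that(2)] by linarith
      finally show False using R2 by simp
    qed
    let ?T = "{xs. set xs \<subseteq> R \<and> length xs = s}"
    let ?B0 = "{xs. set xs \<subseteq> R \<and> length xs = s \<and> 3 * h ^ s < 2 * card (non_nbrs R E (set xs)) * card R ^ (s - 1)}"
    let ?Bad = "\<lambda>j. {xs. set xs \<subseteq> non_nbrs R E (B j) \<and> length xs = s}"
    have fT: "finite ?T" using fW by (intro finite_lists_length_eq)
    have fU: "finite (non_nbrs R E (B j))" for j using fW by (simp add: non_nbrs_def)
    have cB0: "3 * card ?B0 \<le> 2 * card R ^ s" by (rule card_bad_tuples[OF fW(2) Rne s h1 hR])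
    have cBad: "card (?Bad j) * 2 ^ (s\<^sup>2 + s) \<le> 3 ^ s * card R ^ s" if "j < i" for j
    proof -
      have "card (?Bad j) = card (non_nbrs R E (B j)) ^ s" using fU by (intro card_lists_length_eq)
      then show ?thesis using card_tuples_in_small_set[OF Bj(5)[OF that] _ _ s] R2 by simp
    qed
    have "(\<Sum>j<i. card (?Bad j)) * 2 ^ (s\<^sup>2 + s) \<le> (\<Sum>j<i. 3 ^ s * card R ^ s)"
      unfolding sum_distrib_right using cBad by (intro sum_mono) auto
    also have "\<dots> \<le> (t - 1) * (3 ^ s * card R ^ s)" using Suc.prems by auto
    finally have "3 * (\<Sum>j<i. card (?Bad j)) * 2 ^ (s\<^sup>2 + s) \<le> (3 * (t - 1) * 3 ^ s) * card R ^ s" by simp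
    also have "\<dots> < 2 ^ (s\<^sup>2 + s) * card R ^ s" using ts R2 by (intro mult_strict_right_mono) auto
    finally have cs: "3 * (\<Sum>j<i. card (?Bad j)) < card R ^ s" by (simp add: mult.commute)
    have "card (?B0 \<union> (\<Union>j<i. ?Bad j)) \<le> card ?B0 + card (\<Union>j<i. ?Bad j)" by (rule card_Un_le)
    also have "\<dots> \<le> card ?B0 + (\<Sum>j<i. card (?Bad j))" by (intro add_left_mono card_UN_le) simp
    also have "\<dots> < card R ^ s" using cB0 cs by linarith
    also have "\<dots> = card ?T" using fW by (simp add: card_lists_length_eq)
    finally have "\<not> ?T \<subseteq> ?B0 \<union> (\<Union>j<i. ?Bad j)"
    proof (rule contrapos_pn)
      assume "?T \<subseteq> ?B0 \<union> (\<Union>j<i. ?Bad j)"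
      moreover have "finite (?B0 \<union> (\<Union>j<i. ?Bad j))"
      proof (rule finite_subset[OF _ fT])
        show "?B0 \<union> (\<Union>j<i. ?Bad j) \<subseteq> ?T" by (auto simp: non_nbrs_def)
      qed
      ultimately show "\<not> card (?B0 \<union> (\<Union>j<i. ?Bad j)) < card ?T" by (simp add: card_mono not_less)
    qed
    then obtain xs where xs: "set xs \<subseteq> R" "length xs = s" "xs \<notin> ?B0" "\<And>j. j < i \<Longrightarrow> xs \<notin> ?Bad j" by blast
    have "xs \<noteq> []" using xs s by auto
    from connect_through_common_neighbors[OF g common this xs(1)]
    obtain C where C: "set xs \<subseteq> C" "C \<subseteq> R" "finite C" "connected_set E C" "card C \<le> 2 * s - 1" unfolding xs(2) by auto
    have Cne: "C \<noteq> {}" using C \<open>xs \<noteq> []\<close> by auto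
    define B' where "B' = B(i := C)"
    define R' where "R' = V - (\<Union>j<Suc i. B' j)"
    have R'R: "R' \<subseteq> R" by (auto simp: R'_def R_def W_def B'_def lessThan_Suc)
    \<comment> \<open>Both factors can only decrease when the remainder shrinks and when the tuple
      grows into the connected set \<open>C\<close>.\<close>
    have shrink: "2 * card (non_nbrs R' E A) * card R' ^ (s - 1) \<le> 3 * h ^ s"
      if "2 * card (non_nbrs R E A') * card R ^ (s - 1) \<le> 3 * h ^ s" "A' \<subseteq> A" for A A'
    proof -
      have "card (non_nbrs R' E A) \<le> card (non_nbrs R E A')"
        using fW R'R that(2) by (intro card_mono) (auto simp: non_nbrs_def)
      moreover have "card R' \<le> card R" using fW R'R by (intro card_mono)
      ultimately have "2 * card (non_nbrs R' E A) * card R' ^ (s - 1) \<le> 2 * card (non_nbrs R E A') * card R ^ (s - 1)"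
        by (intro mult_mono power_mono) auto
      with that(1) show ?thesis by linarith
    qed
    have adj: "\<exists>u\<in>B j. \<exists>v\<in>C. E u v" if "j < i" for j
    proof -
      have "\<not> set xs \<subseteq> non_nbrs R E (B j)" using xs(4)[OF that] xs(2) by simp
      then obtain x b where "x \<in> set xs" "b \<in> B j" "E x b" using xs(1) by (auto simp: non_nbrs_def)
      then show ?thesis using C(1) ugraph_sym[OF g] by blast
    qed
    have dis: "B j \<inter> C = {}" if "j < i" for j using C(2) that unfolding R_def W_def by blast
    have "Q (Suc i) B'"
      unfolding Q_def R'_def[symmetric]
    proof (intro conjI allI impI)
      fix j assume j: "j < Suc i"
      show "B' j \<noteq> {}" "B' j \<subseteq> V" "connected_set E (B' j)" "card (B' j) \<le> 2 * s - 1"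
        using j Bj C Cne by (auto simp: B'_def less_Suc_eq R_def)
      show "2 * card (non_nbrs R' E (B' j)) * card R' ^ (s - 1) \<le> 3 * h ^ s"
      proof (cases "j = i")
        case True
        have "2 * card (non_nbrs R E (set xs)) * card R ^ (s - 1) \<le> 3 * h ^ s" using xs(1-3) by auto
        then show ?thesis using shrink[OF _ C(1)] True by (simp add: B'_def)
      next
        case False
        then show ?thesis using shrink[OF Bj(5) subset_refl, of j] j by (simp add: B'_def)
      qed
    next
      fix j k assume j: "j < Suc i" and k: "k < Suc i" and jk: "j \<noteq> k"
      have old: "B j \<inter> B k = {} \<and> (\<exists>u\<in>B j. \<exists>v\<in>B k. E u v)" if "j < i" "k < i"
        using B that jk unfolding Q_def by blast
      consider "j < i" "k < i" | "j < i" "k = i" | "j = i" "k < i" using j k jk by linarith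
      then have "B' j \<inter> B' k = {} \<and> (\<exists>u\<in>B' j. \<exists>v\<in>B' k. E u v)"
      proof cases
        case 1
        then show ?thesis using old by (simp add: B'_def)
      next
        case 2
        then show ?thesis using adj[of j] dis[of j] by (simp add: B'_def)
      next
        case 3
        then show ?thesis using adj[of k] dis[of k] ugraph_sym[OF g] by (simp add: B'_def Int_commute) blast
      qed
      then show "B' j \<inter> B' k = {}" "\<exists>u\<in>B' j. \<exists>v\<in>B' k. E u v" by auto
    qed
    then show ?case by blast
  qed
  then obtain B where "Q t B" by blast
  then show ?thesis unfolding has_Kt_minor_def Q_def by (intro exI[of _ B]) blast
qed

section \<open>A surplus over half density, and the numerical estimates\<close>

lemma ln_quotient_bound: "ln (200 / 37 :: real) \<le> 17 / 10"
proof -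
  \<comment> \<open>The value 200/37 is 1/0.185, the largest quotient \<open>n / b\<close> at the
    start. The exponent 1.7 is split into ten factors exp (0.17) so that the quadratic Taylor bound
    is accurate enough.\<close>
  have "(200 / 37 :: real) \<le> (1 + 17 / 100 + (17 / 100)\<^sup>2 / 2) ^ 10" by (simp add: power2_eq_square power_numeral_reduce)
  also have "\<dots> \<le> exp (17 / 100) ^ 10"
    by (intro power_mono) (use exp_lower_Taylor_quadratic[of "17 / 100 :: real"] in \<open>auto simp: field_simps\<close>)
  also have "\<dots> = exp (17 / 10)" by (simp flip: exp_of_nat_mult)
  finally have "ln (200 / 37 :: real) \<le> ln (exp (17 / 10))" by (subst ln_le_cancel_iff) auto
  then show ?thesis by simp
qed

text \<open>The potential \<open>n b (1 + ln (n / b))\<close> is chosen so that its increment exceeds its average by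
  about \<open>b\<close>: the neighbourhood of a vertex of small degree in an edge-minimal minor then has minimum degree
  larger than half of its order, by about \<open>b / 2\<close>.\<close>
lemma exists_minor_above_half_density:
  fixes V :: "'a set" and D :: nat
  assumes g: "ugraph E" and V: "finite V" "V \<noteq> {}" and nm: "\<not> has_Kt_minor V E t"
    and cV: "card V \<le> D + 1" and deg: "\<And>v. v \<in> V \<Longrightarrow> D + 1 \<le> 2 * card (neighbors V E v)"
    and b: "b = 185 / 1000 * (real D + 1)"
  obtains V' and E' :: "'a \<Rightarrow> 'a \<Rightarrow> bool" where "ugraph E'" "finite V'" "V' \<noteq> {}" "\<not> has_Kt_minor V' E' t"
    "\<And>v. v \<in> V' \<Longrightarrow> real (card V') + b - 3 < 2 * real (card (neighbors V' E' v))"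
proof -
  have b0: "0 < b" using b by simp
  \<comment> \<open>Cutting the logarithm off at 0 keeps \<open>\<phi>\<close> positive for
    \<open>n < b\<close>; at the minimal graph both \<open>n\<close> and \<open>n - 1\<close> turn
    out to be at least \<open>b\<close>.\<close>
  define \<phi> where "\<phi> n = real n * b * (1 + max 0 (ln (real n / b)))" for n
  have pos: "0 < \<phi> n" if "1 \<le> n" for n using that b0 unfolding \<phi>_def by (intro mult_pos_pos add_pos_nonneg) auto
  have cV1: "1 \<le> card V" using V by (simp add: Suc_leI card_gt_0_iff)
  \<comment> \<open>The given graph reaches the potential because 0.185 * (1 + 1.7) = 0.4995 is
    below the guaranteed density 1/2.\<close>
  have "real (card V) / b \<le> 200 / 37"
    using cV b0 unfolding b by (simp add: field_simps)
  then have "ln (real (card V) / b) \<le> ln (200 / 37)" using cV1 b0 by (subst ln_le_cancel_iff) auto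
  then have "max 0 (ln (real (card V) / b)) \<le> 17 / 10" using ln_quotient_bound by simp
  then have "b * (1 + max 0 (ln (real (card V) / b))) \<le> b * (27 / 10)" using b0 by (intro mult_left_mono) auto
  also have "\<dots> \<le> (real D + 1) / 2" unfolding b by simp
  finally have "\<phi> (card V) \<le> real (card V) * ((real D + 1) / 2)" unfolding \<phi>_def mult.assoc by (intro mult_left_mono) auto
  also have "\<dots> = (\<Sum>v\<in>V. (real D + 1) / 2)" by simp
  also have "\<dots> \<le> (\<Sum>v\<in>V. real (card (neighbors V E v)))"
  proof (rule sum_mono)
    fix v assume "v \<in> V"
    from deg[OF this] have "real (D + 1) \<le> real (2 * card (neighbors V E v))" by (simp only: of_nat_le_iff)
    then show "(real D + 1) / 2 \<le> real (card (neighbors V E v))" by simp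
  qed
  also have "\<dots> = card (incident_pairs V E V)" using V by (simp add: card_incident_pairs_UNIV)
  finally have dens: "\<phi> (card V) \<le> card (incident_pairs V E V)" .
  obtain W and F :: "'a \<Rightarrow> 'a \<Rightarrow> bool" where W: "ugraph F" "finite W" "2 \<le> card W" "\<not> has_Kt_minor W F t"
    "\<phi> (card W) \<le> card (incident_pairs W F W)" "card (incident_pairs W F W) < \<phi> (card W) + 2"
    and dg: "\<And>v. v \<in> W \<Longrightarrow> \<phi> (card W) - \<phi> (card W - 1) < 2 * real (card (neighbors W F v))"
    and codg: "\<And>u v. u \<in> W \<Longrightarrow> v \<in> W \<Longrightarrow> F u v \<Longrightarrow>
        \<phi> (card W) - \<phi> (card W - 1) < 2 + 2 * real (card (neighbors W F u \<inter> neighbors W F v))"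
    by (rule exists_minimal_dense_minor[where \<phi> = \<phi>, OF g V nm dens pos]) (assumption, rule that, assumption+)
  define n where "n = card W"
  define x where "x = real n - 1"
  have Wne: "W \<noteq> {}" using W(3) by auto
  have x1: "1 \<le> x" using W(3) by (simp add: x_def n_def)
  have degW: "card (neighbors W F v) \<le> n - 1" if "v \<in> W" for v
  proof -
    have "neighbors W F v \<subseteq> W - {v}" using ugraph_irrefl[OF W(1)] by (auto simp: neighbors_def)
    then have "card (neighbors W F v) \<le> card (W - {v})" using W(2) by (intro card_mono) auto
    then show ?thesis using that W(2) by (simp add: n_def)
  qed
  \<comment> \<open>There are at most \<open>n (n - 1)\<close> ordered pairs, while
    \<open>\<phi> n\<close> is at least \<open>n b\<close>. This gives \<open>b \<le> n - 1\<close>,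
    so the cut-off at 0 is inactive from here on.\<close>
  have "card (incident_pairs W F W) \<le> (\<Sum>v\<in>W. n - 1)"
    unfolding card_incident_pairs_UNIV[OF W(2)] by (intro sum_mono degW)
  then have "real (card (incident_pairs W F W)) \<le> real (n * (n - 1))" unfolding of_nat_le_iff by (simp add: n_def)
  also have "\<dots> = real n * x" using W(3) by (simp add: x_def n_def of_nat_diff)
  finally have "\<phi> n \<le> real n * x" using W(5) by (simp add: n_def)
  moreover have "real n * b * 1 \<le> \<phi> n" unfolding \<phi>_def using b0 by (intro mult_left_mono) auto
  ultimately have "real n * b \<le> real n * x" by linarith
  then have bx: "b \<le> x" using x1 by (simp add: x_def)
  define l where "l = ln (x / b)"
  have l0: "0 \<le> l" using bx b0 by (simp add: l_def)
  have nb: "ln (real n / b) = l + ln (real n / x)"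
    using b0 x1 by (simp add: l_def x_def ln_div)
  have lo: "1 / real n \<le> ln (real n / x)"
    using ln_le_minus_one[of "x / real n"] x1 by (simp add: x_def ln_div field_simps)
  have hi: "ln (real n / x) \<le> 1 / x"
    using ln_le_minus_one[of "real n / x"] x1 by (simp add: x_def field_simps)
  have lo0: "0 \<le> ln (real n / x)" using lo by (rule order.trans[rotated]) simp
  have phn: "\<phi> n = real n * b * (1 + l + ln (real n / x))"
    unfolding \<phi>_def nb using l0 lo0 by (simp add: max_def)
  have rn: "real (n - 1) = x" using W(3) by (simp add: x_def n_def of_nat_diff)
  have phn1: "\<phi> (n - 1) = x * b * (1 + l)" unfolding \<phi>_def rn l_def[symmetric] using l0 by (simp add: max_def)
  \<comment> \<open>The average \<open>\<phi> n / n\<close> is about \<open>b (1 + l)\<close>; the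
    growth of the logarithm adds another \<open>b\<close> to the increment. This extra
    \<open>b\<close> is the surplus.\<close>
  have "b * 1 \<le> b * (real n * ln (real n / x))" using lo b0 x1 by (intro mult_left_mono) (auto simp: x_def field_simps)
  then have "b * (2 + l) \<le> \<phi> n - \<phi> (n - 1)" unfolding phn phn1 by (simp add: x_def algebra_simps)
  then have inc: "b + b * (1 + l) \<le> \<phi> n - \<phi> (n - 1)" by (simp add: algebra_simps)
  have "\<exists>v\<in>W. real n * card (neighbors W F v) < \<phi> n + 2"
  proof (rule ccontr)
    assume "\<not> ?thesis"
    then have "(\<Sum>v\<in>W. \<phi> n + 2) \<le> (\<Sum>v\<in>W. real n * card (neighbors W F v))" by (intro sum_mono) auto
    also have "\<dots> = real n * card (incident_pairs W F W)"
      by (simp add: card_incident_pairs_UNIV[OF W(2)] sum_distrib_left)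
    finally have "real n * (\<phi> n + 2) \<le> real n * card (incident_pairs W F W)" by (simp add: n_def)
    then show False using W(6) x1 by (simp add: n_def x_def)
  qed
  then obtain v where v: "v \<in> W" "real n * card (neighbors W F v) < \<phi> n + 2" by blast
  define d where "d = card (neighbors W F v)"
  have n2: "2 \<le> real n" using x1 by (simp add: x_def)
  have "b * ln (real n / x) \<le> x * (1 / x)" using hi bx b0 lo0 by (intro mult_mono) auto
  then have q1: "b * ln (real n / x) \<le> 1" using x1 by simp
  have "real n * d < real n * (b * (1 + l) + b * ln (real n / x)) + 2"
    using v(2) unfolding phn d_def by (simp add: algebra_simps)
  also have "\<dots> \<le> real n * (b * (1 + l) + 1) + real n"
    by (rule add_mono[OF mult_left_mono]) (use q1 n2 in auto)
  also have "\<dots> = real n * (b * (1 + l) + 2)" by (simp add: algebra_simps)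
  finally have "d < b * (1 + l) + 2" using n2 by simp
  with inc have key: "b + d - 2 < \<phi> n - \<phi> (n - 1)" by linarith
  let ?H = "closed_nbhd W F v"
  note H = closed_nbhd_degree[OF W(1,2) v(1)]
  show thesis
  proof (rule that[OF W(1) H(1)])
    show "\<not> has_Kt_minor ?H F t" by (rule contrapos_nn[OF W(4)]) (rule has_Kt_minor_mono[OF _ H(2)])
    show "?H \<noteq> {}" by (simp add: closed_nbhd_def)
    fix w assume w: "w \<in> ?H"
    show "real (card ?H) + b - 3 < 2 * real (card (neighbors ?H F w))"
    proof (cases "w = v")
      case True
      then show ?thesis using dg[OF v(1)] key H(3,4) by (simp add: d_def n_def)
    next
      case False
      then have wN: "w \<in> neighbors W F v" using w by (simp add: closed_nbhd_def)
      then have "w \<in> W" "F v w" by (auto simp: neighbors_def)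
      then show ?thesis using codg[OF v(1), of w] H(3) H(5)[OF wN] key by (simp add: d_def n_def)
    qed
  qed
qed

lemma log2_lower:
  assumes "2 ^ p \<le> (m::nat) ^ q" "0 < q" "m \<le> t" "0 < m"
  shows "real p / real q \<le> log 2 (real t)"
proof -
  have "real (2 ^ p) \<le> real (m ^ q)" using assms(1) by (simp only: of_nat_le_iff)
  then have "log 2 (2 ^ p) \<le> log 2 (real m ^ q)" by (subst log_le_cancel_iff) (use assms in auto)
  then have "real p \<le> real q * log 2 (real m)" using assms by (simp add: log_nat_power)
  also have "\<dots> \<le> real q * log 2 (real t)" using assms by (intro mult_left_mono) auto
  finally show ?thesis using assms(2) by (simp add: field_simps)
qed

text \<open>Two demands compete: \<open>2 ^ (s\<^sup>2 + s)\<close> must beat \<open>3 ^ s\<close>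
  times \<open>3 * (t - 1)\<close>, which needs \<open>s\<close> of order sqrt (log 2 t), while the
  branch sets of size \<open>2 * s - 1\<close> must fit into the surplus. The factor 2.96 is 16 *
  0.185.\<close>

lemma tuple_length_exists:
  fixes t :: nat
  assumes t: "6 \<le> t" and b: "296 / 100 * real t * sqrt (log 2 (real t)) \<le> b"
  obtains s where "1 \<le> s" "real ((t - 1) * (2 * s - 1)) \<le> b - 3" "3 * (t - 1) * 3 ^ s < (2::nat) ^ (s\<^sup>2 + s)"
proof -
  define L where "L = sqrt (log 2 (real t))"
  have lg0: "0 \<le> log 2 (real t)" using t by simp
  have Lsq: "L\<^sup>2 = log 2 (real t)" unfolding L_def using lg0 by simp
  have Lge: "c \<le> L" if "c\<^sup>2 \<le> log 2 (real t)" for c unfolding L_def using that by (rule real_le_rsqrt)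
  have t1: "real (t - 1) = real t - 1" using t by simp
  show thesis
  proof (cases "t \<le> 51")
    \<comment> \<open>At \<open>s = 3\<close> the last demand reads 81 (t - 1) < 4096, that is
      \<open>t \<le> 51\<close>. The surplus demand is 5 (t - 1) \<le> b - 3: for \<open>t\<close> =
      6, 7 the bound \<open>1.6 \<le> L\<close> suffices, and from 8 on 2.96 * 1.7 exceeds
      5.\<close>
    case True
    have "5 * (real t - 1) \<le> b - 3"
    proof (cases "t \<le> 7")
      case True
      have "real 64 / real 25 \<le> log 2 (real t)" by (rule log2_lower[of _ 6]) (use t in auto)
      then have "16 / 10 \<le> L" by (intro Lge) (simp add: power2_eq_square)
      then have "296 / 100 * real t * (16 / 10) \<le> 296 / 100 * real t * L" by (intro mult_left_mono) auto
      then show ?thesis using b True unfolding L_def by simp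
    next
      case False
      have "real 3 / real 1 \<le> log 2 (real t)" by (rule log2_lower[of _ 8]) (use False in auto)
      then have "17 / 10 \<le> L" by (intro Lge) (simp add: power2_eq_square)
      then have "296 / 100 * real t * (17 / 10) \<le> 296 / 100 * real t * L" by (intro mult_left_mono) auto
      then show ?thesis using b unfolding L_def by simp
    qed
    then show thesis using True t1 by (intro that[of 3]) (auto simp: power_numeral_reduce)
  next
    case False
    have "real 57 / real 10 \<le> log 2 (real t)" by (rule log2_lower[of _ 52]) (use False in auto)
    then have L: "2387 / 1000 \<le> L" by (intro Lge) (simp add: power2_eq_square)
    \<comment> \<open>The largest \<open>s\<close> with \<open>2 * s - 1 \<le> 2.96 L\<close>.
      Rounding costs less than one, so \<open>s\<close> is at least \<open>1.48 L - 1/2\<close>, the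
      number called \<open>y\<close> below.\<close>
    define s where "s = nat \<lfloor>(296 / 100 * L + 1) / 2\<rfloor>"
    have fl: "0 \<le> \<lfloor>(296 / 100 * L + 1) / 2\<rfloor>" using L by simp
    have s_hi: "real s \<le> (296 / 100 * L + 1) / 2" unfolding s_def of_nat_nat[OF fl] by (rule of_int_floor_le)
    have s_lo: "(296 / 100 * L + 1) / 2 - 1 \<le> real s" unfolding s_def of_nat_nat[OF fl] by linarith
    have "1 \<le> real s" using s_lo L by auto
    then have s1: "1 \<le> s" by simp
    have "real (t - 1) * (2 * real s - 1) \<le> (real t - 1) * (296 / 100 * L)"
      unfolding t1 using s_hi t by (intro mult_left_mono) auto
    also have "\<dots> = 296 / 100 * real t * L - 296 / 100 * L" by (simp add: field_simps)
    also have "\<dots> \<le> b - 3" using b L unfolding L_def by linarith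
    finally have c1: "real ((t - 1) * (2 * s - 1)) \<le> b - 3" using s1 by (simp add: of_nat_diff)
    define y where "y = 148 / 100 * L - 1 / 2"
    have y: "y \<le> real s" "3 \<le> y" using s_lo L by (auto simp: y_def)
    \<comment> \<open>With 3 bounded by the power of 2 with exponent 1.6, the last demand becomes
      \<open>L\<^sup>2 + 1.6 \<le> s (s - 0.6)\<close>. For \<open>y\<close> in place of
      \<open>s\<close> the difference is the present product, which vanishes at the lower bound for
      \<open>L\<close>, plus a positive remainder.\<close>
    have "0 \<le> (L - 2387 / 1000) * (11904 / 10000 * L + 47 / 100)" using L by (intro mult_nonneg_nonneg) auto
    moreover have "y * (y - 6 / 10) - (L\<^sup>2 + 16 / 10) =
        (L - 2387 / 1000) * (11904 / 10000 * L + 47 / 100) + (34848 / 10000000 * L + 7189 / 100000)"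
      by (simp add: y_def power2_eq_square field_simps)
    ultimately have "L\<^sup>2 + 16 / 10 \<le> y * (y - 6 / 10)" using L by linarith
    also have "\<dots> \<le> real s * (real s - 6 / 10)" using y by (intro mult_mono) auto
    finally have e: "16 / 10 + L\<^sup>2 + 16 / 10 * real s \<le> real (s\<^sup>2 + s)" by (simp add: power2_eq_square algebra_simps)
    have three: "3 \<le> (2::real) powr (16 / 10)"
    proof -
      have "log 2 3 \<le> real 8 / real 5"
      proof -
        have "log 2 ((3::real) ^ 5) \<le> log 2 (2 ^ 8)" by (subst log_le_cancel_iff) auto
        moreover have "log 2 ((3::real) ^ 5) = 5 * log 2 3" "log 2 ((2::real) ^ 8) = 8"
          by (subst log_nat_power; simp)+
        ultimately have "5 * log 2 3 \<le> (8::real)" by linarith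
        then show ?thesis by simp
      qed
      then have "2 powr (log 2 3) \<le> (2::real) powr (16 / 10)" by (intro powr_mono) auto
      then show ?thesis by simp
    qed
    have "(3::real) ^ s \<le> (2 powr (16 / 10)) ^ s" using three by (intro power_mono) auto
    also have "\<dots> = 2 powr (16 / 10 * real s)" by (simp add: powr_powr flip: powr_realpow)
    finally have three_s: "(3::real) ^ s \<le> 2 powr (16 / 10 * real s)" .
    have tt: "real t = 2 powr (L\<^sup>2)" using t by (simp add: Lsq)
    have "3 * real (t - 1) * 3 ^ s < 3 * real t * 3 ^ s" using t by simp
    also have "\<dots> \<le> 2 powr (16 / 10) * 2 powr (L\<^sup>2) * 2 powr (16 / 10 * real s)"
      unfolding tt using three three_s by (intro mult_mono) auto
    also have "\<dots> = 2 powr (16 / 10 + L\<^sup>2 + 16 / 10 * real s)" by (simp add: powr_add)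
    also have "\<dots> \<le> 2 powr real (s\<^sup>2 + s)" using e by (intro powr_mono) auto
    also have "\<dots> = 2 ^ (s\<^sup>2 + s)" by (rule powr_realpow) simp
    finally have "real (3 * (t - 1) * 3 ^ s) < real (2 ^ (s\<^sup>2 + s))" by simp
    then have "3 * (t - 1) * 3 ^ s < (2::nat) ^ (s\<^sup>2 + s)" by (simp only: of_nat_less_iff)
    then show thesis using that[OF s1 c1] by blast
  qed
qed

theorem min_degree_minor:
  fixes V :: "'a set" and t :: nat
  assumes g: "ugraph E" and V: "finite V" "V \<noteq> {}" and t: "1 \<le> t"
    and deg: "\<And>v. v \<in> V \<Longrightarrow> 16 * real t * sqrt (log 2 (real t)) < card (neighbors V E v)"
  shows "has_Kt_minor V E t"
proof (rule ccontr)
  assume nm: "\<not> has_Kt_minor V E t"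
  define D where "D = nat \<lfloor>16 * real t * sqrt (log 2 (real t))\<rfloor> + 1"
  have x0: "0 \<le> 16 * real t * sqrt (log 2 (real t))" using t by simp
  have D1: "1 \<le> D" by (simp add: D_def)
  have DL: "16 * real t * sqrt (log 2 (real t)) \<le> real D" unfolding D_def using x0 by (simp add: of_nat_nat) linarith
  have Dd: "D \<le> card (neighbors V E v)" if "v \<in> V" for v
  proof -
    have "\<lfloor>16 * real t * sqrt (log 2 (real t))\<rfloor> < int (card (neighbors V E v))"
      using deg[OF that] by (simp add: floor_less_iff)
    then show ?thesis using x0 unfolding D_def by linarith
  qed
  have "(\<Sum>v\<in>V. D) \<le> (\<Sum>v\<in>V. card (neighbors V E v))" by (intro sum_mono Dd)
  then have R: "D * card V \<le> card (incident_pairs V E V)" using V by (simp add: card_incident_pairs_UNIV mult.commute)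
  show False
  proof (cases "t \<le> 5")
    case True
    \<comment> \<open>For \<open>t\<close> from 2 to 5 the exponential bound is already at most
      \<open>16 * t\<close>; the random choice is kept for \<open>t \<ge> 6\<close>, where the
      rounding losses fit into the surplus.\<close>
    have "2 ^ t \<le> D"
    proof (cases "t = 1")
      case True
      obtain v where v: "v \<in> V" using V by blast
      then have "has_Kt_minor V E t" unfolding has_Kt_minor_def True by (intro exI[of _ "\<lambda>_. {v}"]) auto
      then show ?thesis using nm by blast
    next
      case False
      then have "1 \<le> sqrt (log 2 (real t))" using t by (simp add: le_log_iff)
      then have "16 * real t * 1 \<le> 16 * real t * sqrt (log 2 (real t))" by (intro mult_left_mono) auto
      then have "16 * t \<le> D" using DL by linarith
      moreover have "2 ^ t \<le> 16 * t"
      proof -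
        have "t = 2 \<or> t = 3 \<or> t = 4 \<or> t = 5" using True False t by linarith
        then show ?thesis by auto
      qed
      ultimately show ?thesis by linarith
    qed
    then have "2 ^ t * card V \<le> card (incident_pairs V E V)" using R mult_le_mono1 order.trans by blast
    then show False using Mader_minor[OF g V t] nm by blast
  next
    case False
    obtain W c and F :: "'a \<Rightarrow> 'a \<Rightarrow> bool" where W: "ugraph F" "finite W" "\<not> has_Kt_minor W F t" "c \<in> W"
      "card W \<le> D + 1" "\<And>v. v \<in> W \<Longrightarrow> D + 1 \<le> 2 * card (neighbors W F v)"
      by (rule exists_dense_minor_nbhd[OF g V nm D1 R]) (rule that, assumption+)
    define b where "b = 185 / 1000 * (real D + 1)"
    have Wne: "W \<noteq> {}" using W by auto
    obtain U and H :: "'a \<Rightarrow> 'a \<Rightarrow> bool" where U: "ugraph H" "finite U" "U \<noteq> {}" "\<not> has_Kt_minor U H t"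
      "\<And>v. v \<in> U \<Longrightarrow> real (card U) + b - 3 < 2 * real (card (neighbors U H v))"
      by (rule exists_minor_above_half_density[OF W(1,2) Wne W(3,5,6) b_def]) (assumption, rule that, assumption+)
    have "296 / 100 * real t * sqrt (log 2 (real t)) \<le> b" using DL unfolding b_def by simp
    then obtain s where s: "1 \<le> s" "real ((t - 1) * (2 * s - 1)) \<le> b - 3" "3 * (t - 1) * 3 ^ s < (2::nat) ^ (s\<^sup>2 + s)"
      by (rule tuple_length_exists[rotated]) (use False in auto)
    have "card U + (t - 1) * (2 * s - 1) < 2 * card (neighbors U H v)" if "v \<in> U" for v
    proof -
      have "real (card U + (t - 1) * (2 * s - 1)) < real (2 * card (neighbors U H v))"
        using U(5)[OF that] s(2) unfolding of_nat_add by simp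
      then show ?thesis by (simp only: of_nat_less_iff)
    qed
    then show False using dense_graph_minor[OF U(1-3) s(1) _ s(3)] U(4) by blast
  qed
qed

section \<open>Dynamic colouring of degenerate classes\<close>

definition add_edge :: "('a \<Rightarrow> 'a \<Rightarrow> bool) \<Rightarrow> 'a \<Rightarrow> 'a \<Rightarrow> 'a \<Rightarrow> 'a \<Rightarrow> bool" where
  "add_edge E x y = (\<lambda>a b. E a b \<or> a = x \<and> b = y \<or> a = y \<and> b = x)"

lemma ugraph_add_edge: "ugraph E \<Longrightarrow> x \<noteq> y \<Longrightarrow> ugraph (add_edge E x y)"
  by (auto simp: ugraph_def add_edge_def)

text \<open>The palette is fixed in advance so that a free colour for \<open>v\<close> can be found
  by counting. The edge \<open>x y\<close> makes the colours of \<open>x\<close> and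
  \<open>y\<close> differ, so \<open>v\<close> becomes happy. But it also changes the neighbourhoods
  of \<open>x\<close> and \<open>y\<close>, so their happiness in the smaller graph proves nothing
  about \<open>E\<close>; they are made happy directly, by the colour of \<open>v\<close>.\<close>

lemma dynamic_coloring_degenerate_class:
  fixes \<G> :: "'a set \<Rightarrow> ('a \<Rightarrow> 'a \<Rightarrow> bool) \<Rightarrow> bool"
  assumes graph: "\<And>V E. \<G> V E \<Longrightarrow> finite V \<and> ugraph E"
    and del: "\<And>V E v. \<G> V E \<Longrightarrow> v \<in> V \<Longrightarrow> \<G> (V - {v}) E"
    and sup: "\<And>V E v x y. \<G> V E \<Longrightarrow> v \<in> V \<Longrightarrow> x \<in> neighbors V E v \<Longrightarrow> y \<in> neighbors V E v \<Longrightarrow> x \<noteq> y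
        \<Longrightarrow> \<G> (V - {v}) (add_edge E x y)"
    and deg: "\<And>V E. \<G> V E \<Longrightarrow> V \<noteq> {} \<Longrightarrow> \<exists>v\<in>V. card (neighbors V E v) \<le> d"
    and G: "\<G> V E"
  shows "\<exists>c. proper_coloring V E c \<and> (\<forall>v\<in>V. happy V E c v) \<and> c ` V \<subseteq> {..<d + 3}"
  using G
proof (induction "card V" arbitrary: V E rule: less_induct)
  case less
  have fin: "finite V" and g: "ugraph E" using graph[OF less.prems] by auto
  show ?case
  proof (cases "V = {}")
    case True
    then show ?thesis by (simp add: proper_coloring_def)
  next
    case False
    define v where "v = arg_min_on (\<lambda>v. card (neighbors V E v)) V"
    have v: "v \<in> V" unfolding v_def using fin False by (rule arg_min_if_finite(1))
    have vmin: "card (neighbors V E v) \<le> card (neighbors V E u)" if "u \<in> V" for u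
      unfolding v_def using arg_min_least[OF fin False that, of "\<lambda>v. card (neighbors V E v)"] .
    let ?N = "neighbors V E v"
    have kd: "card ?N \<le> d" using deg[OF less.prems False] vmin order.trans by blast
    have fN: "finite ?N" using fin by (simp add: neighbors_def)
    have small: "card (V - {v}) < card V" using fin v by (rule card_Diff1_less)
    \<comment> \<open>\<open>S\<close> collects the neighbours of \<open>v\<close> whose happiness
      is not inherited: \<open>x\<close> and \<open>y\<close>, or, if \<open>v\<close> has at most
      one neighbour, that neighbour, which may be happy in the smaller graph only because its degree
      has dropped to one.\<close>
    obtain F S where FS: "\<G> (V - {v}) F" "\<And>a b. E a b \<Longrightarrow> F a b" "S \<subseteq> ?N" "card S \<le> 2"
      "\<And>a b. a \<notin> S \<Longrightarrow> F a b = E a b" "card ?N \<le> 1 \<and> S = ?N \<or> (\<exists>x\<in>?N. \<exists>y\<in>?N. F x y \<and> S = {x, y})"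
    proof (cases "card ?N \<le> 1")
      case True
      then show thesis using that[of E ?N] del[OF less.prems v] by auto
    next
      case False
      then obtain x y where xy: "x \<in> ?N" "y \<in> ?N" "x \<noteq> y" using card_le_Suc0_iff_eq[OF fN] by auto
      show thesis
        by (rule that[of "add_edge E x y" "{x, y}"], rule sup[OF less.prems v xy]) (use xy in \<open>auto simp: add_edge_def\<close>)
    qed
    have gF: "ugraph F" using graph[OF FS(1)] by blast
    obtain c where c: "proper_coloring (V - {v}) F c" "\<And>u. u \<in> V - {v} \<Longrightarrow> happy (V - {v}) F c u" "c ` (V - {v}) \<subseteq> {..<d + 3}"
      using less.hyps[OF small FS(1)] by blast
    \<comment> \<open>If \<open>u\<close> has no neighbour besides \<open>v\<close>, it is happy by
      its degree, and the arbitrary value of \<open>w u\<close> merely forbids one more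
      colour.\<close>
    define w where "w u = (SOME w. w \<in> neighbors (V - {v}) E u)" for u
    have w: "w u \<in> neighbors (V - {v}) E u" if "neighbors (V - {v}) E u \<noteq> {}" for u
      unfolding w_def using that by (simp add: some_in_eq)
    have fS: "finite S" using FS(3) fN finite_subset by blast
    \<comment> \<open>At most \<open>d\<close> colours come from the neighbours of \<open>v\<close>
      and at most two from \<open>S\<close>, so one of \<open>d + 3\<close> colours is free.\<close>
    define Fb where "Fb = c ` ?N \<union> (\<lambda>u. c (w u)) ` S"
    have "card Fb \<le> card (c ` ?N) + card ((\<lambda>u. c (w u)) ` S)" unfolding Fb_def by (rule card_Un_le)
    also have "\<dots> \<le> card ?N + card S" using fN fS by (intro add_mono card_image_le)
    also have "\<dots> < card {..<d + 3}" using kd FS(4) by simp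
    finally have "\<not> {..<d + 3} \<subseteq> Fb" using fN fS card_mono[of Fb "{..<d + 3}"] unfolding Fb_def by auto
    then obtain k where k: "k < d + 3" "k \<notin> Fb" by auto
    define c' where "c' = c(v := k)"
    have c'v: "c' v = k" by (simp add: c'_def)
    have c'o: "u \<noteq> v \<Longrightarrow> c' u = c u" for u by (simp add: c'_def)
    have Nv: "u \<noteq> v" if "u \<in> ?N" for u using that ugraph_irrefl[OF g] by (auto simp: neighbors_def)
    have kN: "k \<noteq> c u" if "u \<in> ?N" for u using k(2) that by (auto simp: Fb_def)
    have proper: "proper_coloring V E c'"
      unfolding proper_coloring_def
    proof (intro ballI impI)
      fix a b assume ab: "a \<in> V" "b \<in> V" "E a b"
      have ba: "E b a" using ab ugraph_sym[OF g] by blast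
      have ne: "a \<noteq> b" using ab ugraph_irrefl[OF g] by auto
      consider "a = v" | "b = v" | "a \<noteq> v" "b \<noteq> v" by blast
      then show "c' a \<noteq> c' b"
      proof cases
        case 1
        then show ?thesis using kN[of b] ab ne by (simp add: neighbors_def c'_def)
      next
        case 2
        then show ?thesis using kN[of a] ab ba ne by (auto simp: neighbors_def c'_def)
      next
        case 3
        then show ?thesis using c(1) ab FS(2) by (simp add: proper_coloring_def c'_def)
      qed
    qed
    have happy: "happy V E c' u" if u: "u \<in> V" for u
    proof (cases "u = v")
      case True
      show ?thesis
      proof (cases "card ?N \<le> 1")
        case True
        then show ?thesis using \<open>u = v\<close> by (simp add: happy_def)
      next
        case False
        then obtain x y where xy: "x \<in> ?N" "y \<in> ?N" "F x y" using FS(6) by blast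
        then have "c x \<noteq> c y" using c(1) Nv by (auto simp: proper_coloring_def neighbors_def)
        then have "c' x \<noteq> c' y" using xy Nv c'o by simp
        then show ?thesis using xy \<open>u = v\<close> by (auto simp: happy_def)
      qed
    next
      case uv: False
      show ?thesis
      proof (cases "u \<in> S")
        case True
        then have uN: "u \<in> ?N" using FS(3) by blast
        then have vu: "v \<in> neighbors V E u" using v ugraph_sym[OF g] by (auto simp: neighbors_def)
        show ?thesis
        proof (cases "neighbors (V - {v}) E u = {}")
          case True
          then have "neighbors V E u = {v}" using vu by (auto simp: neighbors_def)
          then show ?thesis by (simp add: happy_def)
        next
          case False
          have wu: "w u \<in> neighbors V E u" "w u \<noteq> v" using w[OF False] by (auto simp: neighbors_def)
          have "k \<noteq> c (w u)" using k(2) \<open>u \<in> S\<close> by (auto simp: Fb_def)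
          then have "c' v \<noteq> c' (w u)" using wu c'o c'v by simp
          then show ?thesis using wu vu by (auto simp: happy_def)
        qed
      next
        case False
        have Nu: "neighbors (V - {v}) F u = neighbors (V - {v}) E u" using FS(5)[OF False] by (simp add: neighbors_def)
        have hu: "happy (V - {v}) E c u" using c(2)[of u] u uv Nu by (simp add: happy_def)
        show ?thesis
        proof (cases "u \<in> ?N")
          case True
          \<comment> \<open>A neighbour \<open>u\<close> of \<open>v\<close> outside
            \<open>S\<close> exists only if \<open>v\<close> has degree at least 3. By minimality
            \<open>u\<close> has too, so two neighbours of \<open>u\<close> remain without
            \<open>v\<close>, and its happiness there is witnessed by two colours rather than by a
            small degree.\<close>
          then have "\<exists>x\<in>?N. \<exists>y\<in>?N. F x y \<and> S = {x, y}" using FS(6) False by blast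
          then obtain x y where xy: "x \<in> ?N" "y \<in> ?N" "F x y" "S = {x, y}" by blast
          have "x \<noteq> y" using xy(3) ugraph_irrefl[OF gF] by auto
          then have "card {u, x, y} = 3" using False xy(4) by auto
          moreover have "card {u, x, y} \<le> card ?N" using fN True xy by (intro card_mono) auto
          ultimately have "3 \<le> card (neighbors V E u)" using vmin[OF u] by simp
          moreover have "neighbors V E u \<subseteq> insert v (neighbors (V - {v}) E u)" by (auto simp: neighbors_def)
          then have "card (neighbors V E u) \<le> card (insert v (neighbors (V - {v}) E u))"
            using fin by (intro card_mono) (auto simp: neighbors_def)
          then have "card (neighbors V E u) \<le> card (neighbors (V - {v}) E u) + 1"
            using fin by (simp add: card_insert_if neighbors_def split: if_splits)
          ultimately have "\<not> card (neighbors (V - {v}) E u) \<le> 1" by linarith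
          then obtain a b where ab: "a \<in> neighbors (V - {v}) E u" "b \<in> neighbors (V - {v}) E u" "c a \<noteq> c b"
            using hu unfolding happy_def by blast
          then have "a \<in> neighbors V E u" "b \<in> neighbors V E u" "c' a \<noteq> c' b" by (auto simp: neighbors_def c'_def)
          then show ?thesis unfolding happy_def by blast
        next
          case nN: False
          have eq: "neighbors V E u = neighbors (V - {v}) E u"
            using nN u ugraph_sym[OF g] by (auto simp: neighbors_def)
          have co: "\<And>a. a \<in> neighbors (V - {v}) E u \<Longrightarrow> c' a = c a" by (auto simp: neighbors_def c'_def)
          show ?thesis using hu co unfolding happy_def eq by metis
        qed
      qed
    qed
    have "c' ` V \<subseteq> {..<d + 3}" using c(3) k(1) by (auto simp: c'_def)
    then show ?thesis using proper happy by blast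
  qed
qed

lemma dynamically_colorable_if_bounded_palette:
  assumes "proper_coloring V E c \<and> (\<forall>v\<in>V. happy V E c v) \<and> c ` V \<subseteq> {..<m}"
  shows "dynamically_colorable V E m"
  unfolding dynamically_colorable_def dynamic_coloring_def
  using assms card_mono[of "{..<m}" "c ` V"] by (intro exI[of _ c]) auto

text \<open>Deleting \<open>v\<close> and joining \<open>x\<close> to \<open>y\<close> gives a
  subgraph of the contraction of the edge \<open>x v\<close> onto \<open>x\<close>.\<close>

lemma has_Kt_minor_suppress:
  assumes g: "ugraph E" and v: "v \<in> V" "x \<in> neighbors V E v" "y \<in> neighbors V E v" "x \<noteq> y"
    and m: "has_Kt_minor (V - {v}) (add_edge E x y) t"
  shows "has_Kt_minor V E t"
proof -
  have vx: "E x v" "x \<in> V" "E v y" using v ugraph_sym[OF g] by (auto simp: neighbors_def)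
  obtain B where B: "\<And>i. i < t \<Longrightarrow> B i \<noteq> {} \<and> B i \<subseteq> V - {v} \<and> connected_set (add_edge E x y) (B i)"
    "\<And>i j. i < t \<Longrightarrow> j < t \<Longrightarrow> i \<noteq> j \<Longrightarrow> B i \<inter> B j = {}"
    "\<And>i j. i < t \<Longrightarrow> j < t \<Longrightarrow> i \<noteq> j \<Longrightarrow> \<exists>a\<in>B i. \<exists>b\<in>B j. add_edge E x y a b"
    using m by (rule has_Kt_minorE) (rule that, assumption+)
  have sub: "contract E x v a b" if "add_edge E x y a b" "a \<noteq> v" "b \<noteq> v" for a b
    using that vx v(4) ugraph_irrefl[OF g] ugraph_sym[OF g] by (auto simp: add_edge_def contract_def)
  have nv: "a \<noteq> v" if "a \<in> B i" "i < t" for a i using B(1)[OF that(2)] that(1) by auto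
  have "has_Kt_minor (V - {v}) (contract E x v) t"
    unfolding has_Kt_minor_def
  proof (intro exI[of _ B] conjI allI impI)
    fix i assume i: "i < t"
    show "connected_set (contract E x v) (B i)"
      by (rule connected_set_cong[of "add_edge E x y"]) (use B(1)[OF i] sub nv[OF _ i] in auto)
    show "B i \<noteq> {}" "B i \<subseteq> V - {v}" using B(1)[OF i] by auto
    fix j assume j: "j < t" and ij: "i \<noteq> j"
    show "B i \<inter> B j = {}" by (rule B(2)[OF i j ij])
    show "\<exists>u\<in>B i. \<exists>w\<in>B j. contract E x v u w" using B(3)[OF i j ij] sub nv[OF _ i] nv[OF _ j] by blast
  qed
  then show ?thesis by (rule has_Kt_minor_contract[OF g vx(2) v(1) vx(1)])
qed

theorem dynamically_colorable_no_minor: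
  fixes V :: "'a set" and t :: nat
  assumes V: "finite V" and g: "ugraph E" and t: "1 \<le> t" and nm: "\<not> has_Kt_minor V E t"
  shows "dynamically_colorable V E (nat \<lfloor>16 * real t * sqrt (log 2 (real t))\<rfloor> + 3)"
proof -
  define d where "d = nat \<lfloor>16 * real t * sqrt (log 2 (real t))\<rfloor>"
  define \<G> where "\<G> = (\<lambda>(V :: 'a set) E. finite V \<and> ugraph E \<and> \<not> has_Kt_minor V E t)"
  have "\<exists>c. proper_coloring V E c \<and> (\<forall>v\<in>V. happy V E c v) \<and> c ` V \<subseteq> {..<d + 3}"
  proof (rule dynamic_coloring_degenerate_class[of \<G>])
    fix V E v assume G: "\<G> V E" and v: "v \<in> V"
    have "\<not> has_Kt_minor (V - {v}) E t"
      by (rule contrapos_nn[of "has_Kt_minor V E t"]) (use G in \<open>simp add: \<G>_def\<close>, erule has_Kt_minor_mono, auto)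
    then show "\<G> (V - {v}) E" using G by (simp add: \<G>_def)
  next
    fix V E v x y assume G: "\<G> V E" and v: "v \<in> V" "x \<in> neighbors V E v" "y \<in> neighbors V E v" "x \<noteq> y"
    have "\<not> has_Kt_minor (V - {v}) (add_edge E x y) t"
      by (rule contrapos_nn[of "has_Kt_minor V E t"])
        (use G in \<open>simp add: \<G>_def\<close>, rule has_Kt_minor_suppress[OF _ v], use G in \<open>simp add: \<G>_def\<close>)
    then show "\<G> (V - {v}) (add_edge E x y)" using G ugraph_add_edge[OF _ v(4)] by (simp add: \<G>_def)
  next
    fix V E assume G: "\<G> V E" and ne: "V \<noteq> {}"
    show "\<exists>v\<in>V. card (neighbors V E v) \<le> d"
    proof (rule ccontr)
      assume a: "\<not> ?thesis"
      have "16 * real t * sqrt (log 2 (real t)) < card (neighbors V E v)" if "v \<in> V" for v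
      proof -
        have "d < card (neighbors V E v)" using a that by auto
        then have "\<lfloor>16 * real t * sqrt (log 2 (real t))\<rfloor> < int (card (neighbors V E v))" unfolding d_def by linarith
        then show ?thesis by (simp add: floor_less_iff)
      qed
      then have "has_Kt_minor V E t" using G ne t by (intro min_degree_minor) (auto simp: \<G>_def)
      then show False using G by (simp add: \<G>_def)
    qed
  qed (use V g nm in \<open>auto simp: \<G>_def\<close>)
  then show ?thesis unfolding d_def by (blast intro: dynamically_colorable_if_bounded_palette)
qed

section \<open>Subdivisions, Menger's theorem and linkages\<close>

lemma reach_in_path:
  assumes "reach_in E S a b" "a \<in> S"
  shows "\<exists>p. p \<noteq> [] \<and> distinct p \<and> set p \<subseteq> S \<and> successively E p \<and> hd p = a \<and> last p = b"
  using assms(1)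
proof (induction rule: rtranclp_induct)
  case base
  then show ?case using assms(2) by (intro exI[of _ "[a]"]) auto
next
  case (step y z)
  then obtain p where p: "p \<noteq> []" "distinct p" "set p \<subseteq> S" "successively E p" "hd p = a" "last p = y" by blast
  show ?case
  proof (cases "z \<in> set p")
    case True
    then obtain xs ys where xy: "p = xs @ z # ys" by (meson split_list)
    have "hd (xs @ [z]) = a" using p(5) xy by (cases xs) auto
    then show ?thesis using p(2-4) unfolding xy
      by (intro exI[of _ "xs @ [z]"]) (auto simp: successively_append_iff)
  next
    case False
    then show ?thesis using p step(2) by (intro exI[of _ "p @ [z]"]) (auto simp: successively_append_iff)
  qed
qed

lemma connected_set_path:
  assumes "connected_set E S" "a \<in> S" "b \<in> S" "S \<subseteq> V"
  shows "\<exists>p. is_path V E p \<and> set p \<subseteq> S \<and> hd p = a \<and> last p = b"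
proof -
  obtain p where "p \<noteq> []" "distinct p" "set p \<subseteq> S" "successively E p" "hd p = a" "last p = b"
    using reach_in_path[OF connected_set_reach[OF assms(1-3)] assms(2)] by blast
  then show ?thesis using assms(4) by (intro exI[of _ p]) (auto simp: is_path_def successively_conv_nth)
qed

lemma connected_set_successively:
  assumes "ugraph E" "successively E p" "p \<noteq> []"
  shows "connected_set E (set p)"
  using assms(3,2)
proof (induction p rule: list_nonempty_induct)
  case (cons x xs)
  have "E x (hd xs)" "successively E xs" using cons by (auto simp: successively_Cons)
  then show ?case using connected_set_insert[OF assms(1) cons.IH, of "hd xs" x] cons(1) by simp
qed simp

lemma internal_subset: "distinct p \<Longrightarrow> internal p \<subseteq> set p - {hd p, last p}"
proof (cases p)
  case (Cons a q)
  assume "distinct p"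
  then show ?thesis unfolding internal_def using Cons
    by (cases q rule: rev_cases) auto
qed (simp add: internal_def)

lemma set_path_minus_ends: "p \<noteq> [] \<Longrightarrow> set p - {hd p, last p} \<subseteq> internal p"
proof (cases p)
  case (Cons a q)
  then show ?thesis unfolding internal_def
    by (cases q rule: rev_cases) auto
qed (simp add: internal_def)

text \<open>Paths are replaced by connected sets containing both branch vertices. Such sets can be
  enlarged and united without path surgery; a path inside each is extracted only at the end.\<close>

definition Kt_subdivision :: "'a set \<Rightarrow> ('a \<Rightarrow> 'a \<Rightarrow> bool) \<Rightarrow> nat \<Rightarrow> (nat \<Rightarrow> 'a) \<Rightarrow> (nat \<Rightarrow> nat \<Rightarrow> 'a set) \<Rightarrow> bool" where
  "Kt_subdivision V E t f S \<longleftrightarrow> inj_on f {..<t} \<and> f ` {..<t} \<subseteq> V \<and>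
     (\<forall>i j. i < j \<and> j < t \<longrightarrow> connected_set E (S i j) \<and> S i j \<subseteq> V \<and> f i \<in> S i j \<and> f j \<in> S i j \<and>
        (S i j - {f i, f j}) \<inter> f ` {..<t} = {}) \<and>
     (\<forall>i j k l. i < j \<and> j < t \<and> k < l \<and> l < t \<and> (i, j) \<noteq> (k, l) \<longrightarrow>
        (S i j - {f i, f j}) \<inter> (S k l - {f k, f l}) = {})"

lemma has_Kt_topological_minorI:
  assumes "Kt_subdivision V E t f S"
  shows "has_Kt_topological_minor V E t"
proof -
  have S: "connected_set E (S i j)" "S i j \<subseteq> V" "f i \<in> S i j" "f j \<in> S i j" "(S i j - {f i, f j}) \<inter> f ` {..<t} = {}"
    if "i < j" "j < t" for i j using assms that unfolding Kt_subdivision_def by auto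
  have D: "(S i j - {f i, f j}) \<inter> (S k l - {f k, f l}) = {}" if "i < j" "j < t" "k < l" "l < t" "(i, j) \<noteq> (k, l)" for i j k l
    using assms that unfolding Kt_subdivision_def by blast
  define P where "P i j = (SOME p. is_path V E p \<and> set p \<subseteq> S i j \<and> hd p = f i \<and> last p = f j)" for i j
  have P: "is_path V E (P i j) \<and> set (P i j) \<subseteq> S i j \<and> hd (P i j) = f i \<and> last (P i j) = f j" if "i < j" "j < t" for i j
    unfolding P_def by (rule someI_ex) (rule connected_set_path[OF S(1,3,4,2)[OF that]])
  have int: "internal (P i j) \<subseteq> S i j - {f i, f j}" if "i < j" "j < t" for i j
    using P[OF that] internal_subset[of "P i j"] by (auto simp: is_path_def)
  show ?thesis unfolding has_Kt_topological_minor_def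
  proof (intro exI[of _ f] exI[of _ P] conjI allI impI; (elim conjE)?)
    show "inj_on f {..<t}" "f ` {..<t} \<subseteq> V" using assms by (auto simp: Kt_subdivision_def)
    fix i j assume ij: "i < j" "j < t"
    show "is_path V E (P i j)" "hd (P i j) = f i" "last (P i j) = f j" using P[OF ij] by auto
    show "internal (P i j) \<inter> f ` {..<t} = {}" using int[OF ij] S(5)[OF ij] by blast
    fix k l assume kl: "k < l" "l < t" "(i, j) \<noteq> (k, l)"
    show "internal (P i j) \<inter> internal (P k l) = {}" using int[OF ij] int[OF kl(1,2)] D[OF ij kl] by blast
  qed
qed

lemma has_Kt_topological_minorE:
  assumes "has_Kt_topological_minor V E t" "ugraph E"
  obtains f S where "Kt_subdivision V E t f S"
proof -
  obtain f P where f: "inj_on f {..<t}" "f ` {..<t} \<subseteq> V"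
    and P: "\<forall>i j. i < j \<and> j < t \<longrightarrow> is_path V E (P i j) \<and> hd (P i j) = f i \<and> last (P i j) = f j
          \<and> internal (P i j) \<inter> f ` {..<t} = {}"
    and D: "\<forall>i j k l. i < j \<and> j < t \<and> k < l \<and> l < t \<and> (i, j) \<noteq> (k, l) \<longrightarrow> internal (P i j) \<inter> internal (P k l) = {}"
    using assms(1) unfolding has_Kt_topological_minor_def by (elim exE conjE) (rule that)
  have P': "is_path V E (P i j)" "hd (P i j) = f i" "last (P i j) = f j" "internal (P i j) \<inter> f ` {..<t} = {}"
    if "i < j" "j < t" for i j using P that by auto
  have D': "internal (P i j) \<inter> internal (P k l) = {}" if "i < j" "j < t" "k < l" "l < t" "(i, j) \<noteq> (k, l)" for i j k l
    using D that by blast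
  have ne: "P i j \<noteq> []" if "i < j" "j < t" for i j using P'(1)[OF that] by (simp add: is_path_def)
  have sub: "set (P i j) - {f i, f j} \<subseteq> internal (P i j)" if "i < j" "j < t" for i j
    using set_path_minus_ends[OF ne[OF that]] P'(2,3)[OF that] by simp
  have "Kt_subdivision V E t f (\<lambda>i j. set (P i j))" unfolding Kt_subdivision_def
  proof (intro conjI allI impI f; (elim conjE)?)
    fix i j assume ij: "i < j" "j < t"
    show "connected_set E (set (P i j))"
      using P'(1)[OF ij] by (intro connected_set_successively assms(2)) (auto simp: is_path_def successively_conv_nth)
    show "set (P i j) \<subseteq> V" using P'(1)[OF ij] by (simp add: is_path_def)
    show "f i \<in> set (P i j)" "f j \<in> set (P i j)" using P'[OF ij] hd_in_set[OF ne[OF ij]] last_in_set[OF ne[OF ij]] by auto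
    show "(set (P i j) - {f i, f j}) \<inter> f ` {..<t} = {}" using sub[OF ij] P'(4)[OF ij] by blast
    fix k l assume kl: "k < l" "l < t" "(i, j) \<noteq> (k, l)"
    show "(set (P i j) - {f i, f j}) \<inter> (set (P k l) - {f k, f l}) = {}"
      using sub[OF ij] sub[OF kl(1,2)] D'[OF ij kl] by blast
  qed
  then show thesis by (rule that)
qed

lemma connected_set_subdivide:
  assumes g: "ugraph E" and v: "E x v" "E v y" and S: "connected_set (add_edge E x y) S"
  shows "connected_set E (if x \<in> S \<and> y \<in> S then insert v S else S)" (is "connected_set E ?S")
proof -
  have st: "reach_in E ?S a b" if ab: "a \<in> S" "b \<in> S" "add_edge E x y a b" for a b
  proof (cases "E a b")
    case True
    then show ?thesis using ab by auto
  next
    case False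
    then have "a = x \<and> b = y \<or> a = y \<and> b = x" using ab(3) by (auto simp: add_edge_def)
    then have "a \<in> ?S \<and> v \<in> ?S \<and> E a v" "v \<in> ?S \<and> b \<in> ?S \<and> E v b"
      using ab v ugraph_sym[OF g] by auto
    then show ?thesis by (rule converse_rtranclp_into_rtranclp[OF _ r_into_rtranclp])
  qed
  have r: "reach_in E ?S a b" if "reach_in (add_edge E x y) S a b" for a b
    using that
  proof (induction rule: rtranclp_induct)
    case (step y z)
    have "reach_in E ?S y z" by (rule st) (use step in auto)
    with step.IH show ?case by (rule rtranclp_trans)
  qed simp
  show ?thesis
  proof (cases "x \<in> S \<and> y \<in> S")
    case True
    have "reach_in E (insert v S) x z" if "z \<in> insert v S" for z
    proof (cases "z = v")
      case True
      then show ?thesis using v \<open>x \<in> S \<and> y \<in> S\<close> by auto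
    next
      case False
      then show ?thesis using r[of x z] connected_set_reach[OF S, of x z] that True by simp
    qed
    then show ?thesis using connected_setI_root[OF g, of "insert v S" x] True by simp
  next
    case False
    have "connected_set E S" unfolding connected_set_def
    proof (intro ballI)
      fix a b assume "a \<in> S" "b \<in> S"
      then show "reach_in E S a b" using r[OF connected_set_reach[OF S]] False by (simp only: if_False)
    qed
    then show ?thesis using False by auto
  qed
qed

lemma has_Kt_topological_minor_suppress:
  assumes g: "ugraph E" and v: "v \<in> V" "x \<in> neighbors V E v" "y \<in> neighbors V E v" "x \<noteq> y"
    and m: "has_Kt_topological_minor (V - {v}) (add_edge E x y) t"
  shows "has_Kt_topological_minor V E t"
proof -
  have vx: "E x v" "x \<in> V" "E v y" using v ugraph_sym[OF g] by (auto simp: neighbors_def)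
  obtain f S where K: "Kt_subdivision (V - {v}) (add_edge E x y) t f S"
    using has_Kt_topological_minorE[OF m ugraph_add_edge[OF g v(4)]] .
  have f: "inj_on f {..<t}" "f ` {..<t} \<subseteq> V - {v}" using K by (auto simp: Kt_subdivision_def)
  have S: "connected_set (add_edge E x y) (S i j)" "S i j \<subseteq> V - {v}" "f i \<in> S i j" "f j \<in> S i j" "(S i j - {f i, f j}) \<inter> f ` {..<t} = {}"
    if "i < j" "j < t" for i j using K that unfolding Kt_subdivision_def by auto
  have D: "(S i j - {f i, f j}) \<inter> (S k l - {f k, f l}) = {}" if "i < j" "j < t" "k < l" "l < t" "(i, j) \<noteq> (k, l)" for i j k l
    using K that unfolding Kt_subdivision_def by blast
  define T where "T i j = (if x \<in> S i j \<and> y \<in> S i j then insert v (S i j) else S i j)" for i j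
  have ends: "z \<in> {f i, f j}" if "i < j" "j < t" "k < l" "l < t" "(i, j) \<noteq> (k, l)" "z \<in> S i j" "z \<in> S k l" for i j k l z
  proof (rule ccontr)
    assume n: "z \<notin> {f i, f j}"
    then have "z \<notin> f ` {..<t}" using S(5)[OF that(1,2)] that(6) by blast
    then have "z \<notin> {f k, f l}" using that by auto
    then show False using n D[OF that(1-5)] that(6,7) by blast
  qed
  \<comment> \<open>Sets of different pairs meet only in common branch vertices, and two different
    pairs have at most one of these in common. So at most one set contains both \<open>x\<close> and
    \<open>y\<close>, and \<open>v\<close> can be inserted there without spoiling
    disjointness.\<close>
  have uniq: "\<not> (x \<in> S i j \<and> y \<in> S i j \<and> x \<in> S k l \<and> y \<in> S k l)"
    if ij: "i < j" "j < t" "k < l" "l < t" "(i, j) \<noteq> (k, l)" for i j k l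
  proof
    assume a: "x \<in> S i j \<and> y \<in> S i j \<and> x \<in> S k l \<and> y \<in> S k l"
    have ne: "(k, l) \<noteq> (i, j)" using ij(5) by auto
    have "x \<in> {f i, f j}" "y \<in> {f i, f j}" using ends[OF ij] a by blast+
    moreover have "x \<in> {f k, f l}" "y \<in> {f k, f l}" using ends[OF ij(3,4,1,2) ne] a by blast+
    ultimately have eq: "{f i, f j} = {f k, f l}" using v(4) by auto
    have "f ` {i, j} = f ` {k, l}" using eq by simp
    then have "{i, j} = {k, l}" using inj_on_image_eq_iff[OF f(1), of "{i, j}" "{k, l}"] ij by auto
    then show False using ij by (auto simp: doubleton_eq_iff)
  qed
  have "Kt_subdivision V E t f T" unfolding Kt_subdivision_def
  proof (intro conjI allI impI f(1); (elim conjE)?)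
    show "f ` {..<t} \<subseteq> V" using f(2) by blast
    fix i j assume ij: "i < j" "j < t"
    show "connected_set E (T i j)" unfolding T_def by (rule connected_set_subdivide[OF g vx(1,3) S(1)[OF ij]])
    show "T i j \<subseteq> V" "f i \<in> T i j" "f j \<in> T i j" using S(2-4)[OF ij] v(1) by (auto simp: T_def)
    show "(T i j - {f i, f j}) \<inter> f ` {..<t} = {}" using S(5)[OF ij] f(2) by (auto simp: T_def)
    fix k l assume kl: "k < l" "l < t" "(i, j) \<noteq> (k, l)"
    have "v \<notin> T i j \<or> v \<notin> T k l" using uniq[OF ij kl] S(2)[OF ij] S(2)[OF kl(1,2)] by (auto simp: T_def)
    then show "(T i j - {f i, f j}) \<inter> (T k l - {f k, f l}) = {}"
      using D[OF ij kl] by (auto simp: T_def split: if_splits)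
  qed
  then show ?thesis by (rule has_Kt_topological_minorI)
qed

lemma has_Kt_topological_minor_mono:
  assumes "has_Kt_topological_minor V E t" "V \<subseteq> V'"
  shows "has_Kt_topological_minor V' E t"
proof -
  obtain f P where f: "inj_on f {..<t}" "f ` {..<t} \<subseteq> V"
    and P: "\<forall>i j. i < j \<and> j < t \<longrightarrow> is_path V E (P i j) \<and> hd (P i j) = f i \<and> last (P i j) = f j
          \<and> internal (P i j) \<inter> f ` {..<t} = {}"
    and D: "\<forall>i j k l. i < j \<and> j < t \<and> k < l \<and> l < t \<and> (i, j) \<noteq> (k, l) \<longrightarrow> internal (P i j) \<inter> internal (P k l) = {}"
    using assms(1) unfolding has_Kt_topological_minor_def by (elim exE conjE) (rule that)
  have mono: "is_path V' E p" if "is_path V E p" for p using that assms(2) by (auto simp: is_path_def)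
  have P': "is_path V E (P i j)" "hd (P i j) = f i" "last (P i j) = f j" "internal (P i j) \<inter> f ` {..<t} = {}"
    if "i < j" "j < t" for i j using P that by auto
  show ?thesis unfolding has_Kt_topological_minor_def
  proof (intro exI[of _ f] exI[of _ P] conjI f(1) D; (intro allI impI)?; (elim conjE)?)
    show "f ` {..<t} \<subseteq> V'" using f(2) assms(2) by (rule order.trans)
  qed (use P' mono in auto)
qed

section \<open>Separations and Menger's theorem\<close>

definition separation :: "'a set \<Rightarrow> ('a \<Rightarrow> 'a \<Rightarrow> bool) \<Rightarrow> 'a set \<Rightarrow> 'a set \<Rightarrow> bool" where
  "separation V E A B \<longleftrightarrow> A \<union> B = V \<and> (\<forall>a\<in>A - B. \<forall>b\<in>B - A. \<not> E a b)"

lemma separationD: "separation V E A B \<Longrightarrow> a \<in> A \<Longrightarrow> a \<notin> B \<Longrightarrow> b \<in> B \<Longrightarrow> b \<notin> A \<Longrightarrow> \<not> E a b"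
  by (auto simp: separation_def)

lemma separation_Un: "separation V E A B \<Longrightarrow> A \<union> B = V"
  by (simp add: separation_def)

text \<open>Induction on the number of edges, with connected sets in place of paths. If deleting an
  edge destroys the hypothesis, this edge \<open>u v\<close> crosses a separation of order
  \<open>card X - 1\<close>, and adding either end to the boundary gives a set of size
  \<open>card X\<close>. The induction hypothesis leads \<open>X\<close> to one of these sets on the
  near side and leads the other to \<open>L\<close> on the far side; the pieces are glued along the
  boundary and along \<open>u v\<close>.\<close>

theorem Menger:
  assumes "ugraph E" "finite V" "X \<subseteq> V" "L \<subseteq> V"
    and "\<And>A B. separation V E A B \<Longrightarrow> X \<subseteq> A \<Longrightarrow> L \<subseteq> B \<Longrightarrow> card X \<le> card (A \<inter> B)"
  shows "\<exists>T. \<forall>x\<in>X. x \<in> T x \<and> T x \<subseteq> V \<and> connected_set E (T x) \<and> T x \<inter> L \<noteq> {} \<and> (\<forall>y\<in>X. y \<noteq> x \<longrightarrow> T x \<inter> T y = {})"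
  using assms
proof (induction "card (incident_pairs V E V)" arbitrary: V E X L rule: less_induct)
  case less
  note g = less.prems(1) and fin = less.prems(2) and XV = less.prems(3) and LV = less.prems(4) and sep = less.prems(5)
  have fX: "finite X" using fin XV finite_subset by blast
  show ?case
  proof (cases "\<exists>p\<in>V. \<exists>q\<in>V. E p q")
    case False
    \<comment> \<open>Without edges any two sets that cover \<open>V\<close> form a separation. The
      boundary of this one is \<open>X \<inter> L\<close>, which forces
      \<open>X \<subseteq> L\<close>.\<close>
    have "separation V E X (V - X \<union> L \<inter> X)" using False XV LV by (auto simp: separation_def)
    from sep[OF this] LV have "card X \<le> card (X \<inter> (V - X \<union> L \<inter> X))" by blast
    also have "X \<inter> (V - X \<union> L \<inter> X) = X \<inter> L" by auto
    finally have "X \<inter> L = X" using fX by (intro card_seteq) auto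
    then show ?thesis using XV by (intro exI[of _ "\<lambda>x. {x}"]) auto
  next
    case True
    then obtain p q where pq: "p \<in> V" "q \<in> V" "E p q" by blast
    let ?F = "delete_edge E p q"
    have gF: "ugraph ?F" by (rule ugraph_delete_edge[OF g])
    have cF: "card (incident_pairs V ?F V) < card (incident_pairs V E V)"
      using card_incident_pairs_delete_edge[OF g fin pq, of V] pq by simp
    have FE: "connected_set E T" if "connected_set ?F T" for T
      using that by (rule connected_set_cong) (rule delete_edge_imp)
    show ?thesis
    proof (cases "\<exists>A B. separation V ?F A B \<and> X \<subseteq> A \<and> L \<subseteq> B \<and> card (A \<inter> B) < card X")
      case False
      have "\<exists>T. \<forall>x\<in>X. x \<in> T x \<and> T x \<subseteq> V \<and> connected_set ?F (T x) \<and> T x \<inter> L \<noteq> {} \<and> (\<forall>y\<in>X. y \<noteq> x \<longrightarrow> T x \<inter> T y = {})"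
      proof (rule less.hyps[OF cF gF fin XV LV], rule ccontr)
        fix A B assume "separation V ?F A B" "X \<subseteq> A" "L \<subseteq> B" "\<not> card X \<le> card (A \<inter> B)"
        then show False using False unfolding not_le by blast
      qed
      then obtain T where T: "\<forall>x\<in>X. x \<in> T x \<and> T x \<subseteq> V \<and> connected_set ?F (T x) \<and> T x \<inter> L \<noteq> {} \<and> (\<forall>y\<in>X. y \<noteq> x \<longrightarrow> T x \<inter> T y = {})" by blast
      have "connected_set E (T x)" if "x \<in> X" for x by (rule FE) (use T that in blast)
      then show ?thesis using T by (intro exI[of _ T]) blast
    next
      case True
      then obtain A B where AB: "separation V ?F A B" "X \<subseteq> A" "L \<subseteq> B" "card (A \<inter> B) < card X" by blast
      have "\<not> separation V E A B" using sep[OF _ AB(2,3)] AB(4) by force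
      then obtain u v where uv: "u \<in> A - B" "v \<in> B - A" "E u v" using AB(1) by (auto simp: separation_def)
      have "\<not> ?F u v" using AB(1) uv by (auto simp: separation_def)
      then have upq: "{u, v} = {p, q}" using uv(3) by (auto simp: delete_edge_def)
      have F: "?F a b \<longleftrightarrow> E a b \<and> {a, b} \<noteq> {u, v}" for a b by (simp add: delete_edge_def upq)
      have VAB: "V = A \<union> B" using separation_Un[OF AB(1)] by simp
      have fA: "finite A" "finite B" using fin VAB by auto
      define S where "S = A \<inter> B"
      have S: "S \<subseteq> A" "S \<subseteq> B" "u \<notin> S" "v \<notin> S" "finite S" using uv fA by (auto simp: S_def)
      \<comment> \<open>Placing \<open>v\<close> on both sides repairs the separation for
        \<open>E\<close>, so \<open>card S + 1\<close> is at least \<open>card X\<close>; as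
        \<open>card S\<close> is below \<open>card X\<close>, equality holds.\<close>
      have "separation V E (insert v A) B"
        unfolding separation_def
      proof (intro conjI ballI notI)
        fix a b assume ab: "a \<in> insert v A - B" "b \<in> B - insert v A" "E a b"
        then have "?F a b" using uv unfolding F by (auto simp: doubleton_eq_iff)
        then show False using separationD[OF AB(1), of a b] ab uv by auto
      qed (use VAB uv in auto)
      then have "card X \<le> card (insert v A \<inter> B)" using sep AB(2,3) by blast
      also have "insert v A \<inter> B = insert v S" using uv by (auto simp: S_def)
      finally have cS: "card (insert v S) = card X" "card (insert u S) = card X" using AB(4) S unfolding S_def[symmetric] by auto
      have smaller: "card (incident_pairs W ?F W) < card (incident_pairs V E V)" if "W \<subseteq> V" for W
      proof -
        have "card (incident_pairs W ?F W) \<le> card (incident_pairs V ?F V)"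
          by (rule card_mono[OF finite_incident_pairs[OF fin]]) (use that in \<open>auto simp: incident_pairs_def\<close>)
        then show ?thesis using cF by simp
      qed
      have "\<exists>T. \<forall>x\<in>X. x \<in> T x \<and> T x \<subseteq> A \<and> connected_set ?F (T x) \<and> T x \<inter> insert u S \<noteq> {} \<and> (\<forall>y\<in>X. y \<noteq> x \<longrightarrow> T x \<inter> T y = {})"
      proof (rule less.hyps[OF _ gF fA(1) AB(2)])
        fix C D assume CD: "separation A ?F C D" "X \<subseteq> C" "insert u S \<subseteq> D"
        have "separation V E C (D \<union> B)"
          unfolding separation_def
        proof (intro conjI ballI notI)
          fix a b assume a: "a \<in> C - (D \<union> B)" and b: "b \<in> (D \<union> B) - C" and e: "E a b"
          have aA: "a \<in> A - B" "a \<noteq> u" "a \<noteq> v" using a CD uv separation_Un[OF CD(1)] by auto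
          then have Fab: "?F a b" using e unfolding F by (auto simp: doubleton_eq_iff)
          show False
          proof (cases "b \<in> D")
            case True
            then show False using separationD[OF CD(1), of a b] a b Fab by auto
          next
            case False
            then have "b \<in> B - A" using b separation_Un[OF CD(1)] by auto
            then show False using separationD[OF AB(1), of a b] aA Fab by auto
          qed
        qed (use VAB separation_Un[OF CD(1)] in auto)
        then have "card X \<le> card (C \<inter> (D \<union> B))" using sep CD(2) AB(3) by blast
        also have "C \<inter> (D \<union> B) = C \<inter> D" using CD(3) separation_Un[OF CD(1)] by (auto simp: S_def)
        finally show "card X \<le> card (C \<inter> D)" .
      qed (use smaller VAB S uv in auto)
      then obtain T where T: "\<And>x. x \<in> X \<Longrightarrow> x \<in> T x \<and> T x \<subseteq> A \<and> connected_set ?F (T x) \<and> T x \<inter> insert u S \<noteq> {}"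
        and Td: "\<And>x y. x \<in> X \<Longrightarrow> y \<in> X \<Longrightarrow> y \<noteq> x \<Longrightarrow> T x \<inter> T y = {}" by blast
      have "\<exists>T. \<forall>x\<in>insert v S. x \<in> T x \<and> T x \<subseteq> B \<and> connected_set ?F (T x) \<and> T x \<inter> L \<noteq> {} \<and> (\<forall>y\<in>insert v S. y \<noteq> x \<longrightarrow> T x \<inter> T y = {})"
      proof (rule less.hyps[OF _ gF fA(2) _ AB(3)])
        fix C D assume CD: "separation B ?F C D" "insert v S \<subseteq> C" "L \<subseteq> D"
        have "separation V E (A \<union> C) D"
          unfolding separation_def
        proof (intro conjI ballI notI)
          fix a b assume a: "a \<in> A \<union> C - D" and b: "b \<in> D - (A \<union> C)" and e: "E a b"
          have bB: "b \<in> B - A" "b \<noteq> u" "b \<noteq> v" using b CD uv separation_Un[OF CD(1)] by auto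
          then have Fab: "?F a b" using e unfolding F by (auto simp: doubleton_eq_iff)
          show False
          proof (cases "a \<in> C")
            case True
            then show False using separationD[OF CD(1), of a b] a b Fab by auto
          next
            case False
            then have "a \<in> A - B" using a separation_Un[OF CD(1)] by auto
            then show False using separationD[OF AB(1), of a b] bB Fab by auto
          qed
        qed (use VAB separation_Un[OF CD(1)] in auto)
        then have "card X \<le> card ((A \<union> C) \<inter> D)" using sep CD(3) AB(2) by blast
        also have "(A \<union> C) \<inter> D = C \<inter> D" using CD(2) separation_Un[OF CD(1)] by (auto simp: S_def)
        finally show "card (insert v S) \<le> card (C \<inter> D)" using cS by simp
      qed (use smaller VAB S uv in auto)
      then obtain T' where T': "\<And>x. x \<in> insert v S \<Longrightarrow> x \<in> T' x \<and> T' x \<subseteq> B \<and> connected_set ?F (T' x) \<and> T' x \<inter> L \<noteq> {}"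
        and Td': "\<And>x y. x \<in> insert v S \<Longrightarrow> y \<in> insert v S \<Longrightarrow> y \<noteq> x \<Longrightarrow> T' x \<inter> T' y = {}" by blast
      obtain k where k: "\<And>x. x \<in> X \<Longrightarrow> k x \<in> T x \<inter> insert u S"
        using bchoice[of X "\<lambda>x w. w \<in> T x \<inter> insert u S"] T by blast
      have inj: "inj_on k X"
      proof (rule inj_onI, rule ccontr)
        fix x y assume xy: "x \<in> X" "y \<in> X" "k x = k y" "x \<noteq> y"
        then show False using k[of x] k[of y] Td[of x y] by auto
      qed
      have img: "k ` X = insert u S" using k cS(2) card_image[OF inj] S(5) by (intro card_seteq) auto
      define h where "h x = (if k x = u then v else k x)" for x
      have hS: "h x \<in> insert v S" if "x \<in> X" for x using k[OF that] by (auto simp: h_def)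
      have hne: "h x \<noteq> h y" if "x \<in> X" "y \<in> X" "y \<noteq> x" for x y
      proof -
        have "k x \<noteq> k y" using inj that by (auto dest: inj_onD)
        then show ?thesis using k[OF that(1)] k[OF that(2)] S(4) by (auto simp: h_def)
      qed
      \<comment> \<open>\<open>T x\<close> lies in \<open>A\<close> and \<open>T' (h y)\<close> in
        \<open>B\<close>, so they can meet only in \<open>S\<close>. Each vertex of \<open>S\<close>
        is \<open>k x'\<close> for a single \<open>x'\<close> and starts the piece of that
        \<open>x'\<close> on the far side, so a meeting point would belong to two different
        indices.\<close>
      have cross: "T x \<inter> T' (h y) = {}" if xy: "x \<in> X" "y \<in> X" "y \<noteq> x" for x y
      proof (rule ccontr)
        assume "T x \<inter> T' (h y) \<noteq> {}"
        then obtain w where w: "w \<in> T x" "w \<in> T' (h y)" by blast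
        have wS: "w \<in> S" using w T[OF xy(1)] T'[OF hS[OF xy(2)]] by (auto simp: S_def)
        then obtain x' where x': "x' \<in> X" "w = k x'" using img by blast
        have "w \<in> T x'" using k[OF x'(1)] x'(2) by auto
        then have "x' = x" using Td[OF xy(1) x'(1)] w by auto
        then have wh: "w = h x" using x'(2) wS S(3) by (auto simp: h_def)
        have "w \<in> T' (h x)" using T'[OF hS[OF xy(1)]] wh by simp
        then show False using Td'[OF hS[OF xy(1)] hS[OF xy(2)]] hne[OF xy] w(2) by auto
      qed
      show ?thesis
      proof (intro exI[of _ "\<lambda>x. T x \<union> T' (h x)"] ballI conjI impI)
        fix x assume x: "x \<in> X"
        note Tx = T[OF x] and T'x = T'[OF hS[OF x]]
        show "x \<in> T x \<union> T' (h x)" using Tx by simp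
        show "T x \<union> T' (h x) \<subseteq> V" using Tx T'x VAB by blast
        show "(T x \<union> T' (h x)) \<inter> L \<noteq> {}" using T'x by blast
        show "connected_set E (T x \<union> T' (h x))"
          by (rule connected_set_Un_edge[OF g, of _ _ "k x" "h x"]) (use Tx T'x FE k[OF x] uv in \<open>auto simp: h_def\<close>)
        fix y assume y: "y \<in> X" "y \<noteq> x"
        show "(T x \<union> T' (h x)) \<inter> (T y \<union> T' (h y)) = {}"
          using Td[OF x y] Td'[OF hS[OF x] hS[OF y(1)]] hne[OF x y] cross[OF x y] cross[OF y(1) x] y(2) by auto
      qed
    qed
  qed
qed

section \<open>Linkages for a prescribed pairing of the terminals\<close>

definition linkage :: "'a set \<Rightarrow> ('a \<Rightarrow> 'a \<Rightarrow> bool) \<Rightarrow> 'a set \<Rightarrow> ('a \<Rightarrow> 'a) \<Rightarrow> ('a \<Rightarrow> 'a set) \<Rightarrow> bool" where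
  "linkage V E X m S \<longleftrightarrow> (\<forall>x\<in>X. x \<in> S x \<and> S x \<subseteq> V \<and> connected_set E (S x) \<and> S (m x) = S x \<and>
     (\<forall>y\<in>X. y \<noteq> x \<longrightarrow> y \<noteq> m x \<longrightarrow> S x \<inter> S y = {}))"

text \<open>A pairing of \<open>X\<close> is given by an involution \<open>m\<close>; fixed points of \<open>m\<close> are vertices which the paths
  of the other pairs have to avoid.\<close>
definition linked :: "'a set \<Rightarrow> ('a \<Rightarrow> 'a \<Rightarrow> bool) \<Rightarrow> 'a set \<Rightarrow> bool" where
  "linked V E X \<longleftrightarrow> (\<forall>m. (\<forall>x\<in>X. m x \<in> X \<and> m (m x) = x) \<longrightarrow> (\<exists>S. linkage V E X m S))"

lemma linkedD:
  assumes "linked V E X" "\<And>x. x \<in> X \<Longrightarrow> m x \<in> X" "\<And>x. x \<in> X \<Longrightarrow> m (m x) = x"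
  obtains S where "linkage V E X m S"
  using assms unfolding linked_def by blast

lemma linkageD:
  assumes "linkage V E X m S" "x \<in> X"
  shows "x \<in> S x" "S x \<subseteq> V" "connected_set E (S x)" "S (m x) = S x"
    "\<And>y. y \<in> X \<Longrightarrow> y \<noteq> x \<Longrightarrow> y \<noteq> m x \<Longrightarrow> S x \<inter> S y = {}"
  using assms unfolding linkage_def by blast+

lemma linkage_mono:
  assumes "linkage V E X m S" "V \<subseteq> V'" "\<And>u v. E u v \<Longrightarrow> E' u v"
  shows "linkage V' E' X m S"
proof -
  have "connected_set E' (S x)" if "x \<in> X" for x
    using linkageD(3)[OF assms(1) that] by (rule connected_set_cong) (rule assms(3))
  then show ?thesis using assms(1,2) unfolding linkage_def by blast
qed

lemma linked_mono:
  assumes "linked V E X" "V \<subseteq> V'" "\<And>u v. E u v \<Longrightarrow> E' u v"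
  shows "linked V' E' X"
  unfolding linked_def
proof (intro allI impI)
  fix m assume m: "\<forall>x\<in>X. m x \<in> X \<and> m (m x) = x"
  obtain S where "linkage V E X m S" by (rule linkedD[OF assms(1), of m]) (use m in auto)
  then have "linkage V' E' X m S" by (rule linkage_mono) (use assms in auto)
  then show "\<exists>S. linkage V' E' X m S" by blast
qed

text \<open>The surplus terminals become fixed points of the pairing.\<close>

lemma linked_subset:
  assumes "linked V E X" "Y \<subseteq> X"
  shows "linked V E Y"
  unfolding linked_def
proof (intro allI impI)
  fix m assume m: "\<forall>x\<in>Y. m x \<in> Y \<and> m (m x) = x"
  define m' where "m' x = (if x \<in> Y then m x else x)" for x
  obtain S where S: "linkage V E X m' S"
    by (rule linkedD[OF assms(1), of m']) (use m assms(2) in \<open>auto simp: m'_def\<close>)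
  have "linkage V E Y m S" unfolding linkage_def
  proof (intro ballI conjI impI)
    fix x assume x: "x \<in> Y"
    then have xX: "x \<in> X" and mx: "m' x = m x" using assms(2) by (auto simp: m'_def)
    note L = linkageD[OF S xX]
    show "x \<in> S x" "S x \<subseteq> V" "connected_set E (S x)" "S (m x) = S x" using L mx by auto
    fix y assume "y \<in> Y" "y \<noteq> x" "y \<noteq> m x"
    then show "S x \<inter> S y = {}" using L(5)[of y] assms(2) mx by auto
  qed
  then show "\<exists>S. linkage V E Y m S" by blast
qed

text \<open>Terminals in \<open>X0\<close> travel by \<open>T\<close> to \<open>L\<close> and are
  joined inside \<open>L\<close>; the remaining pairs are already joined by \<open>T\<close> without
  touching \<open>L\<close>. Only sets of different pairs are assumed disjoint, so \<open>k\<close>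
  may send \<open>x\<close> and \<open>m x\<close> to the same vertex, but it identifies nothing
  else. Hence the pairing induced on the image of \<open>k\<close> is well defined.\<close>

lemma linkage_join:
  assumes g: "ugraph E" and m: "\<And>x. x \<in> X \<Longrightarrow> m x \<in> X" "\<And>x. x \<in> X \<Longrightarrow> m (m x) = x"
    and T: "\<And>x. x \<in> X \<Longrightarrow> x \<in> T x \<and> T x \<subseteq> W \<and> connected_set E (T x)"
    and Td: "\<And>x y. x \<in> X \<Longrightarrow> y \<in> X \<Longrightarrow> y \<noteq> x \<Longrightarrow> y \<noteq> m x \<Longrightarrow> T x \<inter> T y = {}"
    and X0: "X0 \<subseteq> X" "\<And>x. x \<in> X0 \<Longrightarrow> m x \<in> X0" "\<And>x. x \<in> X0 \<Longrightarrow> T x \<inter> L = {k x}"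
    and X1: "\<And>x. x \<in> X \<Longrightarrow> x \<notin> X0 \<Longrightarrow> T x \<inter> L = {} \<and> T (m x) = T x"
    and link: "linked L E (k ` X0)"
  shows "\<exists>S. linkage (W \<union> L) E X m S"
proof -
  have kT: "k x \<in> T x" "k x \<in> L" if "x \<in> X0" for x using X0(3)[OF that] by auto
  have keq: "y = x \<or> y = m x" if "x \<in> X0" "y \<in> X0" "k x = k y" for x y
  proof (rule ccontr)
    assume "\<not> ?thesis"
    then have "T x \<inter> T y = {}" using Td[of x y] that X0(1) by blast
    then show False using kT(1)[OF that(1)] kT(1)[OF that(2)] that(3) by auto
  qed
  \<comment> \<open>The inverse may return \<open>m x\<close> in place of \<open>x\<close>; the
    value does not change, because then \<open>k (m x) = k x\<close>.\<close>
  define m' where "m' z = k (m (inv_into X0 k z))" for z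
  have m'k: "m' (k x) = k (m x)" if x: "x \<in> X0" for x
  proof -
    define y where "y = inv_into X0 k (k x)"
    have y: "y \<in> X0" "k y = k x" using inv_into_into[of "k x" k X0] f_inv_into_f[of "k x" k X0] x by (auto simp: y_def)
    have "k (m y) = k (m x)"
    proof (cases "y = x")
      case False
      then have "y = m x" using keq[OF x y(1)] y(2) by simp
      then show ?thesis using y(2) m(2)[of x] x X0(1) by auto
    qed simp
    then show ?thesis by (simp add: m'_def y_def)
  qed
  obtain S where S: "linkage L E (k ` X0) m' S"
  proof (rule linkedD[OF link, of m'])
    fix z assume "z \<in> k ` X0"
    then obtain x where x: "x \<in> X0" "z = k x" by blast
    have "m (m x) = x" using m(2) x X0(1) by blast
    then show "m' z \<in> k ` X0" "m' (m' z) = z" using x m'k[OF x(1)] m'k[OF X0(2)[OF x(1)]] X0(2)[OF x(1)] by auto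
  qed
  note L = linkageD[OF S imageI]
  have SS: "S (k (m x)) = S (k x)" if "x \<in> X0" for x using L(4)[OF that] m'k[OF that] by simp
  have Sd: "S (k x) \<inter> S (k y) = {}" if xy: "x \<in> X0" "y \<in> X0" "y \<noteq> x" "y \<noteq> m x" for x y
  proof (rule L(5)[OF xy(1)])
    show "k y \<in> k ` X0" using xy by simp
    show "k y \<noteq> k x" using keq[OF xy(1,2)] xy by metis
    have "m (m x) = x" using m(2) xy X0(1) by blast
    then show "k y \<noteq> m' (k x)" using keq[OF X0(2)[OF xy(1)] xy(2)] xy m'k[OF xy(1)] by auto
  qed
  have TS: "T x \<inter> S (k y) = {}" if xy: "x \<in> X0" "y \<in> X0" "y \<noteq> x" "y \<noteq> m x" for x y
  proof -
    have "T x \<inter> S (k y) \<subseteq> {k x} \<inter> S (k y)" using L(2)[OF xy(2)] X0(3)[OF xy(1)] by blast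
    then show ?thesis using Sd[OF xy] L(1)[OF xy(1)] by blast
  qed
  define R where "R x = (if x \<in> X0 then T x \<union> T (m x) \<union> S (k x) else T x)" for x
  have R0: "R x = T x \<union> T (m x) \<union> S (k x)" if "x \<in> X0" for x using that by (simp add: R_def)
  have R1: "R x = T x" if "x \<notin> X0" for x using that by (simp add: R_def)
  have mX0: "m x \<notin> X0" if "x \<in> X" "x \<notin> X0" for x using X0(2)[of "m x"] m(2)[OF that(1)] that(2) by auto
  have mix: "R x \<inter> R y = {}" if x: "x \<in> X0" and y: "y \<in> X" "y \<notin> X0" for x y
  proof -
    have "y \<noteq> x" "y \<noteq> m x" "y \<noteq> m (m x)" using x y X0(2)[OF x] X0(2)[OF X0(2)[OF x]] by auto
    then have "T x \<inter> T y = {}" "T (m x) \<inter> T y = {}" using Td[of x y] Td[of "m x" y] x X0(1) X0(2)[OF x] y by auto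
    moreover have "S (k x) \<inter> T y = {}" using L(2)[OF x] X1[OF y] by blast
    ultimately show ?thesis using R0[OF x] R1[OF y(2)] by auto
  qed
  have "linkage (W \<union> L) E X m R" unfolding linkage_def
  proof (intro ballI)
    fix x assume x: "x \<in> X"
    have mm: "m (m x) = x" by (rule m(2)[OF x])
    show "x \<in> R x \<and> R x \<subseteq> W \<union> L \<and> connected_set E (R x) \<and> R (m x) = R x \<and>
        (\<forall>y\<in>X. y \<noteq> x \<longrightarrow> y \<noteq> m x \<longrightarrow> R x \<inter> R y = {})"
    proof (cases "x \<in> X0")
      case True
      note mx = X0(2)[OF True]
      have "connected_set E (T x \<union> S (k x))" "connected_set E (T (m x) \<union> S (k x))"
        using connected_set_Un[OF g _ L(3)[OF True]] T[OF x] T[OF m(1)[OF x]] kT(1)[OF True] kT(1)[OF mx] L(1)[OF True] L(1)[OF mx] SS[OF True] by blast+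
      then have "connected_set E ((T x \<union> S (k x)) \<union> (T (m x) \<union> S (k x)))"
        by (rule connected_set_Un[OF g]) (use L(1)[OF True] in blast)
      then have "connected_set E (R x)" unfolding R0[OF True] by (simp add: Un_ac)
      moreover have "x \<in> R x" "R x \<subseteq> W \<union> L" unfolding R0[OF True] using T[OF x] T[OF m(1)[OF x]] L(2)[OF True] by blast+
      moreover have "R (m x) = R x" unfolding R0[OF True] R0[OF mx] mm SS[OF True] by blast
      moreover have "R x \<inter> R y = {}" if y: "y \<in> X" "y \<noteq> x" "y \<noteq> m x" for y
      proof (cases "y \<in> X0")
        case yX: True
        have my: "m y \<in> X" "m (m y) = y" using m y by auto
        have ne: "m y \<noteq> x" "m y \<noteq> m x" "x \<noteq> m y" using my mm y by auto
        have "T x \<inter> T y = {}" "T x \<inter> T (m y) = {}" "T (m x) \<inter> T y = {}" "T (m x) \<inter> T (m y) = {}"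
          using Td[OF x y] Td[OF x my(1)] Td[OF m(1)[OF x] y(1)] Td[OF m(1)[OF x] my(1)] mm y ne by auto
        moreover have "T x \<inter> S (k y) = {}" "T (m x) \<inter> S (k y) = {}" "T y \<inter> S (k x) = {}" "T (m y) \<inter> S (k x) = {}"
          using TS[OF True yX y(2,3)] TS[OF mx yX] TS[OF yX True] TS[OF X0(2)[OF yX] True] y ne mm my by auto
        moreover have "S (k x) \<inter> S (k y) = {}" by (rule Sd[OF True yX y(2,3)])
        ultimately show ?thesis unfolding R0[OF True] R0[OF yX] by blast
      next
        case False
        then show ?thesis by (rule mix[OF True y(1)])
      qed
      ultimately show ?thesis by blast
    next
      case False
      have "R (m x) = R x" using R1[OF False] R1[OF mX0[OF x False]] X1[OF x False] by simp
      moreover have "R x \<inter> R y = {}" if y: "y \<in> X" "y \<noteq> x" "y \<noteq> m x" for y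
      proof (cases "y \<in> X0")
        case True
        then show ?thesis using mix[OF True x False] by blast
      next
        case yX: False
        then show ?thesis using Td[OF x y] R1[OF False] R1[OF yX] by simp
      qed
      ultimately show ?thesis using T[OF x] R1[OF False] by auto
    qed
  qed
  then show ?thesis by blast
qed

text \<open>Menger's theorem leads \<open>X\<close> into \<open>Z\<close>. Stopping at the first
  vertex of \<open>Z\<close> makes each set meet \<open>L\<close> in exactly one vertex, because
  \<open>W\<close> meets \<open>L\<close> only inside \<open>Z\<close>; the pairing is then
  completed inside \<open>L\<close>.\<close>

lemma linked_extend:
  assumes g: "ugraph E" and W: "finite W" "X \<subseteq> W" "Z \<subseteq> W" "Z \<subseteq> L" "W \<inter> L \<subseteq> Z"
    and sep: "\<And>A B. separation W E A B \<Longrightarrow> X \<subseteq> A \<Longrightarrow> Z \<subseteq> B \<Longrightarrow> card X \<le> card (A \<inter> B)"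
    and link: "\<And>Y. Y \<subseteq> Z \<Longrightarrow> card Y = card X \<Longrightarrow> linked L E Y"
  shows "linked (W \<union> L) E X"
  unfolding linked_def
proof (intro allI impI)
  fix m assume m: "\<forall>x\<in>X. m x \<in> X \<and> m (m x) = x"
  have fX: "finite X" using W finite_subset by blast
  obtain T0 where T0: "\<And>x. x \<in> X \<Longrightarrow> x \<in> T0 x \<and> T0 x \<subseteq> W \<and> connected_set E (T0 x) \<and> T0 x \<inter> Z \<noteq> {}"
    and T0d: "\<And>x y. x \<in> X \<Longrightarrow> y \<in> X \<Longrightarrow> y \<noteq> x \<Longrightarrow> T0 x \<inter> T0 y = {}"
    using Menger[OF g W(1-3) sep] by blast
  have "\<exists>T z. T \<subseteq> T0 x \<and> connected_set E T \<and> x \<in> T \<and> T \<inter> Z = {z}" if x: "x \<in> X" for x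
  proof -
    obtain y where y: "y \<in> T0 x" "y \<in> Z" using T0[OF x] by blast
    obtain T' z where "T' \<subseteq> T0 x" "connected_set E T'" "x \<in> T'" "T' \<inter> Z = {z}"
      by (rule connected_set_first_hit[OF g, of "T0 x" x y Z]) (use T0[OF x] y in auto)
    then show ?thesis by blast
  qed
  then have "\<exists>T. \<forall>x\<in>X. \<exists>z. T x \<subseteq> T0 x \<and> connected_set E (T x) \<and> x \<in> T x \<and> T x \<inter> Z = {z}" by (rule bchoice[OF ballI])
  then obtain T where "\<forall>x\<in>X. \<exists>z. T x \<subseteq> T0 x \<and> connected_set E (T x) \<and> x \<in> T x \<and> T x \<inter> Z = {z}" ..
  then have "\<exists>k. \<forall>x\<in>X. T x \<subseteq> T0 x \<and> connected_set E (T x) \<and> x \<in> T x \<and> T x \<inter> Z = {k x}" by (rule bchoice)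
  then obtain k where "\<forall>x\<in>X. T x \<subseteq> T0 x \<and> connected_set E (T x) \<and> x \<in> T x \<and> T x \<inter> Z = {k x}" ..
  note T = bspec[OF this]
  have Td: "T x \<inter> T y = {}" if "x \<in> X" "y \<in> X" "y \<noteq> x" for x y
    using T[OF that(1)] T[OF that(2)] T0d[OF that] by blast
  have TL: "T x \<inter> L = {k x}" if "x \<in> X" for x using T[OF that] T0[OF that] W(4,5) by blast
  have kT: "k x \<in> T x" if "x \<in> X" for x using T[OF that] by blast
  have kne: "k x \<noteq> k y" if "x \<in> X" "y \<in> X" "y \<noteq> x" for x y
  proof
    assume "k x = k y"
    then show False using kT[OF that(1)] kT[OF that(2)] Td[OF that] by auto
  qed
  have inj: "inj_on k X" by (rule inj_onI, rule ccontr) (use kne in blast)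
  have "linked L E (k ` X)" by (rule link) (use T card_image[OF inj] in auto)
  moreover have "T x \<subseteq> W" if "x \<in> X" for x using T[OF that] T0[OF that] by blast
  ultimately show "\<exists>S. linkage (W \<union> L) E X m S"
    using m T Td TL by (intro linkage_join[OF g, of X m T W X L k]) auto
qed

section \<open>Linked hubs in dense graphs\<close>

definition walk :: "'a set \<Rightarrow> ('a \<Rightarrow> 'a \<Rightarrow> bool) \<Rightarrow> 'a \<Rightarrow> 'a \<Rightarrow> 'a list \<Rightarrow> bool" where
  "walk W E a b p \<longleftrightarrow> p \<noteq> [] \<and> set p \<subseteq> W \<and> successively E p \<and> hd p = a \<and> last p = b"

lemma walk_rev: "ugraph E \<Longrightarrow> walk W E a b p \<Longrightarrow> walk W E b a (rev p)"
  unfolding walk_def by (auto simp: successively_rev hd_rev last_rev elim: successively_mono dest: ugraph_sym)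

text \<open>Walks may repeat vertices, so the part between positions \<open>i\<close> and
  \<open>j\<close> can be replaced by any \<open>q\<close> that fits, without a disjointness
  condition.\<close>

lemma walk_splice:
  assumes p: "walk W E a b p" and ij: "i < j" "j < length p"
    and q: "successively E (p ! i # q @ [p ! j])" "set q \<subseteq> W"
  shows "walk W E a b (take (Suc i) p @ q @ drop j p)" "set (take (Suc i) p @ q @ drop j p) \<subseteq> set p \<union> set q"
    "length (take (Suc i) p @ q @ drop j p) = length p + Suc i + length q - j"
proof -
  have t: "take (Suc i) p = take i p @ [p ! i]" using ij by (simp add: take_Suc_conv_app_nth)
  have d: "drop j p = p ! j # drop (Suc j) p" using ij by (simp add: Cons_nth_drop_Suc)
  have sp: "successively E p" using p by (simp add: walk_def)
  have "successively E (take (Suc i) p @ drop (Suc i) p)" using sp by simp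
  then have s1: "successively E (take i p @ [p ! i])" unfolding successively_append_iff t by simp
  have "successively E (take j p @ drop j p)" using sp by simp
  then have s2: "successively E (p ! j # drop (Suc j) p)" unfolding successively_append_iff d by simp
  have "successively E (take i p @ [p ! i] @ q @ p ! j # drop (Suc j) p)"
    using s1 s2 q(1) by (auto simp: successively_append_iff successively_Cons hd_append split: if_splits)
  then have suc: "successively E (take (Suc i) p @ q @ drop j p)" unfolding t d by simp
  have pn: "p \<noteq> []" using p by (simp add: walk_def)
  have h: "hd (take (Suc i) p @ q @ drop j p) = hd p" using pn by (cases p) auto
  have l: "last (take (Suc i) p @ q @ drop j p) = last p" using ij by (simp add: last_append)
  show sub: "set (take (Suc i) p @ q @ drop j p) \<subseteq> set p \<union> set q"
    using set_take_subset[of "Suc i" p] set_drop_subset[of j p] by auto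
  show "walk W E a b (take (Suc i) p @ q @ drop j p)"
    unfolding walk_def using suc h l p q(2) sub pn by (auto simp: walk_def)
  show "length (take (Suc i) p @ q @ drop j p) = length p + Suc i + length q - j" using ij by simp
qed

text \<open>A common vertex of the two neighbourhoods gives a shortcut with at most one vertex
  between positions at least three apart. If both positions carry the same vertex, the loop between
  them is cut out instead.\<close>

lemma shortest_walk_nbhds_disjoint:
  assumes g: "ugraph E" and p: "walk W E a b p" and min: "\<And>r. walk W E a b r \<Longrightarrow> length p \<le> length r"
    and ij: "i + 3 \<le> j" "j < length p"
  shows "closed_nbhd W E (p ! i) \<inter> closed_nbhd W E (p ! j) = {}"
proof (rule ccontr)
  assume "\<not> ?thesis"
  then obtain z where z: "z \<in> closed_nbhd W E (p ! i)" "z \<in> closed_nbhd W E (p ! j)" by blast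
  have ij': "i < j" using ij by simp
  have zi: "z = p ! i \<or> E (p ! i) z \<and> z \<in> W" and zj: "z = p ! j \<or> E z (p ! j) \<and> z \<in> W"
    using z ugraph_sym[OF g] by (auto simp: closed_nbhd_def neighbors_def)
  have False if "successively E (p ! i # q @ [p ! j])" "set q \<subseteq> W" "length q \<le> 1" for q
  proof -
    note w = walk_splice[OF p ij' ij(2) that(1,2)]
    show False using min[OF w(1)] w(3) that(3) ij by linarith
  qed
  from this[of "[]"] this[of "[z]"] have n: "\<not> E (p ! i) (p ! j)" "\<not> (E (p ! i) z \<and> E z (p ! j) \<and> z \<in> W)" by auto
  then have eq: "p ! i = p ! j" using zi zj by auto
  show False
  proof (cases "Suc j < length p")
    case True
    have "E (p ! j) (p ! Suc j)" using p True by (simp add: walk_def successively_conv_nth)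
    then have s: "successively E (p ! i # [] @ [p ! Suc j])" using eq by simp
    show False using min[OF walk_splice(1)[OF p _ True s]] walk_splice(3)[OF p _ True s] ij by simp
  next
    case False
    then have lj: "j = length p - 1" using ij by simp
    have pn: "p \<noteq> []" using p by (simp add: walk_def)
    have t: "take (Suc i) p = take i p @ [p ! i]" using ij by (simp add: take_Suc_conv_app_nth)
    have "successively E (take (Suc i) p @ drop (Suc i) p)" using p by (simp add: walk_def)
    then have suc: "successively E (take (Suc i) p)" unfolding successively_append_iff by blast
    have la: "last (take (Suc i) p) = last p" unfolding t using eq lj pn by (simp add: last_conv_nth)
    have "walk W E a b (take (Suc i) p)" unfolding walk_def
      using suc la p pn set_take_subset[of "Suc i" p] by (auto simp: walk_def)
    then show False using min ij by fastforce
  qed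
qed

text \<open>Four distinct vertices occupy four positions, and the first and the last of these are at
  least three apart.\<close>

lemma walk_neighbors_span:
  assumes "4 \<le> card (set p \<inter> {w. P w})"
  obtains i j where "i + 3 \<le> j" "j < length p" "P (p ! i)" "P (p ! j)"
proof -
  define I where "I = {i. i < length p \<and> P (p ! i)}"
  have fI: "finite I" by (simp add: I_def)
  have "set p \<inter> {w. P w} = (!) p ` I" by (auto simp: I_def in_set_conv_nth)
  then have c: "4 \<le> card I" using assms card_image_le[OF fI, of "(!) p"] by simp
  then have ne: "I \<noteq> {}" by auto
  have "I \<subseteq> {Min I..Max I}" using fI by auto
  then have "card I \<le> card {Min I..Max I}" by (intro card_mono) auto
  then have "Min I + 3 \<le> Max I" using c by simp
  moreover have "Min I \<in> I" "Max I \<in> I" using fI ne by auto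
  ultimately show thesis using that[of "Min I" "Max I"] by (auto simp: I_def)
qed

text \<open>The sets of \<open>z\<close> and \<open>m z\<close> coincide, so an orbit of size two
  contributes at most \<open>c\<close> and a fixed point at most \<open>c / 2\<close>: half of
  \<open>c\<close> per element in both cases. The constants of the hub rely on this halving.\<close>

lemma card_UN_involution:
  assumes "finite Y" "\<And>z. z \<in> Y \<Longrightarrow> m z \<in> Y \<and> m (m z) = z \<and> A (m z) = A z"
    and "\<And>z. z \<in> Y \<Longrightarrow> card (A z) \<le> c \<and> (m z = z \<longrightarrow> 2 * card (A z) \<le> c)"
  shows "2 * card (\<Union>z\<in>Y. A z) \<le> c * card Y"
  using assms
proof (induction "card Y" arbitrary: Y rule: less_induct)
  case less
  show ?case
  proof (cases "Y = {}")
    case False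
    then obtain z where z: "z \<in> Y" by blast
    define Y' where "Y' = Y - {z, m z}"
    have mz: "m z \<in> Y" "m (m z) = z" "A (m z) = A z" using less.prems(2)[OF z] by auto
    have c1: "card Y' < card Y" unfolding Y'_def using z less.prems(1) by (intro psubset_card_mono) auto
    have "2 * card (\<Union>z\<in>Y'. A z) \<le> c * card Y'"
    proof (rule less.hyps[OF c1])
      fix w assume w: "w \<in> Y'"
      then have "w \<in> Y" by (simp add: Y'_def)
      then show "card (A w) \<le> c \<and> (m w = w \<longrightarrow> 2 * card (A w) \<le> c)" by (rule less.prems(3))
      have "m w \<noteq> z" "m w \<noteq> m z" using less.prems(2)[OF \<open>w \<in> Y\<close>] mz w by (auto simp: Y'_def)
      then show "m w \<in> Y' \<and> m (m w) = w \<and> A (m w) = A w" using less.prems(2)[OF \<open>w \<in> Y\<close>] by (simp add: Y'_def)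
    qed (use less.prems(1) in \<open>simp add: Y'_def\<close>)
    moreover have "(\<Union>z\<in>Y. A z) = (\<Union>z\<in>Y'. A z) \<union> A z"
    proof
      show "(\<Union>z\<in>Y. A z) \<subseteq> (\<Union>z\<in>Y'. A z) \<union> A z" using mz(3) by (auto simp: Y'_def)
    qed (use z in \<open>auto simp: Y'_def\<close>)
    then have "card (\<Union>z\<in>Y. A z) \<le> card (\<Union>z\<in>Y'. A z) + card (A z)" by (simp add: card_Un_le)
    moreover have "2 * card (A z) + c * card Y' \<le> c * card Y"
    proof -
      have "card {z, m z} + card Y' = card Y" unfolding Y'_def
        using z mz(1) less.prems(1) card_mono[of Y "{z, m z}"] by (subst card_Diff_subset) auto
      then have "c * card Y = c * card {z, m z} + c * card Y'" by (metis distrib_left)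
      moreover have "2 * card (A z) \<le> c * card {z, m z}"
        using less.prems(3)[OF z] by (cases "m z = z") auto
      ultimately show ?thesis by linarith
    qed
    ultimately show ?thesis by linarith
  qed simp
qed

text \<open>Take a maximal part of the pairing that is linked by sets with at most one vertex
  outside \<open>Y\<close>. A missing pair has to avoid at most \<open>q - 2\<close> other terminals
  and at most \<open>(q - 2) / 2\<close> connectors in use. Doubled, these obstacles number at most
  \<open>3 * (q - 2)\<close>, fewer than the \<open>3 * q - 4\<close> guaranteed for twice the
  common neighbours.\<close>

lemma linked_if_many_common_neighbors:
  assumes g: "ugraph E" and L: "finite L" "Y \<subseteq> L" "card Y \<le> q"
    and common: "\<And>x y. x \<in> L \<Longrightarrow> y \<in> L \<Longrightarrow> 3 * q \<le> 2 * card (neighbors L E x \<inter> neighbors L E y) + 4"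
  shows "linked L E Y"
  unfolding linked_def
proof (intro allI impI)
  fix m assume "\<forall>x\<in>Y. m x \<in> Y \<and> m (m x) = x"
  then have m: "\<And>x. x \<in> Y \<Longrightarrow> m x \<in> Y" "\<And>x. x \<in> Y \<Longrightarrow> m (m x) = x" by auto
  have fY: "finite Y" using L finite_subset by blast
  define ok where "ok Y' S \<longleftrightarrow> Y' \<subseteq> Y \<and> (\<forall>x\<in>Y'. m x \<in> Y') \<and> linkage L E Y' m S \<and>
    (\<forall>x\<in>Y'. S x \<inter> Y = {x, m x} \<and> card (S x - Y) \<le> 1 \<and> (m x = x \<longrightarrow> S x - Y = {}))" for Y' S
  have "ok {} (\<lambda>_. {})" by (simp add: ok_def linkage_def)
  then have ex: "\<exists>S. ok {} S" by blast
  have bd: "card Y' < Suc (card Y)" if "\<exists>S. ok Y' S" for Y' using that fY by (auto simp: ok_def less_Suc_eq_le intro: card_mono)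
  obtain Y' where Y': "\<exists>S. ok Y' S" and mx: "\<And>Z. \<exists>S. ok Z S \<Longrightarrow> card Z \<le> card Y'"
    using ex_has_greatest_nat[of "\<lambda>Y'. \<exists>S. ok Y' S" "{}" card "Suc (card Y)"] ex bd by blast
  then obtain S where S: "ok Y' S" by blast
  have fY': "finite Y'" using S fY finite_subset by (auto simp: ok_def)
  have lk: "linkage L E Y' m S" and sub: "Y' \<subseteq> Y" and mY': "\<And>x. x \<in> Y' \<Longrightarrow> m x \<in> Y'"
    and SY: "\<And>x. x \<in> Y' \<Longrightarrow> S x \<inter> Y = {x, m x} \<and> card (S x - Y) \<le> 1 \<and> (m x = x \<longrightarrow> S x - Y = {})" using S by (auto simp: ok_def)
  have "Y' = Y"
  proof (rule ccontr)
    assume "Y' \<noteq> Y"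
    then obtain x where x: "x \<in> Y" "x \<notin> Y'" using sub by blast
    have mxY': "m x \<notin> Y'" using mY'[of "m x"] m(2)[OF x(1)] x(2) by auto
    define U where "U = (\<Union>z\<in>Y'. S z - Y)"
    have "2 * card U \<le> 1 * card Y'" unfolding U_def
    proof (rule card_UN_involution[OF fY'])
      fix z assume z: "z \<in> Y'"
      show "m z \<in> Y' \<and> m (m z) = z \<and> S (m z) - Y = S z - Y" using mY'[OF z] m(2) sub z linkageD(4)[OF lk z] by auto
      have "2 * card (S z - Y) \<le> 1" if "m z = z"
      proof -
        have "S z - Y = {}" using SY[OF z] that by blast
        then show ?thesis by (simp only: card.empty)
      qed
      then show "card (S z - Y) \<le> 1 \<and> (m z = z \<longrightarrow> 2 * card (S z - Y) \<le> 1)" using SY[OF z] by blast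
    qed
    have UL: "U \<subseteq> L" unfolding U_def using linkageD(2)[OF lk] by blast
    have fU: "finite U" using UL L(1) finite_subset by blast
    obtain T where T: "connected_set E T" "T \<subseteq> L" "T \<inter> Y = {x, m x}" "card (T - Y) \<le> 1" "m x = x \<longrightarrow> T - Y = {}" "T \<inter> U = {}"
    proof (cases "m x = x")
      case True
      then show thesis using that[of "{x}"] x L(2) by (auto simp: U_def)
    next
      case False
      let ?N = "neighbors L E x \<inter> neighbors L E (m x)"
      have "2 * card (U \<union> (Y - {x, m x})) < 2 * card ?N"
      proof -
        have c2: "card {x, m x} = 2" using False by auto
        have "card (Y - {x, m x}) = card Y - card {x, m x}" using x m fY by (intro card_Diff_subset) auto
        then have cY: "card (Y - {x, m x}) = card Y - 2" using c2 by simp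
        have "card {x, m x} \<le> card Y" using x m fY by (intro card_mono) auto
        then have Y2: "2 \<le> card Y" using c2 by simp
        have "Y' \<subseteq> Y - {x, m x}" using sub x mxY' by auto
        then have "card Y' \<le> card Y - 2" using cY fY card_mono[of "Y - {x, m x}" Y'] by simp
        moreover have "card (U \<union> (Y - {x, m x})) \<le> card U + (card Y - 2)" using card_Un_le[of U "Y - {x, m x}"] cY by simp
        moreover have "3 * q \<le> 2 * card ?N + 4" using common x L(2) m by blast
        ultimately show ?thesis using \<open>2 * card U \<le> 1 * card Y'\<close> L(3) Y2 by linarith
      qed
      then have "\<not> ?N \<subseteq> U \<union> (Y - {x, m x})"
        using card_mono[of "U \<union> (Y - {x, m x})" ?N] fU fY by auto
      then obtain z where z: "z \<in> ?N" "z \<notin> U" "z \<notin> Y - {x, m x}" by blast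
      have zz: "E x z" "E (m x) z" "z \<in> L" using z by (auto simp: neighbors_def)
      have "z \<noteq> x" "z \<noteq> m x" using zz ugraph_irrefl[OF g] by auto
      then have zY: "z \<notin> Y" using z by blast
      have "connected_set E (insert x {z})" by (rule connected_set_insert[OF g, of _ z]) (use zz in auto)
      then have "connected_set E (insert (m x) (insert x {z}))" by (rule connected_set_insert[OF g, of _ z]) (use zz in auto)
      then show thesis
        by (rule that) (use zz zY z(2) x m L(2) False in \<open>auto simp: U_def card_le_Suc0_iff_eq\<close>)
    qed
    define S' where "S' = S(x := T, m x := T)"
    define Z where "Z = Y' \<union> {x, m x}"
    have disj: "T \<inter> S z = {}" if "z \<in> Y'" for z
    proof -
      have "S z \<subseteq> U \<union> {z, m z}" using SY[OF that] that by (auto simp: U_def)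
      moreover have "z \<notin> T" "m z \<notin> T" using T(3) that mY'[OF that] sub x mxY' by auto
      ultimately show ?thesis using T(6) by blast
    qed
    have mm: "m (m x) = x" using m x by blast
    have S'z: "S' z = S z" if "z \<in> Y'" for z using that x mxY' by (auto simp: S'_def)
    have S'x: "S' x = T" "S' (m x) = T" by (auto simp: S'_def)
    have mne: "m z \<noteq> x" "m z \<noteq> m x" if "z \<in> Y'" for z using mY'[OF that] x mxY' by auto
    have "linkage L E Z m S'" unfolding linkage_def
    proof (intro ballI)
      fix z assume z: "z \<in> Z"
      show "z \<in> S' z \<and> S' z \<subseteq> L \<and> connected_set E (S' z) \<and> S' (m z) = S' z \<and>
          (\<forall>y\<in>Z. y \<noteq> z \<longrightarrow> y \<noteq> m z \<longrightarrow> S' z \<inter> S' y = {})"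
      proof (cases "z \<in> Y'")
        case True
        note l = linkageD[OF lk True]
        have "S' z \<inter> S' y = {}" if "y \<in> Z" "y \<noteq> z" "y \<noteq> m z" for y
        proof (cases "y \<in> Y'")
          case y: True
          show ?thesis unfolding S'z[OF True] S'z[OF y] by (rule l(5)[OF y that(2,3)])
        next
          case False
          then show ?thesis using that(1) disj[OF True] S'z[OF True] S'x by (auto simp: Z_def)
        qed
        then show ?thesis using l(1-4) unfolding S'z[OF True] S'z[OF mY'[OF True]] by blast
      next
        case False
        then have zx: "z = x \<or> z = m x" using z by (simp add: Z_def)
        have "S' z = T" "S' (m z) = T" using zx by (elim disjE; hypsubst; simp only: S'x mm)+
        moreover have "z \<in> T" using zx T(3) by blast
        moreover have "T \<inter> S' y = {}" if "y \<in> Z" "y \<noteq> z" "y \<noteq> m z" for y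
        proof -
          have "y \<in> Y'" using that zx mm by (auto simp: Z_def)
          then show ?thesis using disj S'z by simp
        qed
        ultimately show ?thesis using T(1,2) by simp
      qed
    qed
    moreover have "S' z \<inter> Y = {z, m z} \<and> card (S' z - Y) \<le> 1 \<and> (m z = z \<longrightarrow> S' z - Y = {})" if "z \<in> Z" for z
    proof (cases "z \<in> Y'")
      case True
      then show ?thesis using SY S'z by simp
    next
      case False
      then have zx: "z = x \<or> z = m x" using that by (simp add: Z_def)
      have e: "S' z = T" "{z, m z} = {x, m x}" "m z = z \<Longrightarrow> m x = x"
        using zx by (elim disjE; hypsubst; simp add: S'x mm insert_commute)+
      show ?thesis unfolding e(1,2) using T(3-5) e(3) by blast
    qed
    moreover have "Z \<subseteq> Y" "\<forall>z\<in>Z. m z \<in> Z" using sub x m mY' mm by (auto simp: Z_def)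
    ultimately have "ok Z S'" unfolding ok_def by blast
    then have "card Z \<le> card Y'" using mx by blast
    moreover have "card Y' < card Z" using fY' x by (intro psubset_card_mono) (auto simp: Z_def)
    ultimately show False by simp
  qed
  then show "\<exists>S. linkage L E Y m S" using lk by blast
qed

text \<open>\<open>Y'\<close> is the part of the terminals \<open>Y\<close> that is already linked.\<close>
definition short_linkage :: "'a set \<Rightarrow> ('a \<Rightarrow> 'a \<Rightarrow> bool) \<Rightarrow> 'a set \<Rightarrow> ('a \<Rightarrow> 'a) \<Rightarrow> 'a set \<Rightarrow> ('a \<Rightarrow> 'a list) \<Rightarrow> bool" where
  "short_linkage V E Y m Y' p \<longleftrightarrow> Y' \<subseteq> Y \<and> (\<forall>z\<in>Y'. m z \<in> Y' \<and> walk V E z (m z) (p z) \<and> length (p z) \<le> 8 \<and>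
     set (p z) \<inter> Y = {z, m z} \<and> set (p (m z)) = set (p z) \<and> (m z = z \<longrightarrow> p z = [z]) \<and>
     (\<forall>y\<in>Y'. y \<noteq> z \<longrightarrow> y \<noteq> m z \<longrightarrow> set (p z) \<inter> set (p y) = {}))"

lemma short_linkageD:
  assumes "short_linkage V E Y m Y' p" "z \<in> Y'"
  shows "m z \<in> Y'" "walk V E z (m z) (p z)" "length (p z) \<le> 8" "set (p z) \<inter> Y = {z, m z}" "set (p (m z)) = set (p z)"
    "m z = z \<Longrightarrow> p z = [z]" "\<And>y. y \<in> Y' \<Longrightarrow> y \<noteq> z \<Longrightarrow> y \<noteq> m z \<Longrightarrow> set (p z) \<inter> set (p y) = {}"
  using assms unfolding short_linkage_def by blast+

text \<open>Serves both to add a new pair and to reroute one that is already linked; the partner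
  receives the reversed walk.\<close>

lemma short_linkage_update:
  assumes g: "ugraph E" and sl: "short_linkage V E Y m Y' p"
    and m: "\<And>z. z \<in> Y \<Longrightarrow> m z \<in> Y" "\<And>z. z \<in> Y \<Longrightarrow> m (m z) = z"
    and x: "x \<in> Y" and r: "walk V E x (m x) r" "length r \<le> 8" "set r \<inter> Y = {x, m x}" "m x = x \<Longrightarrow> r = [x]"
    and dis: "\<And>y. y \<in> Y' \<Longrightarrow> y \<noteq> x \<Longrightarrow> y \<noteq> m x \<Longrightarrow> set r \<inter> set (p y) = {}"
  shows "short_linkage V E Y m (Y' \<union> {x, m x}) (p(x := r, m x := rev r))"
proof -
  let ?p = "p(x := r, m x := rev r)" and ?Z = "Y' \<union> {x, m x}"
  have mm: "m (m x) = x" using m x by blast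
  have Y'Y: "Y' \<subseteq> Y" using sl by (simp add: short_linkage_def)
  have old: "?p z = p z" if "z \<noteq> x" "z \<noteq> m x" for z using that by simp
  have new: "set (?p z) = set r" "length (?p z) = length r" if "z = x \<or> z = m x" for z using that by auto
  have wx: "walk V E (m x) x (rev r)" by (rule walk_rev[OF g r(1)])
  show ?thesis unfolding short_linkage_def
  proof (intro conjI ballI)
    show "?Z \<subseteq> Y" using Y'Y x m by auto
    fix z assume z: "z \<in> ?Z"
    show "m z \<in> ?Z" using z short_linkageD(1)[OF sl] mm by auto
    have nx: "m z \<noteq> x" "m z \<noteq> m x" if "z \<noteq> x" "z \<noteq> m x" using that z m(2) Y'Y mm x by auto (metis in_mono)+
    show "walk V E z (m z) (?p z)"
    proof (cases "z = x \<or> z = m x")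
      case True
      then show ?thesis using r wx mm by auto
    next
      case False
      then show ?thesis using z short_linkageD(2)[OF sl, of z] by auto
    qed
    show "length (?p z) \<le> 8" using z r(2) short_linkageD(3)[OF sl, of z] by auto
    show "set (?p z) \<inter> Y = {z, m z}" using z r(3) short_linkageD(4)[OF sl, of z] mm by auto
    show "set (?p (m z)) = set (?p z)"
    proof (cases "z = x \<or> z = m x")
      case True
      then show ?thesis using mm new by auto
    next
      case False
      then show ?thesis using nx z short_linkageD(5)[OF sl, of z] by auto
    qed
    show "m z = z \<longrightarrow> ?p z = [z]" using z r(4) short_linkageD(6)[OF sl, of z] mm by auto
    fix y assume y0: "y \<in> ?Z"
    show "y \<noteq> z \<longrightarrow> y \<noteq> m z \<longrightarrow> set (?p z) \<inter> set (?p y) = {}"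
    proof (intro impI)
      assume y12: "y \<noteq> z" "y \<noteq> m z"
      note y = y0 y12
      consider "z = x \<or> z = m x" | "y = x \<or> y = m x" "z \<noteq> x" "z \<noteq> m x" | "z \<noteq> x" "z \<noteq> m x" "y \<noteq> x" "y \<noteq> m x" by blast
      then show "set (?p z) \<inter> set (?p y) = {}"
      proof cases
        case 1
        then have "y \<in> Y'" "y \<noteq> x" "y \<noteq> m x" using y mm by auto
        then show ?thesis using dis[of y] new(1)[OF 1] old[of y] by simp
      next
        case 2
        then have "z \<in> Y'" using z by auto
        then show ?thesis using dis[of z] new(1)[OF 2(1)] old[of z] 2 by (simp add: Int_commute)
      next
        case 3
        then have "z \<in> Y'" "y \<in> Y'" using z y by auto
        then show ?thesis using short_linkageD(7)[OF sl, of z y] y old[of z] old[of y] 3 by simp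
      qed
    qed
  qed
qed

section \<open>The hub in a dense graph of small order\<close>

definition component :: "('a \<Rightarrow> 'a \<Rightarrow> bool) \<Rightarrow> 'a set \<Rightarrow> 'a \<Rightarrow> 'a set" where
  "component E F a = {z. reach_in E F a z}"

lemma component_subset: "a \<in> F \<Longrightarrow> component E F a \<subseteq> F"
  using reach_in_closed by (fastforce simp: component_def)

lemma neighbors_component:
  assumes "a \<in> F" "v \<in> component E F a"
  shows "neighbors (component E F a) E v = neighbors F E v"
proof -
  have vF: "v \<in> F" using component_subset[OF assms(1)] assms(2) by blast
  have "w \<in> component E F a" if "w \<in> F" "E v w" for w
    using assms(2) vF that unfolding component_def by (simp add: rtranclp.rtrancl_into_rtrancl)
  then show ?thesis using component_subset[OF assms(1)] by (auto simp: neighbors_def)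
qed

theorem dense_graph_hub:
  fixes q :: nat
  assumes g: "ugraph E" and V: "finite V" "V \<noteq> {}" and cV: "card V \<le> 8 * q + 1"
    and deg: "\<And>v. v \<in> V \<Longrightarrow> 4 * q \<le> card (neighbors V E v)"
  shows "\<exists>L\<subseteq>V. q \<le> card L \<and> (\<forall>Y\<subseteq>L. card Y \<le> q \<longrightarrow> linked L E Y)"
proof (cases "\<forall>Y\<subseteq>V. card Y \<le> q \<longrightarrow> linked V E Y")
  case True
  obtain v where v: "v \<in> V" using V by blast
  have "card (neighbors V E v) \<le> card V" using V by (intro card_mono) (auto simp: neighbors_def)
  then have "q \<le> card V" using deg[OF v] by linarith
  then show ?thesis using True by blast
next
  case False
  then obtain Y where Y: "Y \<subseteq> V" "card Y \<le> q" "\<not> linked V E Y" by blast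
  then obtain m where m0: "\<forall>x\<in>Y. m x \<in> Y \<and> m (m x) = x" and nl: "\<And>S. \<not> linkage V E Y m S"
    unfolding linked_def by blast
  have m: "\<And>x. x \<in> Y \<Longrightarrow> m x \<in> Y" "\<And>x. x \<in> Y \<Longrightarrow> m (m x) = x" using m0 by auto
  have fY: "finite Y" using Y V finite_subset by blast
  have "short_linkage V E Y m {} (\<lambda>_. [])" by (simp add: short_linkage_def)
  then have ex: "\<exists>p. short_linkage V E Y m {} p" by blast
  have bd: "card Y' < Suc (card Y)" if "\<exists>p. short_linkage V E Y m Y' p" for Y'
    using that fY by (auto simp: short_linkage_def less_Suc_eq_le intro: card_mono)
  obtain Y' where Y': "\<exists>p. short_linkage V E Y m Y' p"
    and mx: "\<And>Z. \<exists>p. short_linkage V E Y m Z p \<Longrightarrow> card Z \<le> card Y'"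
    using ex_has_greatest_nat[of "\<lambda>Y'. \<exists>p. short_linkage V E Y m Y' p" "{}" card "Suc (card Y)"] ex bd by blast
  obtain p where p: "short_linkage V E Y m Y' p"
    and mn: "\<And>r. short_linkage V E Y m Y' r \<Longrightarrow> (\<Sum>z\<in>Y'. length (p z)) \<le> (\<Sum>z\<in>Y'. length (r z))"
    using ex_has_least_nat[of "\<lambda>p. short_linkage V E Y m Y' p" _ "\<lambda>p. \<Sum>z\<in>Y'. length (p z)"] Y' by blast
  note P = short_linkageD[OF p]
  have Y'Y: "Y' \<subseteq> Y" using p by (simp add: short_linkage_def)
  have fY': "finite Y'" using Y'Y fY finite_subset by blast
  have maxY: "x \<in> Y'" if "short_linkage V E Y m (Y' \<union> {x, m x}) r" for x r
  proof (rule ccontr)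
    assume "x \<notin> Y'"
    then have "card Y' < card (Y' \<union> {x, m x})" using fY' by (intro psubset_card_mono) auto
    then show False using mx[of "Y' \<union> {x, m x}"] that by fastforce
  qed
  have ne: "Y' \<noteq> Y"
  proof
    assume eq: "Y' = Y"
    have "linkage V E Y m (\<lambda>x. set (p x))" unfolding linkage_def
    proof (intro ballI conjI impI)
      fix x assume "x \<in> Y"
      then have x: "x \<in> Y'" using eq by simp
      have w: "p x \<noteq> []" "set (p x) \<subseteq> V" "successively E (p x)" "hd (p x) = x" using P(2)[OF x] by (auto simp: walk_def)
      show "x \<in> set (p x)" using hd_in_set[OF w(1)] w(4) by simp
      show "set (p x) \<subseteq> V" by (rule w(2))
      show "connected_set E (set (p x))" by (rule connected_set_successively[OF g w(3,1)])
      show "set (p (m x)) = set (p x)" by (rule P(5)[OF x])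
      fix y assume "y \<in> Y" "y \<noteq> x" "y \<noteq> m x"
      then show "set (p x) \<inter> set (p y) = {}" using P(7)[OF x] eq by simp
    qed
    then show False using nl by blast
  qed
  then obtain x where x: "x \<in> Y" "x \<notin> Y'" using Y'Y by blast
  have mx': "m x \<notin> Y'" using P(1)[of "m x"] m(2)[OF x(1)] x(2) by auto
  have xp: "x \<notin> set (p y)" "m x \<notin> set (p y)" if "y \<in> Y'" for y
    using P(4)[OF that] P(1)[OF that] that x mx' m(1)[OF x(1)] by auto
  have mxx: "m x \<noteq> x"
  proof
    assume eq: "m x = x"
    have "short_linkage V E Y m (Y' \<union> {x, m x}) (p(x := [x], m x := rev [x]))"
      by (rule short_linkage_update[OF g p m x(1)]) (use eq x Y xp in \<open>auto simp: walk_def\<close>)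
    then show False using maxY x(2) by blast
  qed
  define U where "U = (\<Union>z\<in>Y'. set (p z)) \<union> (Y - Y')"
  define F where "F = V - U"
  have YU: "Y \<subseteq> U"
  proof
    fix y assume "y \<in> Y"
    show "y \<in> U"
    proof (cases "y \<in> Y'")
      case True
      then show ?thesis using P(4)[OF True] \<open>y \<in> Y\<close> by (auto simp: U_def)
    qed (use \<open>y \<in> Y\<close> in \<open>simp add: U_def\<close>)
  qed
  have UV: "U \<subseteq> V" using P(2) Y by (auto simp: U_def walk_def)
  have fU: "finite U" "finite F" using UV V finite_subset by (auto simp: F_def)
  have cF: "card F + card U = card V"
    using V UV card_mono[of V U] unfolding F_def by (simp add: card_Diff_subset finite_subset)
  have cY: "card (Y - Y') + card Y' = card Y" using fY Y'Y card_mono[of Y Y'] by (simp add: card_Diff_subset finite_subset)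
  have U_size: "card U \<le> 4 * card Y' + card (Y - Y')"
  proof -
    have "2 * card (\<Union>z\<in>Y'. set (p z)) \<le> 8 * card Y'"
    proof (rule card_UN_involution[OF fY'])
      fix z assume z: "z \<in> Y'"
      show "m z \<in> Y' \<and> m (m z) = z \<and> set (p (m z)) = set (p z)" using P(1,5)[OF z] m(2) Y'Y z by auto
      have "card (set (p z)) \<le> 8" using P(3)[OF z] card_length[of "p z"] by linarith
      moreover have "2 * card (set (p z)) \<le> 8" if "m z = z" using P(6)[OF z that] by simp
      ultimately show "card (set (p z)) \<le> 8 \<and> (m z = z \<longrightarrow> 2 * card (set (p z)) \<le> 8)" by blast
    qed
    then show ?thesis unfolding U_def using card_Un_le[of "\<Union>z\<in>Y'. set (p z)" "Y - Y'"] by linarith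
  qed
  \<comment> \<open>A vertex with four neighbours on one walk would give a shorter walk.\<close>
  have three: "card (set (p z) \<inter> {w. E v w}) \<le> 3" if v: "v \<in> F" and z: "z \<in> Y'" for v z
  proof (rule ccontr)
    assume "\<not> ?thesis"
    then have c4: "4 \<le> card (set (p z) \<inter> {w. E v w})" by simp
    then obtain i j where ij: "i + 3 \<le> j" "j < length (p z)" "E v (p z ! i)" "E v (p z ! j)"
      by (rule walk_neighbors_span)
    have zz: "m z \<noteq> z"
    proof
      assume "m z = z"
      then have "p z = [z]" by (rule P(6)[OF z])
      then show False using ij by simp
    qed
    have i_j: "i < j" using ij by simp
    have s: "successively E (p z ! i # [v] @ [p z ! j])" using ij ugraph_sym[OF g] by simp
    have vV: "set [v] \<subseteq> V" using v by (simp add: F_def)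
    define r where "r = take (Suc i) (p z) @ [v] @ drop j (p z)"
    note r = walk_splice[OF P(2)[OF z] i_j ij(2) s vV, folded r_def]
    have lr: "length r < length (p z)" using r(3) ij by simp
    have zY: "z \<in> Y" using z Y'Y by blast
    have vU: "v \<notin> U" using v by (simp add: F_def)
    have rw: "r \<noteq> []" "hd r = z" "last r = m z" using r(1) by (auto simp: walk_def)
    have zr: "z \<in> set r" "m z \<in> set r" using hd_in_set[OF rw(1)] last_in_set[OF rw(1)] rw by auto
    have rY: "set r \<inter> Y = {z, m z}" using r(2) P(4)[OF z] vU YU zr zY m(1)[OF zY] by auto
    have "short_linkage V E Y m (Y' \<union> {z, m z}) (p(z := r, m z := rev r))"
    proof (rule short_linkage_update[OF g p m zY r(1) _ rY])
      show "length r \<le> 8" using lr P(3)[OF z] by simp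
      show "m z = z \<Longrightarrow> r = [z]" using zz by simp
      fix y assume y: "y \<in> Y'" "y \<noteq> z" "y \<noteq> m z"
      have "v \<notin> set (p y)" using vU y by (auto simp: U_def)
      then show "set r \<inter> set (p y) = {}" using r(2) P(7)[OF z y] by auto
    qed
    moreover have "Y' \<union> {z, m z} = Y'" using z P(1)[OF z] by auto
    ultimately have "short_linkage V E Y m Y' (p(z := r, m z := rev r))" by simp
    from mn[OF this] have le: "(\<Sum>w\<in>Y'. length (p w)) \<le> (\<Sum>w\<in>Y'. length ((p(z := r, m z := rev r)) w))" .
    define k where "k w = length ((p(z := r, m z := rev r)) w)" for w
    have split: "(\<Sum>w\<in>Y'. h w) = h z + (h (m z) + (\<Sum>w\<in>Y' - {z, m z}. h w))" for h :: "'a \<Rightarrow> nat"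
    proof -
      have "(\<Sum>w\<in>Y'. h w) = h z + (\<Sum>w\<in>Y' - {z}. h w)" using fY' z by (rule sum.remove)
      also have "(\<Sum>w\<in>Y' - {z}. h w) = h (m z) + (\<Sum>w\<in>Y' - {z} - {m z}. h w)"
        using fY' zz P(1)[OF z] by (intro sum.remove) auto
      also have "Y' - {z} - {m z} = Y' - {z, m z}" by auto
      finally show ?thesis .
    qed
    have same: "(\<Sum>w\<in>Y' - {z, m z}. k w) = (\<Sum>w\<in>Y' - {z, m z}. length (p w))" by (rule sum.cong) (auto simp: k_def)
    have kz: "k z = length r" "k (m z) = length r" using zz by (auto simp: k_def)
    have mmz: "m (m z) = z" using m(2) zY by blast
    show False
    proof (cases "length (p (m z)) < length r")
      case True
      \<comment> \<open>Then the reversed walk of \<open>m z\<close> is a shorter replacement.\<close>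
      let ?r = "p (m z)"
      have mzY: "m z \<in> Y" "m z \<in> Y'" using m(1)[OF zY] P(1)[OF z] by auto
      have "short_linkage V E Y m (Y' \<union> {m z, m (m z)}) (p(m z := ?r, m (m z) := rev ?r))"
        by (rule short_linkage_update[OF g p m mzY(1) P(2)[OF mzY(2)] P(3)[OF mzY(2)] P(4)[OF mzY(2)] P(6)[OF mzY(2)] P(7)[OF mzY(2)]])
      moreover have "Y' \<union> {m z, m (m z)} = Y'" using z mzY mmz by auto
      ultimately have "short_linkage V E Y m Y' (p(m z := ?r, z := rev ?r))" using mmz by simp
      from mn[OF this] have "(\<Sum>w\<in>Y'. length (p w)) \<le> (\<Sum>w\<in>Y'. length ((p(m z := ?r, z := rev ?r)) w))" .
      then show False unfolding split using True lr zz by (simp cong: sum.cong_simp)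
    next
      case False
      then show False using le unfolding k_def[symmetric] split[of k] split[of "\<lambda>w. length (p w)"] same kz using lr by linarith
    qed
  qed
  \<comment> \<open>At most 3 neighbours on the walk of a pair and at most one on a fixed point give
    3/2 per linked terminal; an unlinked terminal contributes at most one.\<close>
  have eta: "2 * card (U \<inter> {w. E v w}) \<le> 3 * q" if v: "v \<in> F" for v
  proof -
    have "2 * card (\<Union>z\<in>Y'. set (p z) \<inter> {w. E v w}) \<le> 3 * card Y'"
    proof (rule card_UN_involution[OF fY'])
      fix z assume z: "z \<in> Y'"
      show "m z \<in> Y' \<and> m (m z) = z \<and> set (p (m z)) \<inter> {w. E v w} = set (p z) \<inter> {w. E v w}" using P(1,5)[OF z] m(2) Y'Y z by auto
      have "2 * card (set (p z) \<inter> {w. E v w}) \<le> 3" if "m z = z"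
      proof -
        have "card (set (p z) \<inter> {w. E v w}) \<le> card {z}" using P(6)[OF z that] by (intro card_mono) auto
        then show ?thesis by simp
      qed
      then show "card (set (p z) \<inter> {w. E v w}) \<le> 3 \<and> (m z = z \<longrightarrow> 2 * card (set (p z) \<inter> {w. E v w}) \<le> 3)" using three[OF v z] by blast
    qed
    moreover have "card (U \<inter> {w. E v w}) \<le> card (\<Union>z\<in>Y'. set (p z) \<inter> {w. E v w}) + card (Y - Y')"
    proof -
      have "U \<inter> {w. E v w} \<subseteq> (\<Union>z\<in>Y'. set (p z) \<inter> {w. E v w}) \<union> (Y - Y')" by (auto simp: U_def)
      then have "card (U \<inter> {w. E v w}) \<le> card ((\<Union>z\<in>Y'. set (p z) \<inter> {w. E v w}) \<union> (Y - Y'))"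
        using fY fY' by (intro card_mono) auto
      then show ?thesis using card_Un_le order.trans by blast
    qed
    ultimately show ?thesis using cY Y(2) by linarith
  qed
  have degF: "4 * q \<le> card (neighbors F E v) + card (U \<inter> {w. E v w})" if v: "v \<in> V" for v
  proof -
    have "neighbors V E v \<subseteq> neighbors F E v \<union> (U \<inter> {w. E v w})" by (auto simp: neighbors_def F_def)
    then have "card (neighbors V E v) \<le> card (neighbors F E v \<union> (U \<inter> {w. E v w}))"
      using fU by (intro card_mono) (auto simp: neighbors_def)
    then show ?thesis using deg[OF v] card_Un_le[of "neighbors F E v" "U \<inter> {w. E v w}"] by linarith
  qed
  have etaU: "card (U \<inter> {w. E v w}) \<le> card U" for v using fU by (intro card_mono) auto
  \<comment> \<open>\<open>U\<close> has at most \<open>4 * q\<close> vertices and contains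
    \<open>y\<close> itself, so it cannot hold all the \<open>4 * q\<close> or more neighbours of
    \<open>y\<close>.\<close>
  have out: "\<exists>a\<in>F. E y a" if y: "y \<in> {x, m x}" for y
  proof -
    have yY: "y \<in> Y" "y \<in> V" using y x m Y by auto
    have "U \<inter> {w. E y w} \<subseteq> U - {y}" using ugraph_irrefl[OF g] by auto
    then have "card (U \<inter> {w. E y w}) \<le> card (U - {y})" using fU by (intro card_mono) auto
    also have "\<dots> = card U - 1" using yY YU by (intro card_Diff_singleton) auto
    finally have "card (U \<inter> {w. E y w}) \<le> card U - 1" .
    moreover have "card {x, m x} \<le> card (Y - Y')" using fY x mx' m by (intro card_mono) auto
    then have "2 \<le> card (Y - Y')" using mxx by simp
    ultimately have "0 < card (neighbors F E y)" using degF[OF yY(2)] U_size cY Y(2) by linarith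
    then have "neighbors F E y \<noteq> {}" by force
    then show ?thesis by (auto simp: neighbors_def)
  qed
  obtain a where a: "a \<in> F" "E x a" using out[of x] by blast
  obtain b where b: "b \<in> F" "E (m x) b" using out[of "m x"] by blast
  have disconnected: "\<not> reach_in E F a b"
  proof
    assume "reach_in E F a b"
    from reach_in_path[OF this a(1)] have "\<exists>r. walk F E a b r" by (auto simp: walk_def)
    then obtain r where r: "walk F E a b r" and rm: "\<And>s. walk F E a b s \<Longrightarrow> length r \<le> length s"
      using ex_has_least_nat[of "walk F E a b" _ length] by blast
    \<comment> \<open>Otherwise the closed neighbourhoods at positions 0, 3 and 6 are disjoint. Each
      of these vertices has at least \<open>4 * q\<close> neighbours, of which at most
      \<open>card U\<close> and at most 3q/2 lie in \<open>U\<close>; together they need more than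
      the at most \<open>8 * q + 1 - card U\<close> vertices of \<open>F\<close>.\<close>
    have len: "length r \<le> 6"
    proof (rule ccontr)
      assume "\<not> ?thesis"
      then have l7: "6 < length r" by simp
      let ?v = "\<lambda>i. r ! i"
      have rF: "?v i \<in> F" if "i < length r" for i using r that nth_mem by (auto simp: walk_def)
      have d: "closed_nbhd F E (?v 0) \<inter> closed_nbhd F E (?v 3) = {}" "closed_nbhd F E (?v 0) \<inter> closed_nbhd F E (?v 6) = {}"
        "closed_nbhd F E (?v 3) \<inter> closed_nbhd F E (?v 6) = {}"
        using shortest_walk_nbhds_disjoint[OF g r rm] l7 by auto
      have H: "finite (closed_nbhd F E (?v i))" "closed_nbhd F E (?v i) \<subseteq> F" "card (closed_nbhd F E (?v i)) = card (neighbors F E (?v i)) + 1"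
        if "i < length r" for i using closed_nbhd_degree[OF g fU(2) rF[OF that]] by auto
      have l: "0 < length r" "3 < length r" using l7 by auto
      have "card (closed_nbhd F E (?v 0) \<union> closed_nbhd F E (?v 3) \<union> closed_nbhd F E (?v 6)) \<le> card F"
        using H(2)[OF l(1)] H(2)[OF l(2)] H(2)[OF l7] fU by (intro card_mono) auto
      moreover have "card (closed_nbhd F E (?v 0) \<union> closed_nbhd F E (?v 3) \<union> closed_nbhd F E (?v 6))
          = card (closed_nbhd F E (?v 0)) + card (closed_nbhd F E (?v 3)) + card (closed_nbhd F E (?v 6))"
      proof -
        have "card (closed_nbhd F E (?v 0) \<union> closed_nbhd F E (?v 3)) = card (closed_nbhd F E (?v 0)) + card (closed_nbhd F E (?v 3))"
          by (rule card_Un_disjoint[OF H(1)[OF l(1)] H(1)[OF l(2)] d(1)])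
        moreover have "(closed_nbhd F E (?v 0) \<union> closed_nbhd F E (?v 3)) \<inter> closed_nbhd F E (?v 6) = {}" using d by blast
        ultimately show ?thesis using H(1)[OF l(1)] H(1)[OF l(2)] H(1)[OF l7] by (subst card_Un_disjoint) auto
      qed
      ultimately have "card (neighbors F E (?v 0)) + card (neighbors F E (?v 3)) + card (neighbors F E (?v 6)) + 3 \<le> card F"
        using H(3)[OF l(1)] H(3)[OF l(2)] H(3)[OF l7] by linarith
      moreover have "4 * q \<le> card (neighbors F E (?v i)) + card (U \<inter> {w. E (?v i) w})" "2 * card (U \<inter> {w. E (?v i) w}) \<le> 3 * q"
        if "i < length r" for i using degF[of "?v i"] eta[OF rF[OF that]] rF[OF that] by (auto simp: F_def)
      note this[OF l(1)] this[OF l(2)] this[OF l7] etaU[of "?v 0"] etaU[of "?v 3"] etaU[of "?v 6"] cF cV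
      ultimately show False by linarith
    qed
    define s where "s = x # r @ [m x]"
    have rr: "r \<noteq> []" "set r \<subseteq> F" "successively E r" "hd r = a" "last r = b" using r by (auto simp: walk_def)
    have "walk V E x (m x) s" unfolding walk_def s_def
      using rr a b x m Y ugraph_sym[OF g] by (auto simp: successively_Cons successively_append_iff F_def)
    moreover have "length s \<le> 8" using len by (simp add: s_def)
    moreover have "set s \<inter> Y = {x, m x}" using rr(2) YU x m by (auto simp: s_def F_def)
    moreover have "set s \<inter> set (p y) = {}" if "y \<in> Y'" for y
    proof -
      have "set r \<inter> set (p y) = {}" using rr(2) that by (auto simp: F_def U_def)
      then show ?thesis using xp[OF that] by (auto simp: s_def)
    qed
    ultimately have "short_linkage V E Y m (Y' \<union> {x, m x}) (p(x := s, m x := rev s))"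
      using mxx by (intro short_linkage_update[OF g p m x(1)]) auto
    then show False using maxY x(2) by blast
  qed
  have "component E F a \<inter> component E F b = {}"
  proof (rule ccontr)
    assume "component E F a \<inter> component E F b \<noteq> {}"
    then obtain z where "reach_in E F a z" "reach_in E F b z" by (auto simp: component_def)
    then show False using disconnected rtranclp_trans[OF _ reach_in_sym[OF g]] by blast
  qed
  moreover have "component E F a \<subseteq> F" "component E F b \<subseteq> F" by (rule component_subset[OF a(1)], rule component_subset[OF b(1)])
  ultimately have "card (component E F a) + card (component E F b) \<le> card F"
    using fU card_mono[of F "component E F a \<union> component E F b"] card_Un_disjoint[of "component E F a" "component E F b"]
    by (metis finite_subset le_sup_iff)
  then have "\<exists>c\<in>F. 2 * card (component E F c) \<le> card F"
  proof (cases "card (component E F a) \<le> card (component E F b)")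
    case True
    then show ?thesis using \<open>_ + _ \<le> card F\<close> a(1) by (intro bexI[of _ a]) auto
  next
    case False
    then show ?thesis using \<open>_ + _ \<le> card F\<close> b(1) by (intro bexI[of _ b]) auto
  qed
  then obtain c where c: "c \<in> F" "2 * card (component E F c) \<le> card F" by blast
  define L where "L = component E F c"
  have LF: "L \<subseteq> F" using component_subset[OF c(1)] by (simp add: L_def)
  have fL: "finite L" using LF fU finite_subset by blast
  have cL: "c \<in> L" by (simp add: L_def component_def)
  have nL: "neighbors L E v = neighbors F E v" if "v \<in> L" for v
    using neighbors_component[OF c(1)] that by (simp add: L_def)
  have dL: "4 * q \<le> card (neighbors L E v) + card (U \<inter> {w. E v w})" "2 * card (U \<inter> {w. E v w}) \<le> 3 * q" if "v \<in> L" for v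
    using degF[of v] eta[of v] nL[OF that] LF that by (auto simp: F_def)
  have sub: "neighbors L E v \<subseteq> L" for v by (auto simp: neighbors_def)
  have "card (neighbors L E c) \<le> card L" by (rule card_mono[OF fL sub])
  then have qL: "q \<le> card L" using dL[OF cL] by linarith
  \<comment> \<open>Degrees do not drop when \<open>F\<close> is restricted to its component
    \<open>L\<close>, while \<open>2 * card L\<close> is at most \<open>card F\<close>. Inclusion
    and exclusion then leaves enough common neighbours, the losses to \<open>U\<close> being offset
    by the smaller \<open>F\<close>.\<close>
  have common: "3 * q \<le> 2 * card (neighbors L E v \<inter> neighbors L E w) + 4" if "v \<in> L" "w \<in> L" for v w
  proof -
    have "card (neighbors L E v \<union> neighbors L E w) \<le> card L" using fL sub by (intro card_mono) auto
    moreover have "card (neighbors L E v) + card (neighbors L E w)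
        = card (neighbors L E v \<union> neighbors L E w) + card (neighbors L E v \<inter> neighbors L E w)"
      using fL sub finite_subset by (intro card_Un_Int) blast+
    ultimately show ?thesis
      using dL[OF that(1)] dL[OF that(2)] c(2) cF cV etaU[of v] etaU[of w] unfolding L_def[symmetric] by linarith
  qed
  have "linked L E Z" if "Z \<subseteq> L" "card Z \<le> q" for Z
    by (rule linked_if_many_common_neighbors[OF g fL that common])
  moreover have "L \<subseteq> V" using LF by (auto simp: F_def)
  ultimately show ?thesis using qL by blast
qed

section \<open>Massed pairs\<close>

definition add_clique :: "('a \<Rightarrow> 'a \<Rightarrow> bool) \<Rightarrow> 'a set \<Rightarrow> 'a \<Rightarrow> 'a \<Rightarrow> bool" where
  "add_clique E K = (\<lambda>u v. E u v \<or> u \<noteq> v \<and> u \<in> K \<and> v \<in> K)"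

lemma ugraph_add_clique: "ugraph E \<Longrightarrow> ugraph (add_clique E K)"
  by (auto simp: ugraph_def add_clique_def)

text \<open>Each set of the linkage is cut where it first enters \<open>K\<close>. The remaining
  piece has one vertex in \<open>K\<close>, hence uses no edge of the clique, and the pieces are
  reconnected inside \<open>B\<close>. So a side that links its own boundary may be traded for a
  clique on that boundary.\<close>

lemma linked_replace_clique:
  assumes g: "ugraph E" and XW: "X \<subseteq> W" and K: "W \<inter> B = K"
    and lk: "linked W (add_clique E K) X" and lB: "linked B E K"
  shows "linked (W \<union> B) E X"
  unfolding linked_def
proof (intro allI impI)
  fix m assume m0: "\<forall>x\<in>X. m x \<in> X \<and> m (m x) = x"
  then have m: "\<And>x. x \<in> X \<Longrightarrow> m x \<in> X" "\<And>x. x \<in> X \<Longrightarrow> m (m x) = x" by auto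
  obtain S where S: "linkage W (add_clique E K) X m S" by (rule linkedD[OF lk, of m]) (use m in auto)
  note L = linkageD[OF S]
  define X0 where "X0 = {x \<in> X. S x \<inter> K \<noteq> {}}"
  have "\<exists>T k. T \<subseteq> S x \<and> connected_set E T \<and> x \<in> T \<and> T \<inter> K = {k}" if x: "x \<in> X0" for x
  proof -
    have xX: "x \<in> X" using x by (simp add: X0_def)
    obtain y where y: "y \<in> S x" "y \<in> K" using x by (auto simp: X0_def)
    obtain T z where T: "T \<subseteq> S x" "connected_set (add_clique E K) T" "x \<in> T" "T \<inter> K = {z}"
      by (rule connected_set_first_hit[OF ugraph_add_clique[OF g] L(3)[OF xX] L(1)[OF xX] y])
    have "connected_set E T" using T(2)
    proof (rule connected_set_cong)
      fix a b assume ab: "a \<in> T" "b \<in> T" "add_clique E K a b"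
      show "E a b"
      proof (rule ccontr)
        assume "\<not> E a b"
        then have "a \<noteq> b" "a \<in> T \<inter> K" "b \<in> T \<inter> K" using ab by (auto simp: add_clique_def)
        then show False using T(4) by simp
      qed
    qed
    then show ?thesis using T by blast
  qed
  then have "\<forall>x\<in>X0. \<exists>T k. T \<subseteq> S x \<and> connected_set E T \<and> x \<in> T \<and> T \<inter> K = {k}" ..
  then have "\<exists>T. \<forall>x\<in>X0. \<exists>k. T x \<subseteq> S x \<and> connected_set E (T x) \<and> x \<in> T x \<and> T x \<inter> K = {k}" by (rule bchoice)
  then obtain T0 where "\<forall>x\<in>X0. \<exists>k. T0 x \<subseteq> S x \<and> connected_set E (T0 x) \<and> x \<in> T0 x \<and> T0 x \<inter> K = {k}" ..
  then have "\<exists>k. \<forall>x\<in>X0. T0 x \<subseteq> S x \<and> connected_set E (T0 x) \<and> x \<in> T0 x \<and> T0 x \<inter> K = {k x}" by (rule bchoice)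
  then obtain k where "\<forall>x\<in>X0. T0 x \<subseteq> S x \<and> connected_set E (T0 x) \<and> x \<in> T0 x \<and> T0 x \<inter> K = {k x}" ..
  note T0 = bspec[OF this]
  define T where "T x = (if x \<in> X0 then T0 x else S x)" for x
  have TS: "T x \<subseteq> S x" for x using T0[of x] by (auto simp: T_def)
  have mX0: "m x \<in> X0 \<longleftrightarrow> x \<in> X0" if "x \<in> X" for x using L(4)[OF that] m(1)[OF that] that by (simp add: X0_def)
  show "\<exists>S. linkage (W \<union> B) E X m S"
  proof (rule linkage_join[OF g m, of T W X0 B k])
    fix x assume x: "x \<in> X"
    have "x \<in> T x \<and> connected_set E (T x)"
    proof (cases "x \<in> X0")
      case True
      then show ?thesis using T0[OF True] by (simp add: T_def)
    next
      case False
      then have "S x \<inter> K = {}" using x by (auto simp: X0_def)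
      then have "connected_set E (S x)" using L(3)[OF x]
        by (elim connected_set_cong) (auto simp: add_clique_def)
      then show ?thesis using L(1)[OF x] False by (simp add: T_def)
    qed
    then show "x \<in> T x \<and> T x \<subseteq> W \<and> connected_set E (T x)" using TS[of x] L(2)[OF x] by blast
  next
    fix x y assume "x \<in> X" "y \<in> X" "y \<noteq> x" "y \<noteq> m x"
    then show "T x \<inter> T y = {}" using L(5)[of x y] TS[of x] TS[of y] by blast
  next
    fix x assume x: "x \<in> X0"
    then have xX: "x \<in> X" by (simp add: X0_def)
    show "m x \<in> X0" using mX0[OF xX] x by simp
    have "T x \<inter> B = T x \<inter> K" using TS[of x] L(2)[OF xX] K by blast
    then show "T x \<inter> B = {k x}" using T0[OF x] x by (simp add: T_def)
  next
    fix x assume x: "x \<in> X" "x \<notin> X0"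
    have "S x \<inter> B = S x \<inter> K" using L(2)[OF x(1)] K by blast
    then have "S x \<inter> B = {}" using x by (simp add: X0_def)
    then show "T x \<inter> B = {} \<and> T (m x) = T x" using x mX0[OF x(1)] L(4)[OF x(1)] by (simp add: T_def)
  next
    show "linked B E (k ` X0)" by (rule linked_subset[OF lB]) (use T0 in blast)
  qed (auto simp: X0_def)
qed

text \<open>Sets of different pairs are disjoint, so \<open>u\<close>, and with it \<open>v\<close>,
  goes to one pair at most.\<close>

lemma linked_uncontract:
  assumes g: "ugraph E" and uv: "E u v" "u \<in> W" "v \<notin> W" and lk: "linked W (contract E u v) X" and XW: "X \<subseteq> W"
  shows "linked (insert v W) E X"
  unfolding linked_def
proof (intro allI impI)
  fix m assume m: "\<forall>x\<in>X. m x \<in> X \<and> m (m x) = x"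
  obtain S where S: "linkage W (contract E u v) X m S" by (rule linkedD[OF lk, of m]) (use m in auto)
  note L = linkageD[OF S]
  define T where "T x = (if u \<in> S x then insert v (S x) else S x)" for x
  have "linkage (insert v W) E X m T" unfolding linkage_def
  proof (intro ballI conjI impI)
    fix x assume x: "x \<in> X"
    have vS: "v \<notin> S x" using L(2)[OF x] uv(3) by blast
    show "x \<in> T x" "T x \<subseteq> insert v W" "T (m x) = T x" using L(1,2,4)[OF x] by (auto simp: T_def)
    show "connected_set E (T x)" unfolding T_def by (rule connected_set_uncontract[OF g uv(1) L(3)[OF x] vS])
    fix y assume y: "y \<in> X" "y \<noteq> x" "y \<noteq> m x"
    have "v \<notin> S y" using L(2)[OF y(1)] uv(3) by blast
    then show "T x \<inter> T y = {}" using L(5)[OF x y] vS by (auto simp: T_def)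
  qed
  then show "\<exists>S. linkage (insert v W) E X m S" by blast
qed

text \<open>The threshold \<open>8 * q\<close> in ordered pairs means \<open>4 * q\<close> edges per
  vertex outside \<open>X\<close>. The last condition says that no separation of order below
  \<open>card X\<close> cuts a dense part off from \<open>X\<close>; it is what every reduction has
  to preserve.\<close>

definition massed :: "nat \<Rightarrow> 'a set \<Rightarrow> ('a \<Rightarrow> 'a \<Rightarrow> bool) \<Rightarrow> 'a set \<Rightarrow> bool" where
  "massed q V E X \<longleftrightarrow> finite V \<and> X \<subseteq> V \<and> 8 * q * card (V - X) < card (incident_pairs V E (V - X)) \<and>
     (\<forall>A B. separation V E A B \<longrightarrow> X \<subseteq> A \<longrightarrow> card (A \<inter> B) < card X \<longrightarrow>
        card (incident_pairs V E (B - A)) \<le> 8 * q * card (B - A))"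

lemma massedD:
  assumes "massed q V E X"
  shows "finite V" "X \<subseteq> V" "8 * q * card (V - X) < card (incident_pairs V E (V - X))"
    "\<And>A B. separation V E A B \<Longrightarrow> X \<subseteq> A \<Longrightarrow> card (A \<inter> B) < card X \<Longrightarrow>
        card (incident_pairs V E (B - A)) \<le> 8 * q * card (B - A)"
  using assms unfolding massed_def by blast+

lemma incident_pairs_mono:
  assumes "finite V" "W \<subseteq> V" "\<And>a b. (a, b) \<in> incident_pairs W F S \<Longrightarrow> E a b" "S \<subseteq> S'"
  shows "card (incident_pairs W F S) \<le> card (incident_pairs V E S')"
  using assms by (intro card_mono finite_incident_pairs) (auto simp: incident_pairs_def)

lemma incident_pairs_separation:
  assumes g: "ugraph E" and s: "separation V E A B"
  shows "incident_pairs V E (B - A) = incident_pairs B E (B - A)"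
proof -
  have "b \<in> B" if "a \<in> B - A" "b \<in> V" "E a b \<or> E b a" for a b
    using separationD[OF s, of b a] separation_Un[OF s] that ugraph_sym[OF g] by blast
  then show ?thesis using separation_Un[OF s] by (auto simp: incident_pairs_def)
qed

text \<open>Since the boundary of the first separation lies in \<open>C\<close>, the set
  \<open>A\<close> can be added to \<open>C\<close> without changing the boundary or the far side of
  the second.\<close>

lemma separation_glue:
  assumes "separation V E A B" "separation B E C D" "A \<inter> B \<subseteq> C"
  shows "separation V E (A \<union> C) D" "(A \<union> C) \<inter> D = C \<inter> D" "D - (A \<union> C) = D - C"
proof -
  have V: "V = A \<union> B" "B = C \<union> D" using separation_Un assms(1,2) by blast+
  show "separation V E (A \<union> C) D" unfolding separation_def
  proof (intro conjI ballI notI)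
    fix a b assume a: "a \<in> A \<union> C - D" and b: "b \<in> D - (A \<union> C)" and e: "E a b"
    show False
    proof (cases "a \<in> C")
      case True
      then show False using separationD[OF assms(2), of a b] a b e by blast
    next
      case False
      then show False using separationD[OF assms(1), of a b] a b e V assms(3) by blast
    qed
  qed (use V in blast)
  show "(A \<union> C) \<inter> D = C \<inter> D" "D - (A \<union> C) = D - C" using V assms(3) by blast+
qed

text \<open>A separation of \<open>B\<close> with \<open>A \<inter> B\<close> on its near side
  extends to \<open>V\<close> by adding \<open>A\<close> to that side. So a dense far side whose
  order is least possible is again massed, with the boundary as terminals.\<close>

lemma massed_side:
  assumes g: "ugraph E" and fin: "finite V" and s: "separation V E A B" "X \<subseteq> A"
    and small: "\<And>C D. separation V E C D \<Longrightarrow> X \<subseteq> C \<Longrightarrow> card (C \<inter> D) < card (A \<inter> B) \<Longrightarrow>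
        card (incident_pairs V E (D - C)) \<le> 8 * q * card (D - C)"
    and big: "8 * q * card (B - A) < card (incident_pairs V E (B - A))"
  shows "massed q B E (A \<inter> B)"
  unfolding massed_def
proof (intro conjI allI impI)
  have BV: "B \<subseteq> V" using separation_Un[OF s(1)] by blast
  show "finite B" using BV fin finite_subset by blast
  show "A \<inter> B \<subseteq> B" by simp
  have "B - A \<inter> B = B - A" by blast
  then show "8 * q * card (B - A \<inter> B) < card (incident_pairs B E (B - A \<inter> B))"
    using big incident_pairs_separation[OF g s(1)] by simp
  fix C D assume CD: "separation B E C D" "A \<inter> B \<subseteq> C" "card (C \<inter> D) < card (A \<inter> B)"
  note gl = separation_glue[OF s(1) CD(1,2)]
  have "card (incident_pairs V E (D - C)) \<le> 8 * q * card (D - C)"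
    using small[OF gl(1)] s(2) CD(3) unfolding gl(2,3) by blast
  moreover have "card (incident_pairs B E (D - C)) \<le> card (incident_pairs V E (D - C))"
    by (rule incident_pairs_mono[OF fin BV]) (auto simp: incident_pairs_def)
  ultimately show "card (incident_pairs B E (D - C)) \<le> 8 * q * card (D - C)" by linarith
qed

text \<open>The far side links its own boundary, so it can be replaced by a clique there. The order
  may equal \<open>card X\<close>, one more than the separations restricted by
  \<open>massed\<close>.\<close>

definition rigid :: "'a set \<Rightarrow> ('a \<Rightarrow> 'a \<Rightarrow> bool) \<Rightarrow> 'a set \<Rightarrow> 'a set \<Rightarrow> 'a set \<Rightarrow> bool" where
  "rigid V E X A B \<longleftrightarrow> separation V E A B \<and> X \<subseteq> A \<and> \<not> B \<subseteq> A \<and> card (A \<inter> B) \<le> card X \<and> linked B E (A \<inter> B)"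

text \<open>Either Menger's theorem leads \<open>X\<close> into the hub \<open>Z\<close>, or a
  separation of least order stands in the way. By minimality the boundary of that separation can
  itself be led into the hub, so it is linked on the far side.\<close>

lemma min_separation_linked:
  assumes g: "ugraph E" and fin: "finite V" and XV: "X \<subseteq> V" and Z: "Z \<subseteq> V" "Z \<subseteq> L" "V \<inter> L \<subseteq> Z"
    and link: "\<And>Y. Y \<subseteq> Z \<Longrightarrow> card Y \<le> card X \<Longrightarrow> linked L E Y"
  obtains "linked (V \<union> L) E X" | A B where "separation V E A B" "X \<subseteq> A" "Z \<subseteq> B" "card (A \<inter> B) < card X" "linked (B \<union> L) E (A \<inter> B)"
proof (cases "\<exists>A B. separation V E A B \<and> X \<subseteq> A \<and> Z \<subseteq> B \<and> card (A \<inter> B) < card X")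
  case False
  have "linked (V \<union> L) E X"
  proof (rule linked_extend[OF g fin XV Z])
    fix A B assume "separation V E A B" "X \<subseteq> A" "Z \<subseteq> B"
    then show "card X \<le> card (A \<inter> B)" using False not_less by blast
  qed (use link in auto)
  then show thesis by (rule that(1))
next
  case True
  define P where "P = (\<lambda>(A, B). separation V E A B \<and> X \<subseteq> A \<and> Z \<subseteq> B \<and> card (A \<inter> B) < card X)"
  have "\<exists>p. P p" using True by (auto simp: P_def)
  then obtain p where p: "P p" "\<And>r. P r \<Longrightarrow> card (fst p \<inter> snd p) \<le> card (fst r \<inter> snd r)"
    using ex_has_least_nat[of P _ "\<lambda>p. card (fst p \<inter> snd p)"] by blast
  obtain A B where AB: "p = (A, B)" by force
  have s: "separation V E A B" "X \<subseteq> A" "Z \<subseteq> B" "card (A \<inter> B) < card X" using p(1) by (auto simp: AB P_def)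
  have min: "card (A \<inter> B) \<le> card (C \<inter> D)" if "separation V E C D" "X \<subseteq> C" "Z \<subseteq> D" for C D
  proof (cases "card (C \<inter> D) < card X")
    case True
    then show ?thesis using p(2)[of "(C, D)"] that by (simp add: AB P_def)
  next
    case False
    then show ?thesis using s(4) by simp
  qed
  have BV: "B \<subseteq> V" using separation_Un[OF s(1)] by blast
  have "linked (B \<union> L) E (A \<inter> B)"
  proof (rule linked_extend[OF g, of B "A \<inter> B" Z L])
    show "finite B" using BV fin finite_subset by blast
    fix C D assume CD: "separation B E C D" "A \<inter> B \<subseteq> C" "Z \<subseteq> D"
    note gl = separation_glue[OF s(1) CD(1,2)]
    show "card (A \<inter> B) \<le> card (C \<inter> D)" using min[OF gl(1) _ CD(3)] s(2) unfolding gl(2) by blast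
  next
    fix Y assume "Y \<subseteq> Z" "card Y = card (A \<inter> B)"
    then show "linked L E Y" using link s(4) by simp
  qed (use s(3) Z BV in blast)+
  then show thesis by (rule that(2)[OF s])
qed

section \<open>Reductions of a minimal counterexample\<close>

lemma incident_pairs_empty [simp]: "incident_pairs V E {} = {}"
  by (simp add: incident_pairs_def)

text \<open>A violating separation is taken of least order, as \<open>massed_side\<close>
  requires.\<close>

lemma not_massedE:
  assumes V: "finite V" "X \<subseteq> V" and i: "8 * q * card (V - X) < card (incident_pairs V E (V - X))"
    and nm: "\<not> massed q V E X"
  obtains A B where "separation V E A B" "X \<subseteq> A" "card (A \<inter> B) < card X"
    "8 * q * card (B - A) < card (incident_pairs V E (B - A))"
    "\<And>C D. separation V E C D \<Longrightarrow> X \<subseteq> C \<Longrightarrow> card (C \<inter> D) < card (A \<inter> B) \<Longrightarrow>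
        card (incident_pairs V E (D - C)) \<le> 8 * q * card (D - C)"
proof -
  define P where "P = (\<lambda>(A, B). separation V E A B \<and> X \<subseteq> A \<and> card (A \<inter> B) < card X \<and>
      8 * q * card (B - A) < card (incident_pairs V E (B - A)))"
  from nm obtain A0 B0 where "P (A0, B0)" using V i unfolding massed_def P_def by (auto simp: not_le)
  then obtain p where p: "P p" "\<And>r. P r \<Longrightarrow> card (fst p \<inter> snd p) \<le> card (fst r \<inter> snd r)"
    using ex_has_least_nat[of P _ "\<lambda>p. card (fst p \<inter> snd p)"] by blast
  obtain A B where AB: "p = (A, B)" by force
  have s: "separation V E A B" "X \<subseteq> A" "card (A \<inter> B) < card X" "8 * q * card (B - A) < card (incident_pairs V E (B - A))"
    using p(1) by (auto simp: AB P_def)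
  show thesis
  proof (rule that[OF s], rule ccontr)
    fix C D assume a: "separation V E C D" "X \<subseteq> C" "card (C \<inter> D) < card (A \<inter> B)"
      "\<not> card (incident_pairs V E (D - C)) \<le> 8 * q * card (D - C)"
    then have "P (C, D)" using s(3) by (simp add: P_def)
    then show False using p(2)[of "(C, D)"] a(3) by (simp add: AB)
  qed
qed

text \<open>Choose a rigid separation with \<open>A\<close> smallest. If its order is
  \<open>card X\<close>, Menger's theorem inside \<open>A\<close> either links \<open>X\<close>
  through the boundary or gives a rigid separation with a smaller near side. If the order is below
  \<open>card X\<close>, the far side is sparse, and a clique on the boundary in its place leaves a
  smaller massed pair, which is linked by induction.\<close>

lemma no_rigid_separation:
  fixes V :: "'a set"
  assumes g: "ugraph E" and ms: "massed q V E X" and cX: "card X \<le> q" and nl: "\<not> linked V E X"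
    and IH: "\<And>(V' :: 'a set) E' X'. card V' < card V \<Longrightarrow> ugraph E' \<Longrightarrow> massed q V' E' X' \<Longrightarrow> card X' \<le> q \<Longrightarrow> linked V' E' X'"
  shows "\<not> rigid V E X A B"
proof
  assume "rigid V E X A B"
  note M = massedD[OF ms]
  define P where "P = (\<lambda>(A, B). rigid V E X A B)"
  have "P (A, B)" using \<open>rigid V E X A B\<close> by (simp add: P_def)
  then obtain p where p: "P p" "\<And>r. P r \<Longrightarrow> card (fst p) \<le> card (fst r)"
    using ex_has_least_nat[of P "(A, B)" "\<lambda>p. card (fst p)"] by blast
  obtain A B where AB: "p = (A, B)" by force
  have s: "separation V E A B" "X \<subseteq> A" "\<not> B \<subseteq> A" "card (A \<inter> B) \<le> card X" "linked B E (A \<inter> B)"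
    using p(1) by (auto simp: AB P_def rigid_def)
  have min: "card A \<le> card C" if "rigid V E X C D" for C D using p(2)[of "(C, D)"] that by (simp add: AB P_def)
  have V: "V = A \<union> B" using separation_Un[OF s(1)] by simp
  have fA: "finite A" "finite B" using M(1) V by auto
  have cAV: "card A < card V" using s(3) M(1) V by (intro psubset_card_mono) auto
  define K where "K = A \<inter> B"
  show False
  proof (cases "card K = card X")
    case True
    have lk: "linked B E Y" if "Y \<subseteq> K" for Y using linked_subset[OF s(5)] that by (simp add: K_def)
    show False
    proof (rule min_separation_linked[OF g fA(1) s(2), of K B])
      assume "linked (A \<union> B) E X"
      then show False using nl V by simp
    next
      fix C D assume CD: "separation A E C D" "X \<subseteq> C" "K \<subseteq> D" "card (C \<inter> D) < card X" "linked (D \<union> B) E (C \<inter> D)"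
      have A: "A = C \<union> D" using separation_Un[OF CD(1)] by simp
      have CB: "C \<inter> (D \<union> B) = C \<inter> D" using CD(3) A by (auto simp: K_def)
      have "separation V E C (D \<union> B)" unfolding separation_def
      proof (intro conjI ballI notI)
        fix a b assume a: "a \<in> C - (D \<union> B)" and b: "b \<in> D \<union> B - C" and e: "E a b"
        show False
        proof (cases "b \<in> D")
          case True
          then show False using separationD[OF CD(1), of a b] a b e by blast
        next
          case False
          then show False using separationD[OF s(1), of a b] a b e A by blast
        qed
      qed (use V A in blast)
      then have "rigid V E X C (D \<union> B)" unfolding rigid_def CB using CD s(3) A by auto
      then have "card A \<le> card C" by (rule min)
      then have "C = A" using fA(1) A by (intro card_seteq) auto
      then have "K \<subseteq> C \<inter> D" using CD(3) by (auto simp: K_def)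
      then have "card K \<le> card (C \<inter> D)" using fA(1) A by (intro card_mono) auto
      then show False using True CD(4) by simp
    qed (use lk in \<open>auto simp: K_def\<close>)
  next
    case False
    then have Klt: "card K < card X" using s(4) by (simp add: K_def)
    let ?F = "add_clique E K"
    have gF: "ugraph ?F" by (rule ugraph_add_clique[OF g])
    have lift: "linked (W \<union> B) E Z" if "linked W ?F Z" "Z \<subseteq> W" "W \<subseteq> A" "K \<subseteq> W" for W Z
      by (rule linked_replace_clique[OF g that(2) _ that(1)]) (use that s(5) in \<open>auto simp: K_def\<close>)
    have "massed q A ?F X"
    proof (rule ccontr)
      assume nm: "\<not> massed q A ?F X"
      \<comment> \<open>The far side carries at most \<open>8 * q\<close> pairs per vertex of
        \<open>B - A\<close>, so the excess density remains in \<open>A\<close>.\<close>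
      have "card (incident_pairs V E (V - X)) \<le> card (incident_pairs V E (B - A) \<union> incident_pairs A E (A - X))"
        using fA M(1) V by (intro card_mono finite_UnI finite_incident_pairs) (auto simp: incident_pairs_def)
      also have "\<dots> \<le> card (incident_pairs V E (B - A)) + card (incident_pairs A E (A - X))" by (rule card_Un_le)
      also have "\<dots> \<le> 8 * q * card (B - A) + card (incident_pairs A ?F (A - X))"
        using M(4)[OF s(1,2)] Klt incident_pairs_mono[OF fA(1) subset_refl, of E "A - X" ?F "A - X"]
        by (auto simp: K_def incident_pairs_def add_clique_def)
      finally have 1: "card (incident_pairs V E (V - X)) \<le> 8 * q * card (B - A) + card (incident_pairs A ?F (A - X))" .
      have "V - X = (A - X) \<union> (B - A)" using V s(2) by auto
      then have "card (V - X) = card (A - X) + card (B - A)" using fA by (simp add: card_Un_disjoint[of "A - X" "B - A"] Int_Diff Diff_Int_distrib2 disjoint_iff)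
      then have i: "8 * q * card (A - X) < card (incident_pairs A ?F (A - X))" using M(3) 1 by (simp add: algebra_simps)
      obtain C D where CD: "separation A ?F C D" "X \<subseteq> C" "card (C \<inter> D) < card X" "8 * q * card (D - C) < card (incident_pairs A ?F (D - C))"
        and CDmin: "\<And>C' D'. separation A ?F C' D' \<Longrightarrow> X \<subseteq> C' \<Longrightarrow> card (C' \<inter> D') < card (C \<inter> D) \<Longrightarrow>
          card (incident_pairs A ?F (D' - C')) \<le> 8 * q * card (D' - C')"
        by (rule not_massedE[OF fA(1) s(2) i nm]) (rule that, assumption+)
      have A: "A = C \<union> D" using separation_Un[OF CD(1)] by simp
      \<comment> \<open>No separation splits a clique. If \<open>K\<close> is on the side of
        \<open>X\<close>, restoring \<open>B\<close> there contradicts that \<open>V\<close> is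
        massed. If it is on the far side, \<open>D\<close> with \<open>B\<close> restored is the far
        side of a rigid separation, against the choice of \<open>A\<close>.\<close>
      have clique: "K \<subseteq> C \<or> K \<subseteq> D"
      proof (rule ccontr)
        assume "\<not> ?thesis"
        then obtain a b where "a \<in> K" "a \<notin> C" "b \<in> K" "b \<notin> D" by blast
        then show False using separationD[OF CD(1), of b a] A by (auto simp: K_def add_clique_def)
      qed
      have Esep: "\<not> E a b" if "a \<in> C" "a \<notin> D" "b \<in> D" "b \<notin> C" for a b
        using separationD[OF CD(1), of a b] that by (auto simp: add_clique_def)
      show False
      proof (cases "K \<subseteq> C")
        case True
        have "separation V E (C \<union> B) D" unfolding separation_def
        proof (intro conjI ballI notI)
          fix a b assume a: "a \<in> C \<union> B - D" and b: "b \<in> D - (C \<union> B)" and e: "E a b"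
          show False
          proof (cases "a \<in> C")
            case True
            then show False using Esep[of a b] a b e by blast
          next
            case False
            then show False using separationD[OF s(1), of b a] a b e A ugraph_sym[OF g] by blast
          qed
        qed (use V A in blast)
        moreover have "(C \<union> B) \<inter> D = C \<inter> D" "D - (C \<union> B) = D - C" using True A by (auto simp: K_def)
        ultimately have "card (incident_pairs V E (D - C)) \<le> 8 * q * card (D - C)" using M(4)[of "C \<union> B" D] CD(2,3) by auto
        moreover have "card (incident_pairs A ?F (D - C)) \<le> card (incident_pairs V E (D - C))"
          by (rule incident_pairs_mono[OF M(1)]) (use V True in \<open>auto simp: incident_pairs_def add_clique_def\<close>)
        ultimately show False using CD(4) by linarith
      next
        case False
        then have KD: "K \<subseteq> D" using clique by blast
        have "massed q D ?F (C \<inter> D)"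
          by (rule massed_side[OF gF fA(1) CD(1,2) CDmin CD(4)])
        moreover have "card D < card V" using cAV A fA(1) card_mono[of A D] by auto
        ultimately have "linked D ?F (C \<inter> D)" using IH gF CD(3) cX by simp
        then have lk: "linked (D \<union> B) E (C \<inter> D)" by (rule lift) (use A KD in auto)
        have "separation V E C (D \<union> B)" unfolding separation_def
        proof (intro conjI ballI notI)
          fix a b assume a: "a \<in> C - (D \<union> B)" and b: "b \<in> D \<union> B - C" and e: "E a b"
          show False
          proof (cases "b \<in> D")
            case True
            then show False using Esep[of a b] a b e by blast
          next
            case False
            then show False using separationD[OF s(1), of a b] a b e A by blast
          qed
        qed (use V A in blast)
        moreover have "C \<inter> (D \<union> B) = C \<inter> D" using KD A by (auto simp: K_def)
        ultimately have "rigid V E X C (D \<union> B)" unfolding rigid_def using CD lk s(3) A by auto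
        then have "card A \<le> card C" by (rule min)
        then have "C = A" using fA(1) A by (intro card_seteq) auto
        then have e: "D - C = {}" using A by blast
        show False using CD(4) unfolding e by simp
      qed
    qed
    then have "linked A ?F X" using IH cAV gF cX by blast
    then have "linked (A \<union> B) E X" by (rule lift) (use s(2) in \<open>auto simp: K_def\<close>)
    then show False using nl V by simp
  qed
qed

text \<open>Sparsity extends from order below \<open>card X\<close> to order \<open>card X\<close>:
  a dense far side would be massed with fewer vertices, hence linked by induction, and the
  separation would be rigid. This unit of order pays for the vertex that enters the boundary when an
  edge is deleted or contracted.\<close>

lemma small_side_sparse:
  fixes V :: "'a set"
  assumes g: "ugraph E" and ms: "massed q V E X" and cX: "card X \<le> q"
    and nr: "\<And>A B. \<not> rigid V E X A B"
    and IH: "\<And>(V' :: 'a set) E' X'. card V' < card V \<Longrightarrow> ugraph E' \<Longrightarrow> massed q V' E' X' \<Longrightarrow> card X' \<le> q \<Longrightarrow> linked V' E' X'"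
    and s: "separation V E A B" "X \<subseteq> A" "card (A \<inter> B) \<le> card X" "\<not> A \<subseteq> B"
  shows "card (incident_pairs V E (B - A)) \<le> 8 * q * card (B - A)"
proof (rule ccontr)
  assume "\<not> ?thesis"
  then have big: "8 * q * card (B - A) < card (incident_pairs V E (B - A))" by simp
  note M = massedD[OF ms]
  have "massed q B E (A \<inter> B)"
    by (rule massed_side[OF g M(1) s(1,2) _ big]) (use M(4) s(3) in auto)
  moreover have "card B < card V" using s(4) separation_Un[OF s(1)] M(1) by (intro psubset_card_mono) auto
  ultimately have "linked B E (A \<inter> B)" using IH g s(3) cX by simp
  moreover have "\<not> B \<subseteq> A"
  proof
    assume "B \<subseteq> A"
    then have e: "B - A = {}" by blast
    show False using big unfolding e by simp
  qed
  ultimately have "rigid V E X A B" using s by (simp add: rigid_def)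
  then show False using nr by blast
qed

text \<open>If the deleted edge crosses a separation, restoring it moves one of its ends into the
  boundary. The order then is at most \<open>card X\<close>, which \<open>small_side_sparse\<close>
  still covers.\<close>

lemma massed_delete_edge:
  fixes V :: "'a set"
  assumes g: "ugraph E" and ms: "massed q V E X" and cX: "card X \<le> q"
    and nr: "\<And>A B. \<not> rigid V E X A B"
    and IH: "\<And>(V' :: 'a set) E' X'. card V' < card V \<Longrightarrow> ugraph E' \<Longrightarrow> massed q V' E' X' \<Longrightarrow> card X' \<le> q \<Longrightarrow> linked V' E' X'"
    and uv: "u \<in> V - X" "v \<in> V - X" "E u v"
    and big: "8 * q * card (V - X) + 2 < card (incident_pairs V E (V - X))"
  shows "massed q V (delete_edge E u v) X"
  unfolding massed_def
proof (intro conjI allI impI)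
  note M = massedD[OF ms]
  let ?F = "delete_edge E u v"
  show "finite V" "X \<subseteq> V" by (rule M)+
  show "8 * q * card (V - X) < card (incident_pairs V ?F (V - X))"
    using big card_incident_pairs_delete_edge[OF g M(1), of u v "V - X"] uv by simp
  fix A B assume s: "separation V ?F A B" "X \<subseteq> A" "card (A \<inter> B) < card X"
  have le: "card (incident_pairs V ?F (B - A)) \<le> card (incident_pairs V E (B - A))"
    by (rule incident_pairs_mono[OF M(1)]) (auto simp: incident_pairs_def delete_edge_def)
  have fin: "finite A" "finite B" using separation_Un[OF s(1)] M(1) by auto
  have V: "V = A \<union> B" using separation_Un[OF s(1)] by simp
  show "card (incident_pairs V ?F (B - A)) \<le> 8 * q * card (B - A)"
  proof (cases "separation V E A B")
    case True
    then show ?thesis using M(4)[OF True s(2,3)] le by linarith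
  next
    case False
    then obtain a b where ab: "a \<in> A - B" "b \<in> B - A" "E a b" using s(1) by (auto simp: separation_def)
    have "\<not> ?F a b" using s(1) ab by (auto simp: separation_def)
    then have eq: "{a, b} = {u, v}" using ab(3) by (simp add: delete_edge_def)
    have aX: "a \<notin> X" using eq uv by (auto simp: doubleton_eq_iff)
    have F: "?F c d \<longleftrightarrow> E c d \<and> {c, d} \<noteq> {a, b}" for c d by (simp add: delete_edge_def eq)
    have "separation V E A (insert a B)" unfolding separation_def
    proof (intro conjI ballI notI)
      fix c d assume cd: "c \<in> A - insert a B" "d \<in> insert a B - A" "E c d"
      then have "?F c d" unfolding F using ab by (auto simp: doubleton_eq_iff)
      then show False using separationD[OF s(1), of c d] cd ab by auto
    qed (use V ab in blast)
    moreover have "card (A \<inter> insert a B) \<le> card X"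
    proof -
      have "A \<inter> insert a B = insert a (A \<inter> B)" using ab by blast
      then show ?thesis using s(3) fin by (simp add: card_insert_if)
    qed
    moreover have "\<not> A \<subseteq> insert a B"
    proof
      assume "A \<subseteq> insert a B"
      then have "X \<subseteq> A \<inter> B" using s(2) aX by blast
      then have "card X \<le> card (A \<inter> B)" using fin by (intro card_mono) auto
      then show False using s(3) by simp
    qed
    ultimately have "card (incident_pairs V E (insert a B - A)) \<le> 8 * q * card (insert a B - A)"
      using small_side_sparse[OF g ms cX nr IH] s(2) by blast
    moreover have "insert a B - A = B - A" using ab by blast
    ultimately show ?thesis using le by simp
  qed
qed

text \<open>A violating separation is pulled back by placing \<open>v\<close> wherever
  \<open>u\<close> is. On the near side the order stays; in the boundary it grows by one; on the far
  side that side is massed, so by induction it links its boundary, and the pulled-back separation is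
  rigid.\<close>

lemma massed_contract:
  fixes V :: "'a set"
  assumes g: "ugraph E" and ms: "massed q V E X" and cX: "card X \<le> q"
    and nr: "\<And>A B. \<not> rigid V E X A B"
    and IH: "\<And>(V' :: 'a set) E' X'. card V' < card V \<Longrightarrow> ugraph E' \<Longrightarrow> massed q V' E' X' \<Longrightarrow> card X' \<le> q \<Longrightarrow> linked V' E' X'"
    and uv: "u \<in> V" "v \<in> V - X" "E u v"
    and small: "2 + 2 * card {w \<in> V. E v w \<and> w \<noteq> u \<and> (E u w \<or> u \<in> X \<and> w \<in> X)} \<le> 8 * q"
  shows "massed q (V - {v}) (contract E u v) X"
proof (rule ccontr)
  assume nm: "\<not> massed q (V - {v}) (contract E u v) X"
  note M = massedD[OF ms]
  let ?W = "V - {v}" and ?F = "contract E u v"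
  have gF: "ugraph ?F" by (rule ugraph_contract[OF g])
  have fW: "finite ?W" using M(1) by simp
  have cW: "card ?W < card V" using M(1) uv by (intro psubset_card_mono) auto
  have unev: "u \<noteq> v" using uv ugraph_irrefl[OF g] by auto
  have XW: "X \<subseteq> ?W" using M(2) uv by auto
  have c1: "card (V - X) = card (?W - X) + 1"
  proof -
    have "V - X = insert v (?W - X)" using uv by auto
    then show ?thesis using fW by simp
  qed
  have "card (incident_pairs V E (V - X)) \<le> card (incident_pairs ?W ?F (?W - X)) + 2
     + 2 * card {w \<in> V. E v w \<and> w \<noteq> u \<and> (E u w \<or> u \<in> X \<and> w \<in> X)}"
    by (rule card_incident_pairs_contract[OF g M(1)]) (use uv in auto)
  then have i: "8 * q * card (?W - X) < card (incident_pairs ?W ?F (?W - X))"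
    using M(3) small c1 by simp
  obtain A B where s: "separation ?W ?F A B" "X \<subseteq> A" "card (A \<inter> B) < card X" "8 * q * card (B - A) < card (incident_pairs ?W ?F (B - A))"
    and min: "\<And>C D. separation ?W ?F C D \<Longrightarrow> X \<subseteq> C \<Longrightarrow> card (C \<inter> D) < card (A \<inter> B) \<Longrightarrow>
          card (incident_pairs ?W ?F (D - C)) \<le> 8 * q * card (D - C)"
    by (rule not_massedE[OF fW XW i nm]) (rule that, assumption+)
  have W: "?W = A \<union> B" using separation_Un[OF s(1)] by simp
  have vAB: "v \<notin> A" "v \<notin> B" using W by auto
  have V: "V = insert v (A \<union> B)" using W uv by auto
  have fAB: "finite A" "finite B" using fW W by auto
  have F: "?F a b" if "E a b" "a \<noteq> v" "b \<noteq> v" for a b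
    using that ugraph_irrefl[OF g] by (auto simp: contract_def)
  have Fu: "?F u b" "?F b u" if "E v b" "b \<noteq> u" "b \<noteq> v" for b
    using that unev ugraph_sym[OF g] by (auto simp: contract_def)
  have Esep: "\<not> E a b" if "a \<in> A" "a \<notin> B" "b \<in> B" "b \<notin> A" for a b
    using separationD[OF s(1) that] F[of a b] that vAB by blast
  have XB: "\<not> X \<subseteq> B"
  proof
    assume "X \<subseteq> B"
    then have "X \<subseteq> A \<inter> B" using s(2) by blast
    then have "card X \<le> card (A \<inter> B)" using fAB by (intro card_mono) auto
    then show False using s(3) by simp
  qed
  have "u \<in> A \<union> B" using W uv unev by blast
  then consider "u \<in> A" "u \<notin> B" | "u \<in> A" "u \<in> B" | "u \<in> B" "u \<notin> A" by blast
  then show False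
  proof cases
    case 1
    have "separation V E (insert v A) B" unfolding separation_def
    proof (intro conjI ballI notI)
      fix a b assume a: "a \<in> insert v A - B" and b: "b \<in> B - insert v A" and e: "E a b"
      show False
      proof (cases "a = v")
        case True
        then have "?F u b" using Fu(1)[of b] e b 1 by auto
        then show False using separationD[OF s(1), of u b] 1 b by blast
      next
        case False
        then show False using Esep[of a b] a b e by blast
      qed
    qed (use V in blast)
    moreover have "insert v A \<inter> B = A \<inter> B" "B - insert v A = B - A" using vAB by auto
    ultimately have "card (incident_pairs V E (B - A)) \<le> 8 * q * card (B - A)" using M(4)[of "insert v A" B] s(2,3) by auto
    moreover have "card (incident_pairs ?W ?F (B - A)) \<le> card (incident_pairs V E (B - A))"
    proof (rule incident_pairs_mono[OF M(1)])
      fix a b assume "(a, b) \<in> incident_pairs ?W ?F (B - A)"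
      then have "(a, b) \<in> incident_pairs B ?F (B - A)" using incident_pairs_separation[OF gF s(1)] by simp
      then have "a \<in> B" "b \<in> B" "?F a b" by (auto simp: incident_pairs_def)
      then show "E a b" using 1 by (auto simp: contract_def)
    qed auto
    ultimately show False using s(4) by linarith
  next
    case 2
    have "separation V E (insert v A) (insert v B)" unfolding separation_def
      using Esep V by auto
    moreover have "card (insert v A \<inter> insert v B) \<le> card X" using s(3) fAB vAB by simp
    moreover have "\<not> insert v A \<subseteq> insert v B" using XB s(2) uv by blast
    moreover have "insert v B - insert v A = B - A" using vAB by auto
    ultimately have "card (incident_pairs V E (B - A)) \<le> 8 * q * card (B - A)"
      using small_side_sparse[OF g ms cX nr IH, of "insert v A" "insert v B"] s(2) by auto
    moreover have "card (incident_pairs ?W ?F (B - A)) \<le> card (incident_pairs V E (B - A))"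
    proof -
      \<comment> \<open>Pairs that the contraction moved from \<open>v\<close> to \<open>u\<close>
        are moved back. This is injective because \<open>v\<close> occurs in no pair of the
        contracted graph.\<close>
      define f where "f = (\<lambda>(a, b). if E a b then (a, b) else if a = u then (v, b) else (a, v))"
      have "inj_on f (incident_pairs ?W ?F (B - A))"
        by (rule inj_onI) (auto simp: f_def incident_pairs_def contract_def split: if_splits)
      moreover have "f ` incident_pairs ?W ?F (B - A) \<subseteq> incident_pairs V E (B - A)"
        using 2 uv by (auto simp: f_def incident_pairs_def contract_def split: if_splits)
      ultimately show ?thesis using M(1) by (intro card_inj_on_le[of f]) auto
    qed
    ultimately show False using s(4) by linarith
  next
    case 3
    have "massed q B ?F (A \<inter> B)"
      by (rule massed_side[OF gF fW s(1,2) min s(4)])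
    moreover have "card B < card V" using cW W fW card_mono[of ?W B] by auto
    ultimately have "linked B ?F (A \<inter> B)" using IH gF s(3) cX by simp
    then have lk: "linked (insert v B) E (A \<inter> B)" by (rule linked_uncontract[OF g uv(3) 3(1) vAB(2)]) simp
    have "separation V E A (insert v B)" unfolding separation_def
    proof (intro conjI ballI notI)
      fix a b assume a: "a \<in> A - insert v B" and b: "b \<in> insert v B - A" and e: "E a b"
      show False
      proof (cases "b = v")
        case True
        then have "?F a u" using Fu(2)[of a] e a 3 ugraph_sym[OF g] by auto
        then show False using separationD[OF s(1), of a u] 3 a by blast
      next
        case False
        then show False using Esep[of a b] a b e by blast
      qed
    qed (use V in blast)
    moreover have "A \<inter> insert v B = A \<inter> B" using vAB by auto
    ultimately have "rigid V E X A (insert v B)" using s lk 3 vAB by (auto simp: rigid_def)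
    then show False using nr by blast
  qed
qed

lemma incident_pairs_le_degree_sum:
  assumes g: "ugraph E" and fin: "finite V" and S: "S \<subseteq> V"
  shows "card (incident_pairs V E S) \<le> 2 * (\<Sum>v\<in>S. card (neighbors V E v))"
    and "(\<Sum>v\<in>S. card (neighbors V E v)) \<le> card (incident_pairs V E S)"
proof -
  let ?D = "SIGMA v:S. neighbors V E v"
  have fS: "finite S" using S fin finite_subset by blast
  have fN: "finite (neighbors V E v)" for v using fin by (simp add: neighbors_def)
  have cD: "card ?D = (\<Sum>v\<in>S. card (neighbors V E v))" using fS fN by simp
  have fD: "finite ?D" using fS fN by (intro finite_SigmaI) auto
  have "incident_pairs V E S \<subseteq> ?D \<union> prod.swap ` ?D"
    using ugraph_sym[OF g] S by (auto simp: incident_pairs_def neighbors_def image_iff)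
  then have "card (incident_pairs V E S) \<le> card (?D \<union> prod.swap ` ?D)" using fD by (intro card_mono) auto
  also have "\<dots> \<le> card ?D + card (prod.swap ` ?D)" by (rule card_Un_le)
  also have "\<dots> \<le> card ?D + card ?D" using fD by (intro add_mono card_image_le) auto
  finally show "card (incident_pairs V E S) \<le> 2 * (\<Sum>v\<in>S. card (neighbors V E v))" using cD by simp
  have "?D \<subseteq> incident_pairs V E S" using S by (auto simp: incident_pairs_def neighbors_def)
  then show "(\<Sum>v\<in>S. card (neighbors V E v)) \<le> card (incident_pairs V E S)"
    using card_mono[OF finite_incident_pairs[OF fin]] cD by metis
qed

text \<open>One step of the induction of Thomas and Wollan: in a minimal counterexample the closed neighbourhood
  of a vertex of small degree outside \<open>X\<close> is dense, hence contains a hub, and \<open>X\<close> can be joined to it.\<close>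
lemma massed_linked_step:
  fixes V :: "'a set"
  assumes g: "ugraph E" and ms: "massed q V E X" and cX: "card X \<le> q" and q: "1 \<le> q"
    and m: "\<And>x. x \<in> X \<Longrightarrow> m x \<in> X" "\<And>x. x \<in> X \<Longrightarrow> m (m x) = x"
    and complete: "\<And>x y. x \<in> X \<Longrightarrow> y \<in> X \<Longrightarrow> x \<noteq> y \<Longrightarrow> y \<noteq> m x \<Longrightarrow> E x y"
    and IH: "\<And>(V' :: 'a set) E' X'. card V' < card V \<Longrightarrow> ugraph E' \<Longrightarrow> massed q V' E' X' \<Longrightarrow> card X' \<le> q \<Longrightarrow> linked V' E' X'"
    and IH': "\<And>E'. card (incident_pairs V E' (V - X)) < card (incident_pairs V E (V - X)) \<Longrightarrow> ugraph E' \<Longrightarrow> massed q V E' X \<Longrightarrow> linked V E' X"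
  shows "linked V E X"
proof (rule ccontr)
  assume nl: "\<not> linked V E X"
  note M = massedD[OF ms]
  have nr: "\<And>A B. \<not> rigid V E X A B" by (rule no_rigid_separation[OF g ms cX nl IH])
  have fX: "finite X" using M finite_subset by blast
  have "\<exists>u v. u \<in> V - X \<and> v \<in> V - X \<and> E u v"
  proof (rule ccontr)
    assume a: "\<not> ?thesis"
    \<comment> \<open>All counted edges would run between \<open>V - X\<close> and \<open>X\<close>,
      giving at most \<open>2 * q\<close> ordered pairs per vertex outside \<open>X\<close>.\<close>
    have "incident_pairs V E (V - X) \<subseteq> (V - X) \<times> X \<union> X \<times> (V - X)" using a by (auto simp: incident_pairs_def)
    then have "card (incident_pairs V E (V - X)) \<le> card ((V - X) \<times> X \<union> X \<times> (V - X))" using M(1) fX by (intro card_mono) auto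
    also have "\<dots> \<le> card ((V - X) \<times> X) + card (X \<times> (V - X))" by (rule card_Un_le)
    also have "\<dots> = 2 * (card X * card (V - X))" by (simp add: card_cartesian_product)
    also have "\<dots> \<le> 2 * (q * card (V - X))" using cX by simp
    finally show False using M(3) by (simp add: mult.assoc)
  qed
  then obtain u0 v0 where e0: "u0 \<in> V - X" "v0 \<in> V - X" "E u0 v0" by blast
  have upper: "card (incident_pairs V E (V - X)) \<le> 8 * q * card (V - X) + 2"
  proof (rule ccontr)
    assume "\<not> ?thesis"
    then have "massed q V (delete_edge E u0 v0) X"
      using massed_delete_edge[OF g ms cX nr IH e0] by simp
    then have "linked V (delete_edge E u0 v0) X"
      using card_incident_pairs_delete_edge[OF g M(1), of u0 v0 "V - X"] e0
      by (intro IH' ugraph_delete_edge[OF g]) auto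
    then have "linked V E X" by (rule linked_mono) (auto simp: delete_edge_def)
    then show False using nl by blast
  qed
  \<comment> \<open>Otherwise contracting \<open>u v\<close> removes one vertex and at most
    \<open>8 * q\<close> pairs, so the contracted graph is massed, hence linked by induction, and
    the linkage lifts.\<close>
  have codeg: "4 * q \<le> card {w \<in> V. E v w \<and> w \<noteq> u \<and> (E u w \<or> u \<in> X \<and> w \<in> X)}" if uv: "u \<in> V" "v \<in> V - X" "E u v" for u v
  proof (rule ccontr)
    assume "\<not> ?thesis"
    then have "massed q (V - {v}) (contract E u v) X" by (intro massed_contract[OF g ms cX nr IH uv]) linarith+
    moreover have "card (V - {v}) < card V" using M(1) uv by (intro psubset_card_mono) auto
    ultimately have "linked (V - {v}) (contract E u v) X" using IH ugraph_contract[OF g] cX by blast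
    moreover have "u \<noteq> v" using uv ugraph_irrefl[OF g] by auto
    ultimately have "linked (insert v (V - {v})) E X" using uv M(2) by (intro linked_uncontract[OF g uv(3)]) auto
    then show False using nl uv by (simp add: insert_absorb)
  qed
  have isolated: "neighbors V E v \<noteq> {}" if v: "v \<in> V - X" for v
  proof
    assume N: "neighbors V E v = {}"
    let ?W = "V - {v}"
    have nE: "\<not> E v w" "\<not> E w v" if "w \<in> V" for w using N that ugraph_sym[OF g] by (auto simp: neighbors_def)
    have inc: "incident_pairs ?W E S = incident_pairs V E (insert v S)" "incident_pairs ?W E S = incident_pairs V E S" for S
      using nE v by (auto simp: incident_pairs_def)
    have eq: "V - X = insert v (?W - X)" using v by auto
    have "massed q ?W E X" unfolding massed_def
    proof (intro conjI allI impI)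
      show "finite ?W" "X \<subseteq> ?W" using M v by auto
      have "card (V - X) = card (?W - X) + 1" using M(1) unfolding eq by simp
      moreover have "incident_pairs ?W E (?W - X) = incident_pairs V E (V - X)" unfolding inc(1) eq by simp
      ultimately show "8 * q * card (?W - X) < card (incident_pairs ?W E (?W - X))" using M(3) by simp
      fix A B assume s: "separation ?W E A B" "X \<subseteq> A" "card (A \<inter> B) < card X"
      have W: "A \<union> B = ?W" using separation_Un[OF s(1)] .
      have "separation V E (insert v A) B" using s(1) W v nE unfolding separation_def by auto
      moreover have "insert v A \<inter> B = A \<inter> B" "B - insert v A = B - A" using W by auto
      ultimately show "card (incident_pairs ?W E (B - A)) \<le> 8 * q * card (B - A)"
        using M(4)[of "insert v A" B] s unfolding inc(2) by auto
    qed
    moreover have "card ?W < card V" using M(1) v by (intro psubset_card_mono) auto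
    ultimately have "linked ?W E X" using IH g cX by blast
    then have "linked V E X" by (rule linked_mono) auto
    then show False using nl by blast
  qed
  \<comment> \<open>If all degrees outside \<open>X\<close> exceed \<open>8 * q\<close>, the upper
    bound on the pairs leaves at most two vertices outside \<open>X\<close>. Degrees are then at
    most \<open>q + 2\<close>, too few for the density of a massed pair.\<close>
  have "\<exists>v\<in>V - X. card (neighbors V E v) \<le> 8 * q"
  proof (rule ccontr)
    assume "\<not> ?thesis"
    then have "(\<Sum>v\<in>V - X. 8 * q + 1) \<le> (\<Sum>v\<in>V - X. card (neighbors V E v))" by (intro sum_mono) force
    also have "\<dots> \<le> card (incident_pairs V E (V - X))" by (rule incident_pairs_le_degree_sum(2)[OF g M(1)]) auto
    finally have "card (V - X) * (8 * q + 1) \<le> card (incident_pairs V E (V - X))" by simp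
    then have "card (V - X) * (8 * q + 1) \<le> 8 * q * card (V - X) + 2" using upper by linarith
    then have two: "card (V - X) \<le> 2" by (simp add: algebra_simps)
    have cV: "card V = card X + card (V - X)" using M(1,2) fX card_mono[of V X] by (simp add: card_Diff_subset)
    have "card (incident_pairs V E (V - X)) \<le> 2 * (\<Sum>v\<in>V - X. card (neighbors V E v))"
      by (rule incident_pairs_le_degree_sum(1)[OF g M(1)]) auto
    also have "\<dots> \<le> 2 * (\<Sum>v\<in>V - X. q + 2)"
    proof (intro mult_left_mono sum_mono)
      fix v
      have "card (neighbors V E v) \<le> card V" using M(1) by (intro card_mono) (auto simp: neighbors_def)
      then show "card (neighbors V E v) \<le> q + 2" using cV two cX by linarith
    qed simp
    also have "\<dots> = (2 * q + 4) * card (V - X)" by (simp add: algebra_simps)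
    also have "\<dots> \<le> 8 * q * card (V - X)" using q by (intro mult_right_mono) auto
    finally show False using M(3) by simp
  qed
  then obtain v where v: "v \<in> V - X" "card (neighbors V E v) \<le> 8 * q" by blast
  have vV: "v \<in> V" using v by blast
  let ?H = "closed_nbhd V E v"
  note H = closed_nbhd_degree[OF g M(1) vV]
  have fN: "finite (neighbors V E w)" for w using M(1) by (simp add: neighbors_def)
  \<comment> \<open>For \<open>w\<close> in \<open>X\<close> the set of \<open>codeg\<close> may
    also contain terminals not adjacent to \<open>w\<close>; as \<open>X\<close> is complete up to
    the pairing, only \<open>m w\<close> can be one. This costs a single neighbour, which adjacency
    to \<open>v\<close> regains in the closed neighbourhood.\<close>
  have nb: "4 * q \<le> card (neighbors V E v \<inter> neighbors V E w) + 1" if w: "w \<in> neighbors V E v" for w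
  proof -
    have ww: "w \<in> V" "E w v" using w ugraph_sym[OF g] by (auto simp: neighbors_def)
    let ?C = "{z \<in> V. E v z \<and> z \<noteq> w \<and> (E w z \<or> w \<in> X \<and> z \<in> X)}"
    have "?C \<subseteq> insert (m w) (neighbors V E v \<inter> neighbors V E w)"
      using complete[of w] by (auto simp: neighbors_def)
    then have "card ?C \<le> card (insert (m w) (neighbors V E v \<inter> neighbors V E w))" using fN by (intro card_mono) auto
    then have "card ?C \<le> card (neighbors V E v \<inter> neighbors V E w) + 1" using fN by (simp add: card_insert_if split: if_splits)
    then show ?thesis using codeg[OF ww(1) v(1) ww(2)] by linarith
  qed
  have degv: "4 * q \<le> card (neighbors V E v)"
  proof -
    obtain w where w: "w \<in> neighbors V E v" using isolated[OF v(1)] by blast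
    have "neighbors V E v \<inter> neighbors V E w \<subseteq> neighbors V E v - {w}" using ugraph_irrefl[OF g] by (auto simp: neighbors_def)
    then have "card (neighbors V E v \<inter> neighbors V E w) \<le> card (neighbors V E v - {w})" using fN by (intro card_mono) auto
    also have "\<dots> < card (neighbors V E v)" using w fN by (rule_tac card_Diff1_less)
    finally show ?thesis using nb[OF w] by linarith
  qed
  have "\<exists>L\<subseteq>?H. q \<le> card L \<and> (\<forall>Y\<subseteq>L. card Y \<le> q \<longrightarrow> linked L E Y)"
  proof (rule dense_graph_hub[OF g H(1)])
    show "?H \<noteq> {}" by (simp add: closed_nbhd_def)
    show "card ?H \<le> 8 * q + 1" using H(3) v(2) by simp
    fix w assume w: "w \<in> ?H"
    show "4 * q \<le> card (neighbors ?H E w)"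
    proof (cases "w = v")
      case True
      then show ?thesis using H(4) degv by simp
    next
      case False
      then have "w \<in> neighbors V E v" using w by (simp add: closed_nbhd_def)
      then show ?thesis using H(5) nb by simp
    qed
  qed
  then obtain L where L: "L \<subseteq> ?H" "q \<le> card L" "\<And>Y. Y \<subseteq> L \<Longrightarrow> card Y \<le> q \<Longrightarrow> linked L E Y" by blast
  have LV: "L \<subseteq> V" using L(1) H(2) by blast
  show False
  proof (rule min_separation_linked[OF g M(1,2) LV subset_refl])
    assume "linked (V \<union> L) E X"
    then show False using nl LV by (simp add: Un_absorb2)
  next
    fix A B assume s: "separation V E A B" "X \<subseteq> A" "L \<subseteq> B" "card (A \<inter> B) < card X" "linked (B \<union> L) E (A \<inter> B)"
    have BL: "B \<union> L = B" using s(3) by blast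
    have "\<not> B \<subseteq> A"
    proof
      assume "B \<subseteq> A"
      then have "L \<subseteq> A \<inter> B" using s(3) by blast
      moreover have "finite (A \<inter> B)" using separation_Un[OF s(1)] M(1) by auto
      ultimately have "card L \<le> card (A \<inter> B)" by (intro card_mono)
      then show False using L(2) s(4) cX by linarith
    qed
    then have "rigid V E X A B" using s unfolding BL by (simp add: rigid_def)
    then show False using nr by blast
  next
    fix Y assume "Y \<subseteq> L" "card Y \<le> card X"
    then show "linked L E Y" using L(3) cX by simp
  qed auto
qed

text \<open>All edges inside \<open>X\<close> between different pairs may be added: they do not
  count in the density, they create no new separations, and no linkage can use them, because each of
  its sets meets \<open>X\<close> in one pair. The induction is lexicographic, first on the vertices
  and then on the edges with an end outside \<open>X\<close>.\<close>

theorem massed_linked: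
  fixes V :: "'a set"
  assumes "ugraph E" "massed q V E X" "card X \<le> q" and q: "1 \<le> q"
  shows "linked V E X"
  using assms(1-3)
proof (induction "card V" arbitrary: V E X rule: less_induct)
  case (less V E X)
  note IHV = less.hyps and cX = less.prems(3)
  show ?case using less.prems(1,2)
  proof (induction "card (incident_pairs V E (V - X))" arbitrary: E rule: less_induct)
    case (less E)
    note g = less.prems(1) and ms = less.prems(2)
    show ?case unfolding linked_def
    proof (intro allI impI)
      fix m assume m0: "\<forall>x\<in>X. m x \<in> X \<and> m (m x) = x"
      then have m: "\<And>x. x \<in> X \<Longrightarrow> m x \<in> X" "\<And>x. x \<in> X \<Longrightarrow> m (m x) = x" by auto
      define F where "F = (\<lambda>a b. E a b \<or> a \<in> X \<and> b \<in> X \<and> a \<noteq> b \<and> b \<noteq> m a)"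
      have gF: "ugraph F" using g m unfolding ugraph_def F_def by metis
      have inc: "incident_pairs V F S = incident_pairs V E S" if "S \<inter> X = {}" for S
        using that by (auto simp: incident_pairs_def F_def)
      have VX: "(V - X) \<inter> X = {}" by blast
      have sep: "separation V E A B" if "separation V F A B" for A B using that by (auto simp: separation_def F_def)
      have "massed q V F X" unfolding massed_def
      proof (intro conjI allI impI)
        show "finite V" "X \<subseteq> V" using massedD(1,2)[OF ms] by auto
        show "8 * q * card (V - X) < card (incident_pairs V F (V - X))" using massedD(3)[OF ms] unfolding inc[OF VX] .
        fix A B assume s: "separation V F A B" "X \<subseteq> A" "card (A \<inter> B) < card X"
        have "(B - A) \<inter> X = {}" using s(2) by blast
        then show "card (incident_pairs V F (B - A)) \<le> 8 * q * card (B - A)"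
          using massedD(4)[OF ms sep[OF s(1)] s(2,3)] inc by simp
      qed
      then have "linked V F X"
      proof (rule massed_linked_step[OF gF _ cX q m])
        show "F x y" if "x \<in> X" "y \<in> X" "x \<noteq> y" "y \<noteq> m x" for x y using that by (simp add: F_def)
        show "linked V' E' X'" if "card V' < card V" "ugraph E'" "massed q V' E' X'" "card X' \<le> q" for V' :: "'a set" and E' X'
          by (rule IHV[OF that])
        fix E' assume "card (incident_pairs V E' (V - X)) < card (incident_pairs V F (V - X))" "ugraph E'" "massed q V E' X"
        then show "linked V E' X" using less.hyps[of E'] unfolding inc[OF VX] by blast
      qed
      then obtain S where S: "linkage V F X m S" using m unfolding linked_def by blast
      note L = linkageD[OF S]
      have own: "a \<in> {x, m x}" if "x \<in> X" "a \<in> S x" "a \<in> X" for x a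
        using L(5)[OF that(1,3)] L(1)[OF that(3)] that(2) by blast
      have "connected_set E (S x)" if x: "x \<in> X" for x
        using L(3)[OF x]
      proof (rule connected_set_cong)
        fix a b assume ab: "a \<in> S x" "b \<in> S x" "F a b"
        show "E a b"
        proof (rule ccontr)
          assume "\<not> E a b"
          then have n: "a \<in> X" "b \<in> X" "a \<noteq> b" "b \<noteq> m a" using ab(3) by (auto simp: F_def)
          have "a \<in> {x, m x}" "b \<in> {x, m x}" using own x ab n by blast+
          then show False using n m(2)[OF x] by auto
        qed
      qed
      then have "linkage V E X m S" using S unfolding linkage_def by blast
      then show "\<exists>S. linkage V E X m S" by blast
    qed
  qed
qed

section \<open>Topological minors in graphs of large minimum degree\<close>

text \<open>Take a smallest vertex set with at least \<open>2 * q\<close> vertices and more than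
  \<open>10 * q * (card H - q)\<close> pairs. Comparison with \<open>H - {v}\<close> bounds the
  degrees. For a nontrivial separation of order below \<open>q\<close> both sides are smaller, hence
  too sparse, and with fewer than \<open>q\<close> common vertices their pairs cannot add up to
  those of \<open>H\<close>.\<close>

lemma exists_dense_connected_subgraph:
  assumes g: "ugraph E" and V: "finite V" "V \<noteq> {}" and q: "1 \<le> q"
    and deg: "\<And>v. v \<in> V \<Longrightarrow> 10 * q \<le> card (neighbors V E v)"
  obtains H where "H \<subseteq> V" "H \<noteq> {}" "10 * q * card H < card (incident_pairs H E H) + 10 * q * q"
    "\<And>v. v \<in> H \<Longrightarrow> 5 * q < card (neighbors H E v)"
    "\<And>A B. separation H E A B \<Longrightarrow> card (A \<inter> B) < q \<Longrightarrow> A \<subseteq> B \<or> B \<subseteq> A"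
proof -
  define P where "P H \<longleftrightarrow> H \<subseteq> V \<and> 2 * q \<le> card H \<and> 10 * q * card H < card (incident_pairs H E H) + 10 * q * q" for H
  have le: "card (neighbors H E v) \<le> card H" if "finite H" for H v using that by (intro card_mono) (auto simp: neighbors_def)
  have "(\<Sum>v\<in>V. 10 * q) \<le> (\<Sum>v\<in>V. card (neighbors V E v))" by (intro sum_mono deg)
  then have "10 * q * card V \<le> card (incident_pairs V E V)" using V by (simp add: card_incident_pairs_UNIV mult.commute)
  moreover obtain v0 where v0: "v0 \<in> V" using V by blast
  moreover have "2 * q \<le> card V" using deg[OF v0] le[OF V(1), of v0] by linarith
  moreover have "0 < 10 * q * q" using q by simp
  ultimately have "P V" unfolding P_def by - (intro conjI subset_refl; linarith)
  then obtain H where H: "P H" and Hmin: "\<And>W. P W \<Longrightarrow> card H \<le> card W"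
    using ex_has_least_nat[of P V card] by blast
  have HV: "H \<subseteq> V" and H2: "2 * q \<le> card H" and Hd: "10 * q * card H < card (incident_pairs H E H) + 10 * q * q"
    using H by (auto simp: P_def)
  have fH: "finite H" using HV V finite_subset by blast
  have small: "card (incident_pairs W E W) + 10 * q * q \<le> 10 * q * card W" if "W \<subseteq> H" "W \<noteq> H" "2 * q \<le> card W" for W
  proof (rule ccontr)
    assume "\<not> ?thesis"
    then have "P W" using that HV by (auto simp: P_def)
    moreover have "card W < card H" using that fH by (intro psubset_card_mono) auto
    ultimately show False using Hmin by fastforce
  qed
  \<comment> \<open>On exactly \<open>2 * q\<close> vertices there are at most
    \<open>4 * q * q\<close> pairs, but more than \<open>10 * q * q\<close> are required. So one
    vertex can be deleted without violating the size bound.\<close>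
  have Hne: "card H \<noteq> 2 * q"
  proof
    assume c: "card H = 2 * q"
    have "incident_pairs H E H \<subseteq> H \<times> H" by (auto simp: incident_pairs_def)
    then have "card (incident_pairs H E H) \<le> card (H \<times> H)" using fH by (intro card_mono) auto
    then have "card (incident_pairs H E H) \<le> 4 * (q * q)" using c by (simp add: card_cartesian_product)
    then show False using Hd c by simp
  qed
  have degH: "5 * q < card (neighbors H E v)" if v: "v \<in> H" for v
  proof -
    have c: "card (H - {v}) = card H - 1" using fH v by simp
    have "card (incident_pairs (H - {v}) E (H - {v})) + 10 * q * q \<le> 10 * q * card (H - {v})"
      using v H2 Hne c by (intro small) auto
    also have "10 * q * card (H - {v}) + 10 * q = 10 * q * card H"
    proof -
      have "card H = Suc (card (H - {v}))" using c H2 q by linarith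
      then show ?thesis by simp
    qed
    finally have "card (incident_pairs (H - {v}) E (H - {v})) + 10 * q * q + 10 * q \<le> 10 * q * card H" by simp
    then show ?thesis using Hd card_incident_pairs_remove[OF g fH v] by linarith
  qed
  have conn: "A \<subseteq> B \<or> B \<subseteq> A" if s: "separation H E A B" "card (A \<inter> B) < q" for A B
  proof (rule ccontr)
    assume "\<not> ?thesis"
    then obtain a b where ab: "a \<in> A" "a \<notin> B" "b \<in> B" "b \<notin> A" by blast
    have HAB: "H = A \<union> B" using separation_Un[OF s(1)] by simp
    have fAB: "finite A" "finite B" using fH HAB by auto
    have "neighbors H E a \<subseteq> A" using separationD[OF s(1) ab(1,2)] HAB by (auto simp: neighbors_def)
    then have cA: "5 * q < card A" using degH[of a] ab HAB card_mono[OF fAB(1), of "neighbors H E a"] by auto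
    have "neighbors H E b \<subseteq> B" using separationD[OF s(1) _ _ ab(3,4)] HAB ugraph_sym[OF g] by (auto simp: neighbors_def)
    then have cB: "5 * q < card B" using degH[of b] ab HAB card_mono[OF fAB(2), of "neighbors H E b"] by auto
    have sA: "card (incident_pairs A E A) + 10 * q * q \<le> 10 * q * card A" using ab HAB cA by (intro small) auto
    have sB: "card (incident_pairs B E B) + 10 * q * q \<le> 10 * q * card B" using ab HAB cB by (intro small) auto
    have "incident_pairs H E H \<subseteq> incident_pairs A E A \<union> incident_pairs B E B"
      using separationD[OF s(1)] HAB ugraph_sym[OF g] by (auto simp: incident_pairs_def)
    then have "card (incident_pairs H E H) \<le> card (incident_pairs A E A \<union> incident_pairs B E B)"
      using fAB by (intro card_mono) auto
    then have "card (incident_pairs H E H) \<le> card (incident_pairs A E A) + card (incident_pairs B E B)"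
      using card_Un_le order.trans by blast
    moreover have "card A + card B = card H + card (A \<inter> B)" unfolding HAB by (rule card_Un_Int[OF fAB])
    then have "10 * q * card A + 10 * q * card B = 10 * q * card H + 10 * q * card (A \<inter> B)" by (metis distrib_left)
    moreover have "10 * q * card (A \<inter> B) \<le> 10 * q * q" using s(2) by simp
    ultimately show False using Hd sA sB by linarith
  qed
  show thesis by (rule that[OF HV _ Hd degH conn]) (use H2 q in auto)
qed

text \<open>The degrees give \<open>5 * q \<le> card H\<close>, so the deficit
  \<open>10 * q * q\<close> is at most \<open>2 * q\<close> per vertex and \<open>8 * q\<close>
  remain; the pairs inside \<open>X\<close> number at most \<open>q * card X\<close> and are
  absorbed. Separations of order below \<open>q\<close> are trivial, so their far sides add no
  vertex.\<close>

lemma highly_connected_massed: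
  assumes g: "ugraph E" and H: "finite H" "H \<noteq> {}" and dens: "10 * q * card H < card (incident_pairs H E H) + 10 * q * q"
    and deg: "\<And>v. v \<in> H \<Longrightarrow> 5 * q < card (neighbors H E v)"
    and conn: "\<And>A B. separation H E A B \<Longrightarrow> card (A \<inter> B) < q \<Longrightarrow> A \<subseteq> B \<or> B \<subseteq> A"
    and X: "X \<subseteq> H" "card X \<le> q"
  shows "massed q H E X"
  unfolding massed_def
proof (intro conjI allI impI H X)
  have fX: "finite X" using X H finite_subset by blast
  obtain v where v: "v \<in> H" using H by blast
  have "card (neighbors H E v) \<le> card H" using H by (intro card_mono) (auto simp: neighbors_def)
  then have n: "5 * q \<le> card H" using deg[OF v] by linarith
  define n x r where "n = card H" and "x = card X" and "r = card (incident_pairs H E (H - X))"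
  have "incident_pairs H E H \<subseteq> incident_pairs H E (H - X) \<union> X \<times> X" by (auto simp: incident_pairs_def)
  then have "card (incident_pairs H E H) \<le> card (incident_pairs H E (H - X) \<union> X \<times> X)" using H fX by (intro card_mono) auto
  also have "\<dots> \<le> r + x * x" using card_Un_le[of "incident_pairs H E (H - X)" "X \<times> X"] by (simp add: card_cartesian_product r_def x_def)
  finally have "card (incident_pairs H E H) \<le> r + x * x" .
  then have 1: "10 * q * n < r + x * x + 10 * q * q" using dens by (simp add: n_def)
  have 2: "x * x \<le> 8 * q * x" using X(2) by (simp add: x_def)
  have 3: "10 * q * q \<le> 2 * q * n" using mult_left_mono[OF n, of "2 * q"] by (simp add: n_def algebra_simps)
  have xn: "x \<le> n" unfolding x_def n_def using H X by (intro card_mono)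
  have "10 * q * n = 8 * q * n + 2 * q * n" by simp
  then have "8 * q * n < r + 8 * q * x" using 1 2 3 by linarith
  moreover have "card (H - X) = n - x" unfolding n_def x_def using fX X by (simp add: card_Diff_subset)
  moreover have "8 * q * n = 8 * q * (n - x) + 8 * q * x" using xn by (metis add.commute distrib_left le_add_diff_inverse)
  ultimately show "8 * q * card (H - X) < card (incident_pairs H E (H - X))" unfolding r_def[symmetric] by simp
  fix A B assume s: "separation H E A B" "X \<subseteq> A" "card (A \<inter> B) < card X"
  have "\<not> A \<subseteq> B"
  proof
    assume "A \<subseteq> B"
    then have "X \<subseteq> A \<inter> B" using s(2) by blast
    moreover have "finite (A \<inter> B)" using separation_Un[OF s(1)] H by auto
    ultimately have "card X \<le> card (A \<inter> B)" by (intro card_mono)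
    then show False using s(3) by simp
  qed
  then have "B \<subseteq> A" using conn[OF s(1)] s(3) X(2) by auto
  then have e: "B - A = {}" by blast
  show "card (incident_pairs H E (B - A)) \<le> 8 * q * card (B - A)" unfolding e by simp
qed

lemma exists_injective_choice:
  assumes "finite Q" "\<And>p. p \<in> Q \<Longrightarrow> finite (N p) \<and> k \<le> card (N p)" "card Q \<le> k"
  shows "\<exists>h. inj_on h Q \<and> (\<forall>p\<in>Q. h p \<in> N p)"
  using assms
proof (induction Q rule: finite_induct)
  case (insert a Q)
  then obtain h where h: "inj_on h Q" "\<forall>p\<in>Q. h p \<in> N p" by auto
  have "card (h ` Q) \<le> card Q" by (rule card_image_le[OF insert(1)])
  also have "\<dots> < card (N a)" using insert.prems insert.hyps by (auto dest!: meta_spec[of _ a])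
  finally have "\<not> N a \<subseteq> h ` Q" using card_mono[of "h ` Q" "N a"] insert(1) by auto
  then obtain z where z: "z \<in> N a" "z \<notin> h ` Q" by blast
  have "inj_on (h(a := z)) (insert a Q)" using h(1) z insert(2) by (auto simp: inj_on_def)
  moreover have "\<forall>p\<in>insert a Q. (h(a := z)) p \<in> N p" using h(2) z(1) by auto
  ultimately show ?case by blast
qed simp

text \<open>Terminals are indexed by pairs: \<open>z (i, i)\<close> is the branch vertex
  \<open>f i\<close>, and \<open>z (i, j)\<close> is a private neighbour of \<open>f i\<close>
  reserved for the connection to \<open>f j\<close>. These are \<open>t * t\<close> terminals,
  whence \<open>q\<close>. The pairing swaps the two indices, so the branch vertices are fixed
  points and the connecting sets avoid them.\<close>

theorem min_degree_topological_minor: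
  fixes V :: "'a set" and t :: nat
  assumes g: "ugraph E" and V: "finite V" "V \<noteq> {}" and t: "1 \<le> t"
    and deg: "\<And>v. v \<in> V \<Longrightarrow> 10 * t ^ 2 \<le> card (neighbors V E v)"
  shows "has_Kt_topological_minor V E t"
proof -
  define q where "q = t * t"
  have q: "1 \<le> q" "t \<le> q" using t by (auto simp: q_def)
  have deg': "10 * q \<le> card (neighbors V E v)" if "v \<in> V" for v using deg[OF that] by (simp add: q_def power2_eq_square)
  obtain H where H: "H \<subseteq> V" "H \<noteq> {}" "10 * q * card H < card (incident_pairs H E H) + 10 * q * q"
    and dH: "\<And>v. v \<in> H \<Longrightarrow> 5 * q < card (neighbors H E v)"
    and conn: "\<And>A B. separation H E A B \<Longrightarrow> card (A \<inter> B) < q \<Longrightarrow> A \<subseteq> B \<or> B \<subseteq> A"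
    using exists_dense_connected_subgraph[OF g V q(1) deg'] by blast
  have fH: "finite H" using H V finite_subset by blast
  obtain v0 where v0: "v0 \<in> H" using H by blast
  have "card (neighbors H E v0) \<le> card H" using fH by (intro card_mono) (auto simp: neighbors_def)
  then have tH: "card {..<t} \<le> card H" using dH[OF v0] q by simp
  obtain f where f: "inj_on f {..<t}" "f ` {..<t} \<subseteq> H"
    using card_le_inj[OF finite_lessThan fH tH] by blast
  define Q where "Q = {..<t} \<times> {..<t} - {(i, i) | i. True}"
  define N where "N p = neighbors H E (f (fst p)) - f ` {..<t}" for p :: "nat \<times> nat"
  have fQ: "finite Q" by (simp add: Q_def)
  have "card Q \<le> card ({..<t} \<times> {..<t})" unfolding Q_def by (intro card_mono) auto
  then have cQ: "card Q \<le> q" by (simp add: card_cartesian_product q_def)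
  \<comment> \<open>More than \<open>5 * q\<close> neighbours, less the \<open>t \<le> q\<close>
    branch vertices, leave room for a greedy choice of at most \<open>q\<close> distinct
    ones.\<close>
  have "\<exists>h. inj_on h Q \<and> (\<forall>p\<in>Q. h p \<in> N p)"
  proof (rule exists_injective_choice[OF fQ _ cQ])
    fix p assume "p \<in> Q"
    then have "f (fst p) \<in> H" using f(2) by (auto simp: Q_def)
    then have "5 * q < card (neighbors H E (f (fst p)))" by (rule dH)
    moreover have "card (neighbors H E (f (fst p))) - card (f ` {..<t}) \<le> card (N p)" unfolding N_def by (rule diff_card_le_card_Diff) simp
    moreover have "card (f ` {..<t}) \<le> t" using card_image_le[of "{..<t}" f] by simp
    ultimately show "finite (N p) \<and> q \<le> card (N p)" using fH q by (auto simp: N_def neighbors_def)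
  qed
  then obtain h where h: "inj_on h Q" "\<And>p. p \<in> Q \<Longrightarrow> h p \<in> N p" by blast
  define I where "I = {..<t} \<times> {..<t}"
  define z where "z p = (if fst p = snd p then f (fst p) else h p)" for p
  have IQ: "p \<in> Q" if "p \<in> I" "fst p \<noteq> snd p" for p using that by (auto simp: Q_def I_def)
  have hN: "h p \<in> H" "E (f (fst p)) (h p)" "h p \<notin> f ` {..<t}" if "p \<in> Q" for p
    using h(2)[OF that] by (auto simp: N_def neighbors_def)
  have zinj: "inj_on z I"
  proof (rule inj_onI)
    fix p r assume pr: "p \<in> I" "r \<in> I" "z p = z r"
    have fI: "f (fst s) \<in> f ` {..<t}" if "s \<in> I" for s using that by (auto simp: I_def)
    show "p = r"
    proof (cases "fst p = snd p"; cases "fst r = snd r")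
      assume a: "fst p = snd p" "fst r = snd r"
      then have "f (fst p) = f (fst r)" using pr(3) by (simp add: z_def)
      then have "fst p = fst r" using pr f(1) by (auto simp: I_def dest: inj_onD)
      then show ?thesis using a by (simp add: prod_eq_iff)
    next
      assume a: "fst p = snd p" "fst r \<noteq> snd r"
      then show ?thesis using pr(3) fI[OF pr(1)] hN(3)[OF IQ[OF pr(2) a(2)]] by (simp add: z_def)
    next
      assume a: "fst p \<noteq> snd p" "fst r = snd r"
      then show ?thesis using pr(3) fI[OF pr(2)] hN(3)[OF IQ[OF pr(1) a(1)]] by (simp add: z_def)
    next
      assume a: "fst p \<noteq> snd p" "fst r \<noteq> snd r"
      then have "h p = h r" using pr(3) by (simp add: z_def)
      then show ?thesis using inj_onD[OF h(1) _ IQ[OF pr(1) a(1)] IQ[OF pr(2) a(2)]] by blast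
    qed
  qed
  define X where "X = z ` I"
  have XH: "X \<subseteq> H"
  proof
    fix y assume "y \<in> X"
    then obtain p where p: "p \<in> I" "y = z p" by (auto simp: X_def)
    show "y \<in> H" using p hN(1)[OF IQ[OF p(1)]] f(2) by (cases "fst p = snd p") (auto simp: z_def I_def)
  qed
  have "card X \<le> card I" unfolding X_def by (rule card_image_le) (simp add: I_def)
  then have cX: "card X \<le> q" by (simp add: I_def card_cartesian_product q_def)
  have "linked H E X"
    by (rule massed_linked[OF g highly_connected_massed[OF g fH H(2,3) dH conn XH cX] cX q(1)])
  define m where "m y = z (prod.swap (inv_into I z y))" for y
  have mz: "m (z (i, j)) = z (j, i)" if "i < t" "j < t" for i j
    using inv_into_f_f[OF zinj, of "(i, j)"] that by (simp add: m_def I_def)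
  have Xz: "\<exists>i j. i < t \<and> j < t \<and> y = z (i, j)" if "y \<in> X" for y using that by (auto simp: X_def I_def)
  have zX: "z (i, j) \<in> X" if "i < t" "j < t" for i j using that by (auto simp: X_def I_def)
  obtain S where S: "linkage H E X m S"
  proof (rule linkedD[OF \<open>linked H E X\<close>, of m])
    fix y assume "y \<in> X"
    then obtain i j where ij: "i < t" "j < t" "y = z (i, j)" using Xz by blast
    then show "m y \<in> X" "m (m y) = y" using mz zX by auto
  qed
  note L = linkageD[OF S]
  have Ld: "S (z (i, j)) \<inter> S (z (k, l)) = {}" if "i < t" "j < t" "k < t" "l < t" "(k, l) \<noteq> (i, j)" "(k, l) \<noteq> (j, i)" for i j k l
  proof (rule L(5)[OF zX zX])
    show "z (k, l) \<noteq> z (i, j)" using inj_onD[OF zinj, of "(k, l)" "(i, j)"] that by (auto simp: I_def)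
    show "z (k, l) \<noteq> m (z (i, j))" using inj_onD[OF zinj, of "(k, l)" "(j, i)"] that mz by (auto simp: I_def)
  qed (use that in auto)
  define T where "T i j = insert (f i) (insert (f j) (S (z (i, j))))" for i j
  have T: "T i j - {f i, f j} \<subseteq> S (z (i, j))" for i j by (auto simp: T_def)
  have "Kt_subdivision H E t f T" unfolding Kt_subdivision_def
  proof (intro conjI allI impI f; (elim conjE)?)
    fix i j assume ij: "i < j" "j < t"
    then have it: "i < t" and ne: "i \<noteq> j" by auto
    have zij: "z (i, j) = h (i, j)" "z (j, i) = h (j, i)" using ne by (auto simp: z_def)
    have Qij: "(i, j) \<in> Q" "(j, i) \<in> Q" using ij by (auto simp: Q_def)
    have zj: "z (j, i) \<in> S (z (i, j))" using L(1)[OF zX[OF ij(2) it]] L(4)[OF zX[OF it ij(2)]] mz[OF it ij(2)] by simp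
    have "connected_set E (insert (f j) (S (z (i, j))))"
      by (rule connected_set_insert[OF g L(3)[OF zX[OF it ij(2)]] zj]) (use hN(2)[OF Qij(2)] zij in simp)
    then show "connected_set E (T i j)" unfolding T_def
      by (rule connected_set_insert[OF g, of _ "z (i, j)"]) (use L(1)[OF zX[OF it ij(2)]] hN(2)[OF Qij(1)] zij in auto)
    show "T i j \<subseteq> H" using L(2)[OF zX[OF it ij(2)]] f(2) it ij by (auto simp: T_def)
    show "f i \<in> T i j" "f j \<in> T i j" by (auto simp: T_def)
    show "(T i j - {f i, f j}) \<inter> f ` {..<t} = {}"
    proof -
      have "f k \<notin> S (z (i, j))" if k: "k < t" for k
      proof -
        have "f k = z (k, k)" by (simp add: z_def)
        then have "f k \<in> S (z (k, k))" using L(1)[OF zX[OF k k]] by simp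
        then show ?thesis using Ld[OF it ij(2) k k] ne by auto
      qed
      then show ?thesis using T[of i j] by auto
    qed
    fix k l assume kl: "k < l" "l < t" "(i, j) \<noteq> (k, l)"
    then have "S (z (i, j)) \<inter> S (z (k, l)) = {}" using ij by (intro Ld) auto
    then show "(T i j - {f i, f j}) \<inter> (T k l - {f k, f l}) = {}" using T[of i j] T[of k l] by blast
  qed
  then have "has_Kt_topological_minor H E t" by (rule has_Kt_topological_minorI)
  then show ?thesis using H(1) by (rule has_Kt_topological_minor_mono)
qed

theorem dynamically_colorable_no_topological_minor:
  fixes V :: "'a set" and t :: nat
  assumes V: "finite V" and g: "ugraph E" and t: "1 \<le> t" and nm: "\<not> has_Kt_topological_minor V E t"
  shows "dynamically_colorable V E (10 * t ^ 2 + 2)"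
proof -
  define \<G> where "\<G> = (\<lambda>(V :: 'a set) E. finite V \<and> ugraph E \<and> \<not> has_Kt_topological_minor V E t)"
  have t2: "1 \<le> t ^ 2" using t by simp
  \<comment> \<open>The minimum degree theorem applies from \<open>10 * t ^ 2\<close> on, so the
    class has vertices of degree at most \<open>10 * t ^ 2 - 1\<close>; three more colours make
    \<open>10 * t ^ 2 + 2\<close>.\<close>
  define d where "d = 10 * t ^ 2 - 1"
  have "\<exists>c. proper_coloring V E c \<and> (\<forall>v\<in>V. happy V E c v) \<and> c ` V \<subseteq> {..<d + 3}"
  proof (rule dynamic_coloring_degenerate_class[of \<G>])
    fix V E v assume G: "\<G> V E" and v: "v \<in> V"
    have "\<not> has_Kt_topological_minor (V - {v}) E t"
      by (rule contrapos_nn[of "has_Kt_topological_minor V E t"]) (use G in \<open>simp add: \<G>_def\<close>, erule has_Kt_topological_minor_mono, auto)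
    then show "\<G> (V - {v}) E" using G by (simp add: \<G>_def)
  next
    fix V E v x y assume G: "\<G> V E" and v: "v \<in> V" "x \<in> neighbors V E v" "y \<in> neighbors V E v" "x \<noteq> y"
    have "\<not> has_Kt_topological_minor (V - {v}) (add_edge E x y) t"
      by (rule contrapos_nn[of "has_Kt_topological_minor V E t"])
        (use G in \<open>simp add: \<G>_def\<close>, rule has_Kt_topological_minor_suppress[OF _ v], use G in \<open>simp add: \<G>_def\<close>)
    then show "\<G> (V - {v}) (add_edge E x y)" using G ugraph_add_edge[OF _ v(4)] by (simp add: \<G>_def)
  next
    fix V E assume G: "\<G> V E" and ne: "V \<noteq> {}"
    show "\<exists>v\<in>V. card (neighbors V E v) \<le> d"
    proof (rule ccontr)
      assume a: "\<not> ?thesis"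
      have "10 * t ^ 2 \<le> card (neighbors V E v)" if "v \<in> V" for v
        using a that t2 unfolding d_def by force
      then have "has_Kt_topological_minor V E t" using G ne t by (intro min_degree_topological_minor) (auto simp: \<G>_def)
      then show False using G by (simp add: \<G>_def)
    qed
  qed (use V g nm in \<open>auto simp: \<G>_def\<close>)
  moreover have "d + 3 = 10 * t ^ 2 + 2" using t2 by (simp add: d_def)
  ultimately show ?thesis by (metis dynamically_colorable_if_bounded_palette)
qed

theorem theorem6p3:
  fixes V :: "'a set" and E :: "'a \<Rightarrow> 'a \<Rightarrow> bool" and t :: nat
  assumes "t \<ge> 1" and "simple_graph V E"
  shows "(\<not> has_Kt_topological_minor V E t \<longrightarrow> dynamically_colorable V E (10 * t ^ 2 + 2))
       \<and> (\<not> has_Kt_minor V E t \<longrightarrow>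
            dynamically_colorable V E (nat \<lfloor>16 * real t * sqrt (log 2 (real t))\<rfloor> + 3))"
proof -
  have "finite V" "ugraph E" using assms(2) by (auto simp: simple_graph_def ugraph_def)
  then show ?thesis
    using dynamically_colorable_no_topological_minor dynamically_colorable_no_minor assms(1) by blast
qed

end
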